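(* Let $N \in \mathbb{N}$ and let $p : \mathbb{Z} \to \mathbb{Z}$ be a quasi-polynomial of the form $$p(t) = \sum_{i=1}^{r} \gamma_i \prod_{j=1}^{n} \bigl\lfloor \alpha_{ij} t + \beta_{ij} \bigr\rfloor,$$ with $\gamma_i \in \mathbb{Z}$ and $\alpha_{ij}, \beta_{ij} \in \mathbb{Q}$ for $1 \le i \le r$, $1 \le j \le n$. Then there exist a rational convex polytope $Q \subset \mathbb{R}^{d}$ and integers $K, M \in \mathbb{N}$ such that $$p(t) + K = f_Q(t+M) \quad \text{for every } 0 \le t < N.$$ Moreover, $d = O(n + \lceil \log r \rceil)$, the polytope $Q$ has at most $r\,4^{n+1}$ vertices, and the vertices of $Q$ and the constants $K, M$ can be computed in polynomial time.
   Context: For a rational convex polytope $Q \subset \mathbb{R}^d$ and $t \in \mathbb{N}$, $f_Q(t) := \#(tQ \cap \mathbb{Z}^d)$ is the number of integer points in the dilate $tQ = \{t x : x \in Q\}$ (the Ehrhart quasi-polynomial of $Q$). A rational polytope is one whose vertices all have rational coordinates. *)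

theory Defs
  imports
    "HOL-Analysis.Analysis"
    "HOL-Analysis.Finite_Function_Topology"
    "HOL-Library.Log_Nat"
    "HOL-Computational_Algebra.Polynomial"
begin

section \<open>Quasi-polynomials given by floor expressions\<close>

definition floor_quasi_poly ::
  "nat \<Rightarrow> nat \<Rightarrow> (nat \<Rightarrow> int) \<Rightarrow> (nat \<Rightarrow> nat \<Rightarrow> rat) \<Rightarrow> (nat \<Rightarrow> nat \<Rightarrow> rat) \<Rightarrow> int \<Rightarrow> int" where
  "floor_quasi_poly r n \<gamma> \<alpha> \<beta> t =
     (\<Sum>i\<in>{1..r}. \<gamma> i * (\<Prod>j\<in>{1..n}. \<lfloor>\<alpha> i j * of_int t + \<beta> i j\<rfloor>))"

section \<open>Rational polytopes in a space of variable dimension\<close>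

text \<open>
  The dimension depends on the input, so it cannot be a type. \<open>\<real>\<^sup>d\<close> is the subspace of the
  finitely supported sequences \<open>nat \<Rightarrow>\<^sub>0 real\<close> whose support lies in \<open>{..<d}\<close>; convex hulls,
  polytopes and extreme points (vertices) of subsets do not depend on the ambient vector space.
\<close>

type_synonym seqspace = "nat \<Rightarrow>\<^sub>0 real"

definition euclidean :: "nat \<Rightarrow> seqspace set" where
  "euclidean d = {x. Poly_Mapping.keys x \<subseteq> {..<d}}"

definition integer_points :: "seqspace set" where
  "integer_points = {x. \<forall>i. Poly_Mapping.lookup x i \<in> \<int>}"

definition vertices :: "seqspace set \<Rightarrow> seqspace set" where
  "vertices Q = {v. v extreme_point_of Q}"

definition rational_polytope :: "nat \<Rightarrow> seqspace set \<Rightarrow> bool" where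
  "rational_polytope d Q \<longleftrightarrow>
     polytope Q \<and> Q \<subseteq> euclidean d \<and> (\<forall>v\<in>vertices Q. \<forall>i. Poly_Mapping.lookup v i \<in> \<rat>)"

definition ehrhart :: "seqspace set \<Rightarrow> nat \<Rightarrow> nat" where
  "ehrhart Q t = card ((\<lambda>x. real t *\<^sub>R x) ` Q \<inter> integer_points)"

section \<open>Machine model: random access machine with logarithmic cost\<close>

text \<open>
  Structured programs over a memory of integer cells with indirect addressing. Every integer
  that is computed or used as an address is charged its bit length (the logarithmic cost
  criterion), so that running times are polynomially related to those of Turing machines, also
  in the presence of multiplication and division.
\<close>

definition bits :: "int \<Rightarrow> nat" where
  "bits x = floorlog 2 (nat \<bar>x\<bar>) + 1"

definition bit_size :: "int list \<Rightarrow> nat" where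
  "bit_size xs = (\<Sum>x\<leftarrow>xs. bits x)"

type_synonym memory = "int \<Rightarrow> int"

datatype expr =
    Const int
  | Cell expr
  | Add expr expr
  | Sub expr expr
  | Mul expr expr
  | Div expr expr

fun val :: "expr \<Rightarrow> memory \<Rightarrow> int" where
  "val (Const c) m = c"
| "val (Cell a) m = m (val a m)"
| "val (Add a b) m = val a m + val b m"
| "val (Sub a b) m = val a m - val b m"
| "val (Mul a b) m = val a m * val b m"
| "val (Div a b) m = val a m div val b m"

fun cost :: "expr \<Rightarrow> memory \<Rightarrow> nat" where
  "cost (Const c) m = bits c"
| "cost (Cell a) m = cost a m + bits (val (Cell a) m)"
| "cost (Add a b) m = cost a m + cost b m + bits (val (Add a b) m)"
| "cost (Sub a b) m = cost a m + cost b m + bits (val (Sub a b) m)"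
| "cost (Mul a b) m = cost a m + cost b m + bits (val (Mul a b) m)"
| "cost (Div a b) m = cost a m + cost b m + bits (val (Div a b) m)"

text \<open>
  \<open>Assign a e\<close> stores the value of \<open>e\<close> in the cell whose address is the value of \<open>a\<close>; the guards
  of \<open>Cond\<close> and \<open>While\<close> hold when their value is positive.
\<close>

datatype program =
    Skip
  | Assign expr expr
  | Seq program program
  | Cond expr program program
  | While expr program

inductive exec :: "program \<Rightarrow> memory \<Rightarrow> nat \<Rightarrow> memory \<Rightarrow> bool" where
  Skip: "exec Skip m 1 m"
| Assign: "exec (Assign a e) m (cost a m + cost e m + 1) (m(val a m := val e m))"
| Seq: "exec P m s m' \<Longrightarrow> exec P' m' s' m'' \<Longrightarrow> exec (Seq P P') m (s + s') m''"
| CondTrue: "val e m > 0 \<Longrightarrow> exec P m s m' \<Longrightarrow> exec (Cond e P P') m (cost e m + 1 + s) m'"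
| CondFalse: "\<not> val e m > 0 \<Longrightarrow> exec P' m s m' \<Longrightarrow> exec (Cond e P P') m (cost e m + 1 + s) m'"
| WhileTrue: "val e m > 0 \<Longrightarrow> exec P m s m' \<Longrightarrow> exec (While e P) m' s' m'' \<Longrightarrow>
    exec (While e P) m (cost e m + 1 + s + s') m''"
| WhileFalse: "\<not> val e m > 0 \<Longrightarrow> exec (While e P) m (cost e m + 1) m"

text \<open>
  A list \<open>xs\<close> is stored with its length in cell 0 and its entries in cells 1, ..., \<open>length xs\<close>.
  Initially all other cells are 0; at the end they are arbitrary.
\<close>

definition initial_memory :: "int list \<Rightarrow> memory" where
  "initial_memory xs = (\<lambda>a. if a = 0 then int (length xs)
     else if 1 \<le> a \<and> a \<le> int (length xs) then xs ! nat (a - 1) else 0)"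

definition holds_list :: "memory \<Rightarrow> int list \<Rightarrow> bool" where
  "holds_list m ys \<longleftrightarrow> m 0 = int (length ys) \<and> (\<forall>i<length ys. m (int i + 1) = ys ! i)"

text \<open>
  The output is charged as well: otherwise setting cell 0 to a huge number would
  return a long list of untouched cells in little time.
\<close>

definition computes :: "program \<Rightarrow> int list \<Rightarrow> int list \<Rightarrow> nat \<Rightarrow> bool" where
  "computes P xs ys T \<longleftrightarrow>
     (\<exists>s m. exec P (initial_memory xs) s m \<and> holds_list m ys \<and> T = s + bit_size ys)"

section \<open>Input and output formats\<close>

definition encode_rat :: "rat \<Rightarrow> int list" where
  "encode_rat q = [fst (quotient_of q), snd (quotient_of q)]"

definition encode_input ::
  "nat \<Rightarrow> nat \<Rightarrow> nat \<Rightarrow> (nat \<Rightarrow> int) \<Rightarrow> (nat \<Rightarrow> nat \<Rightarrow> rat) \<Rightarrow> (nat \<Rightarrow> nat \<Rightarrow> rat) \<Rightarrow> int list" where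
  "encode_input N r n \<gamma> \<alpha> \<beta> =
     [int N, int r, int n] @ map \<gamma> [1..<Suc r] @
     concat (map (\<lambda>i. concat (map (\<lambda>j. encode_rat (\<alpha> i j) @ encode_rat (\<beta> i j)) [1..<Suc n]))
       [1..<Suc r])"

definition point_of_fractions :: "(int \<times> int) list \<Rightarrow> seqspace" where
  "point_of_fractions v =
     (\<Sum>i<length v. Poly_Mapping.single i (of_int (fst (v ! i)) / of_int (snd (v ! i))))"

text \<open>
  The list \<open>ys\<close> describes a finite set \<open>V\<close> of points of \<open>\<real>\<^sup>d\<close> together with \<open>d\<close>, \<open>K\<close> and \<open>M\<close>. The
  coordinates are fractions with positive denominators, not necessarily in lowest terms, and a
  point may be listed more than once.
\<close>

definition encodes_output ::
  "nat \<Rightarrow> seqspace set \<Rightarrow> nat \<Rightarrow> nat \<Rightarrow> int list \<Rightarrow> bool" where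
  "encodes_output d V K M ys \<longleftrightarrow>
     (\<exists>vs. (\<forall>v\<in>set vs. length v = d \<and> (\<forall>(a, b)\<in>set v. b > 0)) \<and>
           V = point_of_fractions ` set vs \<and>
           ys = [int d, int K, int M, int (length vs)] @
                concat (map (\<lambda>v. concat (map (\<lambda>(a, b). [a, b]) v)) vs))"

end

theory Submission
  imports Defs
begin

text \<open>
  The idea is a projective transformation. Let \<open>P\<close> be a polytope of points
  \<open>(t, x)\<close> with \<open>0 \<le> t \<le> L < M\<close> and let \<open>Q\<close> consist of the points \<open>(1, x) / (M + t)\<close>. In the dilate
  \<open>(M + t) Q\<close> the first coordinate lies strictly between 0 and 2, so at integer points it is 1, which
  means that \<open>x\<close> lies in the slice of \<open>P\<close> at \<open>t\<close>. Hence slices that depend on \<open>t\<close> in an inhomogeneous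
  and even decreasing way can be counted. Labelling finitely many such \<open>P\<close> with distinct 0/1-vectors
  and taking the convex hull adds up their counts at the cost of logarithmically many dimensions.

  Each slice is a simplex: the equations \<open>D\<^sub>j y\<^sub>j + y'\<^sub>j = A\<^sub>j t + E\<^sub>j\<close> over the naturals, which have
  \<open>\<Prod>\<^sub>j (\<lfloor>(A\<^sub>j t + E\<^sub>j) / D\<^sub>j\<rfloor> + 1)\<close> solutions, are read as the digits of one equation. Therefore a product
  of \<open>n\<close> floors needs only \<open>O(n)\<close> vertices instead of the \<open>2\<^sup>n\<close> vertices of a box, which keeps the
  running time polynomial even for variable \<open>n\<close>.

  Signs are removed in two steps. The vanishing \<open>(n+1)\<close>-st difference of \<open>y \<mapsto> \<Prod>\<^sub>j (x\<^sub>j + y)\<close> at the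
  points \<open>0, S, 2S, \<dots>\<close> expresses \<open>\<Prod>\<^sub>j x\<^sub>j\<close> by \<open>n + 1\<close> products of positive factors, and a negative
  multiple of \<open>\<Prod>\<^sub>j z\<^sub>j\<close> with \<open>0 \<le> z\<^sub>j \<le> C\<close> becomes, up to the constant \<open>C\<^sup>n\<close>, a sum of \<open>n\<close> positive
  products by telescoping. The constants make up \<open>K\<close>.
\<close>

section \<open>Polytopes given by finitely many points\<close>

text \<open>Two obstacles fix the parameters. The coefficients, products of the given ones with
  binomials, may be exponentially large and cannot be realized by repeating pieces. Each enters as
  one more digit row with exactly that many solutions, so a piece with n factors has n + 1 rows and
  2 (n + 1) axes. Moreover the factors must be positive and bounded uniformly in t, while all
  numbers keep polynomially many bits. One scale X achieves both, the product of x^2 + 2 over the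
  input entries and their number: it exceeds every entry as well as 2^(n+1), hence the binomials,
  and its bit length is linear in the input size. All numbers are then at most X^(12n+40). Removing
  the signs leaves at most n (n + 1) pieces per summand, each with 4 (n + 1) vertices because there
  are two ends. The product is at most 4^(n+1) except at n = 2, where the alternation of the signs
  has to be taken into account. Fewer than r (n + 1)^2 label codes are possible or exactly as many,
  so about log r + 2 n label bits suffice and the dimension is linear in n + log r.\<close>

abbreviation lookup :: "seqspace \<Rightarrow> nat \<Rightarrow> real" where "lookup \<equiv> Poly_Mapping.lookup"

lemma lookup_scaleR: "lookup (a *\<^sub>R x) c = a *\<^sub>R lookup x c"
proof -
  have "finite {i. a *\<^sub>R lookup x i \<noteq> 0}"
    by (rule finite_subset[of _ "Poly_Mapping.keys x"]) (auto simp: in_keys_iff)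
  then show ?thesis
    by (simp add: scaleR_poly_mapping_def Abs_poly_mapping_inverse)
qed

text \<open>Indexing by \<open>J\<close> instead of by the points themselves allows \<open>f\<close>
  to take a value repeatedly: the weight of a point goes to one chosen preimage.\<close>

lemma convex_hull_indexed:
  assumes "finite J"
  shows "x \<in> convex hull (f ` J) \<longleftrightarrow>
    (\<exists>u. (\<forall>j\<in>J. 0 \<le> u j) \<and> sum u J = (1::real) \<and> (\<Sum>j\<in>J. u j *\<^sub>R f j) = x)"
proof
  assume x: "x \<in> convex hull (f ` J)"
  obtain J' where J': "J' \<subseteq> J" "inj_on f J'" "f ` J' = f ` J"
    by (metis subset_image_inj order_refl)
  from x obtain w where w: "\<forall>p\<in>f ` J. 0 \<le> w p" "sum w (f ` J) = 1" "(\<Sum>p\<in>f ` J. w p *\<^sub>R p) = x"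
    using assms by (auto simp: convex_hull_finite)
  define u where "u j = (if j \<in> J' then w (f j) else 0)" for j
  have "sum u J = sum w (f ` J')"
    unfolding sum.reindex[OF J'(2)] using J'(1) assms
    by (intro sum.mono_neutral_cong_right) (auto simp: u_def)
  moreover have "(\<Sum>j\<in>J. u j *\<^sub>R f j) = (\<Sum>p\<in>f ` J'. w p *\<^sub>R p)"
    unfolding sum.reindex[OF J'(2)] using J'(1) assms
    by (intro sum.mono_neutral_cong_right) (auto simp: u_def)
  ultimately show "\<exists>u. (\<forall>j\<in>J. 0 \<le> u j) \<and> sum u J = 1 \<and> (\<Sum>j\<in>J. u j *\<^sub>R f j) = x"
    using w J' by (intro exI[of _ u]) (auto simp: u_def)
next
  assume "\<exists>u. (\<forall>j\<in>J. 0 \<le> u j) \<and> sum u J = 1 \<and> (\<Sum>j\<in>J. u j *\<^sub>R f j) = x"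
  then obtain u where u: "\<forall>j\<in>J. 0 \<le> u j" "sum u J = 1" "(\<Sum>j\<in>J. u j *\<^sub>R f j) = x" by blast
  show "x \<in> convex hull (f ` J)"
    using convex_sum[OF assms convex_convex_hull u(2), of f "f ` J"] u
    by (auto intro: hull_inc)
qed

text \<open>Mixing the coefficients of the two ends of a segment through \<open>f j0\<close>
  represents \<open>f j0\<close>, so every index with positive weight at either end is mapped to
  \<open>f j0\<close>. Both ends then equal \<open>f j0\<close>.\<close>

lemma extreme_point_of_indexed_hull:
  assumes J: "finite J" "j0 \<in> J"
    and uniq: "\<And>u. (\<forall>j\<in>J. 0 \<le> u j) \<Longrightarrow> sum u J = (1::real) \<Longrightarrow> (\<Sum>j\<in>J. u j *\<^sub>R f j) = f j0 \<Longrightarrow>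
      (\<forall>j\<in>J. 0 < u j \<longrightarrow> f j = f j0)"
  shows "f j0 extreme_point_of convex hull (f ` J)"
  unfolding extreme_point_of_def
proof (intro conjI ballI notI)
  show "f j0 \<in> convex hull (f ` J)"
    using J by (auto intro: hull_inc)
  fix a b assume a: "a \<in> convex hull (f ` J)" and b: "b \<in> convex hull (f ` J)"
    and seg: "f j0 \<in> open_segment a b"
  from seg obtain s where s: "0 < s" "s < 1" "f j0 = (1 - s) *\<^sub>R a + s *\<^sub>R b" and "a \<noteq> b"
    by (auto simp: in_segment)
  obtain u where u: "\<forall>j\<in>J. 0 \<le> u j" "sum u J = 1" "(\<Sum>j\<in>J. u j *\<^sub>R f j) = a"
    using a J(1) by (auto simp: convex_hull_indexed)
  obtain w where w: "\<forall>j\<in>J. 0 \<le> w j" "sum w J = 1" "(\<Sum>j\<in>J. w j *\<^sub>R f j) = b"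
    using b J(1) by (auto simp: convex_hull_indexed)
  let ?q = "\<lambda>j. (1 - s) * u j + s * w j"
  have "\<forall>j\<in>J. 0 < ?q j \<longrightarrow> f j = f j0"
  proof (rule uniq)
    show "\<forall>j\<in>J. 0 \<le> ?q j" using u(1) w(1) s by auto
    show "sum ?q J = 1"
      using u(2) w(2) by (simp add: sum.distrib sum_distrib_left[symmetric])
    show "(\<Sum>j\<in>J. ?q j *\<^sub>R f j) = f j0"
      unfolding s(3) u(3)[symmetric] w(3)[symmetric]
      by (simp add: scaleR_add_left sum.distrib scaleR_sum_right)
  qed
  then have eq: "f j = f j0" if "j \<in> J" "u j \<noteq> 0 \<or> w j \<noteq> 0" for j
  proof -
    have "0 \<le> u j" "0 \<le> w j" using u(1) w(1) that by auto
    then have "0 < (1 - s) * u j \<and> 0 \<le> s * w j \<or> 0 \<le> (1 - s) * u j \<and> 0 < s * w j"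
      using that s by (auto simp: less_le)
    then have "0 < ?q j" by auto
    then show ?thesis using \<open>\<forall>j\<in>J. 0 < ?q j \<longrightarrow> f j = f j0\<close> that by auto
  qed
  have "a = (\<Sum>j\<in>J. u j *\<^sub>R f j0)"
    unfolding u(3)[symmetric] by (intro sum.cong refl) (use eq in \<open>force\<close>)
  moreover have "b = (\<Sum>j\<in>J. w j *\<^sub>R f j0)"
    unfolding w(3)[symmetric] by (intro sum.cong refl) (use eq in \<open>force\<close>)
  ultimately have "a = b"
    using u(2) w(2) by (simp add: scaleR_sum_left[symmetric])
  with \<open>a \<noteq> b\<close> show False by simp
qed

section \<open>A projective union of simplices\<close>

text \<open>
  Piece \<open>i\<close> is the family of simplices with vertices \<open>R i e / W i v\<close> on the axes \<open>h + v\<close>, where \<open>e\<close> tells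
  the ends \<open>t = 0\<close> and \<open>t = L\<close> apart. Label bit 0 is always set, so coordinate 0 is the homogenizing one.
\<close>

locale simplex_bundle =
  fixes h V :: nat and I :: "'i set" and lab :: "'i \<Rightarrow> nat \<Rightarrow> bool"
    and W :: "'i \<Rightarrow> nat \<Rightarrow> real" and R :: "'i \<Rightarrow> bool \<Rightarrow> real" and M L :: nat
  assumes finite_I: "finite I" and h_pos: "0 < h"
    and lab_0: "i \<in> I \<Longrightarrow> lab i 0"
    and lab_inj: "i \<in> I \<Longrightarrow> i' \<in> I \<Longrightarrow> (\<And>c. c < h \<Longrightarrow> lab i c = lab i' c) \<Longrightarrow> i = i'"
    and W_pos: "i \<in> I \<Longrightarrow> v < V \<Longrightarrow> 0 < W i v"
    and R_pos: "i \<in> I \<Longrightarrow> 0 < R i e"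
    and L_pos: "0 < L" and L_less: "L < M"
begin

text \<open>The value of M + t at the two ends; dividing by it is the projective map.\<close>

definition U :: "bool \<Rightarrow> real" where "U e = (if e then real (M + L) else real M)"

definition coord :: "'i \<Rightarrow> bool \<Rightarrow> nat \<Rightarrow> nat \<Rightarrow> real" where
  "coord i e v c = (if c < h then of_bool (lab i c) else if c = h + v then R i e / W i v else 0)"

definition corner :: "'i \<times> bool \<times> nat \<Rightarrow> seqspace" where
  "corner = (\<lambda>(i, e, v). \<Sum>c<h + V. Poly_Mapping.single c (coord i e v c / U e))"

definition index :: "('i \<times> bool \<times> nat) set" where
  "index = I \<times> UNIV \<times> {..<V}"

definition Q :: "seqspace set" where
  "Q = convex hull (corner ` index)"

text \<open>The affine function of t through the values of \<open>R\<close> at the ends 0 and L; it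
  is the size of the simplex slice at t.\<close>

definition level :: "'i \<Rightarrow> nat \<Rightarrow> real" where
  "level i t = ((real L - real t) * R i False + real t * R i True) / real L"

definition sols :: "'i \<Rightarrow> nat \<Rightarrow> (nat \<Rightarrow> nat) set" where
  "sols i t = {y. (\<forall>v\<ge>V. y v = 0) \<and> (\<Sum>v<V. W i v * real (y v)) = level i t}"

lemma finite_index [simp]: "finite index"
  using finite_I by (simp add: index_def)

lemma U_pos [simp]: "0 < U e"
  using L_less by (auto simp: U_def)

lemma U_nonzero [simp]: "U e \<noteq> 0"
  using U_pos[of e] by linarith

lemma U_nonneg [simp]: "0 \<le> U e"
  using U_pos[of e] by linarith

lemma W_nonneg: "i \<in> I \<Longrightarrow> v < V \<Longrightarrow> 0 \<le> W i v"
  and R_nonneg: "i \<in> I \<Longrightarrow> 0 \<le> R i e"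
  by (simp_all add: W_pos R_pos less_imp_le)

lemma lookup_corner:
  assumes "v < V"
  shows "lookup (corner (i, e, v)) c = coord i e v c / U e"
proof -
  have "lookup (corner (i, e, v)) c = (\<Sum>k<h + V. if k = c then coord i e v k / U e else 0)"
    by (simp add: corner_def lookup_sum lookup_single when_def)
  also have "\<dots> = coord i e v c / U e"
    using assms by (auto simp: coord_def)
  finally show ?thesis .
qed

lemma lookup_comb:
  "lookup (\<Sum>j\<in>index. u j *\<^sub>R corner j) c =
    (\<Sum>(i, e, v)\<in>index. u (i, e, v) * coord i e v c / U e)"
  unfolding lookup_sum lookup_scaleR
  by (intro sum.cong) (auto simp: index_def lookup_corner)

lemma sum_index_single:
  assumes i: "i \<in> I" and zero: "\<And>i' e v. (i', e, v) \<in> index \<Longrightarrow> i' \<noteq> i \<Longrightarrow> w (i', e, v) = 0"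
  shows "(\<Sum>(i', e, v)\<in>index. w (i', e, v) * f i' e v) =
    (\<Sum>v<V. w (i, False, v) * f i False v + w (i, True, v) * f i True v :: real)"
proof -
  have "(\<Sum>(i', e, v)\<in>index. w (i', e, v) * f i' e v) =
    (\<Sum>i'\<in>I. if i' = i then \<Sum>e\<in>UNIV. \<Sum>v<V. w (i', e, v) * f i' e v else 0)"
    unfolding index_def sum.cartesian_product[symmetric]
    by (intro sum.cong refl) (auto simp: zero index_def)
  also have "\<dots> = (\<Sum>e\<in>UNIV. \<Sum>v<V. w (i, e, v) * f i e v)" using i finite_I by simp
  also have "\<dots> = (\<Sum>v<V. \<Sum>e\<in>UNIV. w (i, e, v) * f i e v)" by (rule sum.swap)
  finally show ?thesis by (simp add: UNIV_bool)
qed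

lemma polytope_Q: "polytope Q"
  unfolding Q_def polytope_def using finite_index by (blast intro: finite_imageI)

lemma Q_euclidean: "Q \<subseteq> euclidean (h + V)"
proof
  fix x assume "x \<in> Q"
  then obtain u where "x = (\<Sum>j\<in>index. u j *\<^sub>R corner j)"
    unfolding Q_def convex_hull_indexed[OF finite_index] by blast
  then have "lookup x c = 0" if "\<not> c < h + V" for c
    unfolding \<open>x = _\<close> lookup_comb using that
    by (intro sum.neutral) (auto simp: coord_def index_def)
  then show "x \<in> euclidean (h + V)"
    by (auto simp: euclidean_def in_keys_iff)
qed

text \<open>Each label coordinate is a weighted mean of bits and lies in [0, 1]. Being an integer it
  is 0 or 1, so the bits over the support are all clear or all set. This prevents integer points
  from mixing different pieces.\<close>

lemma lab_constant:
  assumes \<mu>: "\<And>j. j \<in> index \<Longrightarrow> 0 \<le> \<mu> j" "sum \<mu> index = (1::real)"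
    and int: "\<And>c. c < h \<Longrightarrow> (\<Sum>j\<in>index. \<mu> j * of_bool (lab (fst j) c)) \<in> \<int>"
    and j: "j \<in> index" "0 < \<mu> j" and j': "j' \<in> index" "0 < \<mu> j'"
  shows "fst j = fst j'"
proof (rule lab_inj)
  show "fst j \<in> I" "fst j' \<in> I" using j j' by (auto simp: index_def)
  fix c assume c: "c < h"
  let ?x = "\<Sum>j\<in>index. \<mu> j * of_bool (lab (fst j) c)"
  let ?y = "\<Sum>j\<in>index. \<mu> j * of_bool (\<not> lab (fst j) c)"
  have xy: "?x + ?y = 1"
    unfolding \<mu>(2)[symmetric] sum.distrib[symmetric] by (intro sum.cong) auto
  have nn: "0 \<le> ?x" "0 \<le> ?y" using \<mu>(1) by (auto intro!: sum_nonneg)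
  obtain z where z: "?x = of_int z" using int[OF c] by (auto elim: Ints_cases)
  have "z = 0 \<or> z = 1" using nn xy unfolding z by linarith
  then have "?x = 0 \<or> ?y = 0" using xy z by auto
  then show "lab (fst j) c = lab (fst j') c"
  proof
    assume "?x = 0"
    then have "\<forall>j\<in>index. \<mu> j * of_bool (lab (fst j) c) = 0"
      using \<mu>(1) by (subst (asm) sum_nonneg_eq_0_iff) auto
    then show ?thesis using j j' by force
  next
    assume "?y = 0"
    then have "\<forall>j\<in>index. \<mu> j * of_bool (\<not> lab (fst j) c) = 0"
      using \<mu>(1) by (subst (asm) sum_nonneg_eq_0_iff) auto
    then show ?thesis using j j' by force
  qed
qed

text \<open>The coordinates pin down end, piece and axis in this order: coordinate 0 of a corner is
  1 / \<open>U e\<close>, the label coordinates form a vertex of the 0/1-cube, and a vanishing axis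
  coordinate excludes every other axis.\<close>

lemma corner_extreme:
  assumes j0: "j0 \<in> index"
  shows "corner j0 extreme_point_of Q"
  unfolding Q_def
proof (rule extreme_point_of_indexed_hull[OF finite_index j0], intro ballI impI)
  fix u j assume u: "\<forall>j\<in>index. 0 \<le> u j" "sum u index = 1" "(\<Sum>j\<in>index. u j *\<^sub>R corner j) = corner j0"
    and j: "j \<in> index" "0 < u j"
  obtain i0 e0 v0 where j0': "j0 = (i0, e0, v0)" "i0 \<in> I" "v0 < V"
    using j0 by (auto simp: index_def)
  have look: "(\<Sum>(i, e, v)\<in>index. u (i, e, v) * coord i e v c / U e) = coord i0 e0 v0 c / U e0" for c
    using lookup_comb[of u c] lookup_corner[OF j0'(3)] u(3) by (simp add: j0')
  have "(\<Sum>j\<in>index. u j * (1 / U (fst (snd j)) - 1 / U e0)) =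
      (\<Sum>(i, e, v)\<in>index. u (i, e, v) * coord i e v 0 / U e) - 1 / U e0 * sum u index"
    unfolding sum_distrib_left sum_subtractf[symmetric] using h_pos lab_0
    by (intro sum.cong) (auto simp: coord_def index_def field_simps)
  also have "\<dots> = 0" unfolding look using j0' h_pos lab_0 u(2) by (simp add: coord_def)
  finally have sum0: "(\<Sum>j\<in>index. u j * (1 / U (fst (snd j)) - 1 / U e0)) = 0" .
  have U_mono: "1 / U True < 1 / U False"
    using L_pos L_less by (auto simp: U_def field_simps)
  \<comment> \<open>1 / \<open>U e0\<close> is the minimum or the maximum of the two possible
    values, so the terms of \<open>sum0\<close> all have the same sign and vanish one by
    one.\<close>
  have eps: "fst (snd k) = e0" if k: "k \<in> index" "0 < u k" for k
  proof (rule ccontr)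
    assume ne: "fst (snd k) \<noteq> e0"
    have "\<forall>j\<in>index. u j * (1 / U (fst (snd j)) - 1 / U e0) = 0"
    proof (cases e0)
      case True
      have "0 \<le> 1 / U e - 1 / U e0" for e using True U_mono by (cases e) auto
      then show ?thesis using sum0 u(1) by (subst (asm) sum_nonneg_eq_0_iff) auto
    next
      case False
      have *: "0 \<le> 1 / U e0 - 1 / U e" for e using False U_mono by (cases e) auto
      have "(\<Sum>j\<in>index. u j * (1 / U e0 - 1 / U (fst (snd j)))) = 0"
        using sum0 by (simp add: right_diff_distrib sum_subtractf)
      then show ?thesis using u(1) * by (subst (asm) sum_nonneg_eq_0_iff) force+
    qed
    then show False using k ne U_mono by (cases e0; cases "fst (snd k)") auto
  qed
  \<comment> \<open>Only the end \<open>e0\<close> occurs in the support, so the common denominator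
    \<open>U e0\<close> can be cleared.\<close>
  have scaled: "(\<Sum>(i, e, v)\<in>index. u (i, e, v) * coord i e v c) = coord i0 e0 v0 c" for c
  proof -
    have "(\<Sum>(i, e, v)\<in>index. u (i, e, v) * coord i e v c) =
      U e0 * (\<Sum>(i, e, v)\<in>index. u (i, e, v) * coord i e v c / U e)"
      unfolding sum_distrib_left
    proof (intro sum.cong refl, clarify)
      fix i e v assume "(i, e, v) \<in> index"
      then show "u (i, e, v) * coord i e v c = U e0 * (u (i, e, v) * coord i e v c / U e)"
        using eps[of "(i, e, v)"] u(1) U_pos[of e0] by (cases "u (i, e, v) = 0") (auto simp: less_le)
    qed
    then show ?thesis unfolding look using U_pos[of e0] by simp
  qed
  have const: "fst k = fst k'" if "k \<in> index" "0 < u k" "k' \<in> index" "0 < u k'" for k k'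
  proof (rule lab_constant[of u])
    fix c assume "c < h"
    then have "(\<Sum>j\<in>index. u j * of_bool (lab (fst j) c)) = (\<Sum>(i, e, v)\<in>index. u (i, e, v) * coord i e v c)"
      by (intro sum.cong) (auto simp: coord_def)
    then show "(\<Sum>j\<in>index. u j * of_bool (lab (fst j) c)) \<in> \<int>"
      using \<open>c < h\<close> unfolding scaled by (simp add: coord_def)
  qed (use u that in auto)
  have "fst j = i0"
  proof (rule lab_inj)
    show "fst j \<in> I" "i0 \<in> I" using j j0' by (auto simp: index_def)
    fix c assume c: "c < h"
    have "of_bool (lab i0 c) = (\<Sum>(i, e, v)\<in>index. u (i, e, v) * coord i e v c)"
      unfolding scaled using c by (simp add: coord_def)
    also have "\<dots> = (\<Sum>k\<in>index. u k * of_bool (lab (fst k) c))"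
      using c by (intro sum.cong refl) (auto simp: coord_def)
    also have "\<dots> = (\<Sum>k\<in>index. u k * of_bool (lab (fst j) c))"
      by (intro sum.cong refl) (use const[OF j] u(1) in \<open>force simp: less_le\<close>)
    also have "\<dots> = (of_bool (lab (fst j) c) :: real)"
      using u(2) by (simp add: sum_distrib_right[symmetric])
    finally show "lab (fst j) c = lab i0 c" by (simp only: of_bool_eq_iff)
  qed
  moreover have "snd (snd j) = v0"
  proof (rule ccontr)
    let ?v = "snd (snd j)"
    assume ne: "?v \<noteq> v0"
    have "(\<Sum>(i, e, v)\<in>index. u (i, e, v) * coord i e v (h + ?v)) = 0"
      unfolding scaled using ne by (simp add: coord_def)
    moreover have "0 \<le> (case k of (i, e, v) \<Rightarrow> u (i, e, v) * coord i e v (h + ?v))" if "k \<in> index" for k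
      using that u(1) by (auto simp: coord_def index_def W_nonneg R_nonneg intro!: mult_nonneg_nonneg divide_nonneg_nonneg)
    ultimately have "\<forall>k\<in>index. (case k of (i, e, v) \<Rightarrow> u (i, e, v) * coord i e v (h + ?v)) = 0"
      by (subst (asm) sum_nonneg_eq_0_iff) auto
    then have "(case j of (i, e, v) \<Rightarrow> u (i, e, v) * coord i e v (h + ?v)) = 0" using j by blast
    moreover have "0 < R (fst j) (fst (snd j)) / W (fst j) ?v"
      using j W_pos R_pos by (intro divide_pos_pos) (auto simp: index_def)
    ultimately show False using j by (auto simp: coord_def split: prod.splits)
  qed
  ultimately have "j = j0" using eps[OF j] j0' by (cases j) auto
  then show "corner j = corner j0" by simp
qed

lemma vertices_Q: "vertices Q = corner ` index"
  using corner_extreme extreme_point_of_convex_hull by (auto simp: vertices_def Q_def)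

lemma level_pos: "i \<in> I \<Longrightarrow> t \<le> L \<Longrightarrow> 0 < level i t"
  using R_pos[of i] L_pos unfolding level_def
  by (cases "t = 0") (auto simp: R_nonneg intro!: divide_pos_pos add_nonneg_pos mult_nonneg_nonneg)

definition lattice_point :: "'i \<Rightarrow> (nat \<Rightarrow> nat) \<Rightarrow> seqspace" where
  "lattice_point i y = (\<Sum>c<h + V. Poly_Mapping.single c
     (if c < h then of_bool (lab i c) else real (y (c - h))))"

lemma lookup_lattice_point:
  "lookup (lattice_point i y) c =
     (if c < h then of_bool (lab i c) else if c < h + V then real (y (c - h)) else 0)"
proof -
  have "lookup (lattice_point i y) c =
    (\<Sum>k<h + V. if k = c then (if k < h then of_bool (lab i k) else real (y (k - h))) else 0)"
    by (simp add: lattice_point_def lookup_sum lookup_single when_def)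
  then show ?thesis by simp
qed

lemma lattice_point_inj:
  assumes "i \<in> I" "i' \<in> I" "\<forall>v\<ge>V. y v = 0" "\<forall>v\<ge>V. y' v = 0" "lattice_point i y = lattice_point i' y'"
  shows "i = i' \<and> y = y'"
proof
  have eq: "lookup (lattice_point i y) c = lookup (lattice_point i' y') c" for c
    using assms by simp
  show "i = i'"
  proof (rule lab_inj[OF assms(1,2)])
    fix c assume "c < h"
    then show "lab i c = lab i' c" using eq[of c] by (simp add: lookup_lattice_point of_bool_eq_iff)
  qed
  show "y = y'"
  proof
    fix v show "y v = y' v"
      using eq[of "h + v"] assms(3,4) by (cases "v < V") (auto simp: lookup_lattice_point)
  qed
qed

lemma lattice_point_in_dilate:
  assumes i: "i \<in> I" and t: "t \<le> L" and y: "y \<in> sols i t"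
  shows "lattice_point i y \<in> (\<lambda>x. real (M + t) *\<^sub>R x) ` Q"
proof -
  define s where "s = real (M + t)"
  have s: "0 < s" using L_less by (simp add: s_def)
  \<comment> \<open>\<open>\<theta>\<close> locates t in [0, L]; the same two weights interpolate
    \<open>R\<close> to \<open>level\<close> and \<open>U\<close> to s.\<close>
  define \<theta> where "\<theta> e = (if e then real t / real L else (real L - real t) / real L)" for e
  have \<theta>: "0 \<le> \<theta> e" "\<theta> False + \<theta> True = 1" "\<theta> False * R i False + \<theta> True * R i True = level i t"
    "\<theta> False * U False + \<theta> True * U True = s" for e
    using t L_pos by (auto simp: \<theta>_def level_def U_def s_def field_simps)
  \<comment> \<open>The share of axis v in the slice is W y / level. The factor \<open>U e\<close> /
    s compensates for the division of the corners by \<open>U e\<close>; the weights still add up to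
    1 because \<open>\<theta>\<close> interpolates \<open>U\<close> to s.\<close>
  define u where "u = (\<lambda>(i', e, v). if i' = i then \<theta> e * (W i v * real (y v) / level i t) * U e / s else 0)"
  have ind: "(\<Sum>(i', e, v)\<in>index. u (i', e, v) * f i' e v) =
    (\<Sum>v<V. W i v * real (y v) / level i t * (\<theta> False * U False * f i False v + \<theta> True * U True * f i True v) / s)" for f
    by (subst sum_index_single[OF i]) (auto simp: u_def field_simps add_divide_distrib)
  have lev: "0 < level i t" by (rule level_pos[OF i t])
  have ysum: "(\<Sum>v<V. W i v * real (y v) / level i t) = 1"
    using y lev by (simp add: sols_def sum_divide_distrib[symmetric])
  have "(1 / s) *\<^sub>R lattice_point i y \<in> Q"
    unfolding Q_def convex_hull_indexed[OF finite_index]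
  proof (intro exI conjI)
    show "\<forall>j\<in>index. 0 \<le> u j"
      using \<theta>(1) s lev i by (auto simp: u_def index_def W_nonneg intro!: divide_nonneg_nonneg mult_nonneg_nonneg)
    have "sum u index = (\<Sum>(i', e, v)\<in>index. u (i', e, v) * 1)" by (simp add: case_prod_unfold)
    also have "\<dots> = (\<Sum>v<V. W i v * real (y v) / level i t)"
      unfolding ind using s by (simp add: \<theta>(4))
    finally show "sum u index = 1" by (simp add: ysum)
    show "(\<Sum>j\<in>index. u j *\<^sub>R corner j) = (1 / s) *\<^sub>R lattice_point i y"
    proof (rule poly_mapping_eqI)
      fix c
      have "lookup (\<Sum>j\<in>index. u j *\<^sub>R corner j) c =
        (\<Sum>(i', e, v)\<in>index. u (i', e, v) * (coord i' e v c / U e))"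
        unfolding lookup_comb by (intro sum.cong) auto
      also have "\<dots> = (\<Sum>v<V. W i v * real (y v) / level i t * (\<theta> False * coord i False v c + \<theta> True * coord i True v c) / s)"
        unfolding ind by simp
      also have "\<dots> = (if c < h then of_bool (lab i c) else if c < h + V then real (y (c - h)) else 0) / s"
      proof (cases "c < h")
        case True
        then have "\<theta> False * coord i False v c + \<theta> True * coord i True v c = of_bool (lab i c)" for v
          using \<theta>(2) by (simp add: coord_def distrib_right[symmetric])
        then show ?thesis using True ysum
          by (simp add: sum_divide_distrib[symmetric] sum_distrib_right[symmetric])
      next
        case False
        have "W i v * real (y v) / level i t * (\<theta> False * coord i False v c + \<theta> True * coord i True v c) / s =
          (if v = c - h then real (y v) / s else 0)" if "v < V" for v
        proof (cases "v = c - h")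
          case True
          have "\<theta> False * coord i False v c + \<theta> True * coord i True v c = level i t / W i v"
            using True False \<theta>(3) by (simp add: coord_def add_divide_distrib[symmetric])
          then show ?thesis using True lev W_pos[OF i that] by simp
        next
          case F: False
          then have "c \<noteq> h + v" by simp
          then show ?thesis using F False by (simp add: coord_def)
        qed
        then have "(\<Sum>v<V. W i v * real (y v) / level i t * (\<theta> False * coord i False v c + \<theta> True * coord i True v c) / s) =
          (\<Sum>v<V. if v = c - h then real (y v) / s else 0)" by (intro sum.cong) auto
        also have "\<dots> = (if c < h + V then real (y (c - h)) else 0) / s"
          using False by (auto simp: less_diff_conv2)
        finally show ?thesis using False by simp
      qed
      also have "\<dots> = lookup ((1 / s) *\<^sub>R lattice_point i y) c"
        by (simp add: lookup_scaleR lookup_lattice_point)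
      finally show "lookup (\<Sum>j\<in>index. u j *\<^sub>R corner j) c = lookup ((1 / s) *\<^sub>R lattice_point i y) c" .
    qed
  qed
  then show ?thesis
    using s unfolding s_def[symmetric] by (force intro!: image_eqI[of _ _ "(1 / s) *\<^sub>R lattice_point i y"])
qed

lemma integer_point_of_dilate:
  assumes t: "t \<le> L" and x: "x \<in> (\<lambda>x. real (M + t) *\<^sub>R x) ` Q" and int: "x \<in> integer_points"
  shows "\<exists>i\<in>I. \<exists>y\<in>sols i t. x = lattice_point i y"
proof -
  define s where "s = real (M + t)"
  have s: "0 < s" using L_less by (simp add: s_def)
  from x obtain u where u: "\<forall>j\<in>index. 0 \<le> u j" "sum u index = 1"
    and x_eq: "x = s *\<^sub>R (\<Sum>j\<in>index. u j *\<^sub>R corner j)"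
    unfolding Q_def by (auto simp: convex_hull_indexed s_def)
  \<comment> \<open>With the weights \<open>\<mu>\<close> the point is a combination of the corners
    before projection. Their sum is not 1 a priori, but it equals coordinate 0 and is therefore an
    integer.\<close>
  define \<mu> where "\<mu> j = s * u j / U (fst (snd j))" for j
  have \<mu>0: "0 \<le> \<mu> j" if "j \<in> index" for j
    using u(1) s that by (auto simp: \<mu>_def intro!: divide_nonneg_nonneg)
  have look: "lookup x c = (\<Sum>(i, e, v)\<in>index. \<mu> (i, e, v) * coord i e v c)" for c
    unfolding x_eq lookup_scaleR lookup_comb real_scaleR_def sum_distrib_left
    by (intro sum.cong) (auto simp: \<mu>_def)
  have "(\<Sum>(i, e, v)\<in>index. \<mu> (i, e, v) * coord i e v 0) = sum \<mu> index"
    using h_pos lab_0 by (intro sum.cong) (auto simp: coord_def index_def)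
  then have "sum \<mu> index = lookup x 0" unfolding look by simp
  then have "sum \<mu> index \<in> \<int>"
    using int by (simp add: integer_points_def)
  then obtain z where z: "sum \<mu> index = of_int z" by (auto elim: Ints_cases)
  have sU: "(\<Sum>j\<in>index. \<mu> j * U (fst (snd j))) = s"
    using u(2) by (simp add: \<mu>_def sum_distrib_left[symmetric])
  \<comment> \<open>\<open>U\<close> ranges between M and M + L, so the total weight z satisfies M z
    \<le> s \<le> (M + L) z. Since 0 < s and s = M + t < 2 M by L < M, only z = 1 is left.\<close>
  have "real M * of_int z \<le> s"
    unfolding sU[symmetric] z[symmetric] sum_distrib_left
    by (intro sum_mono) (auto simp: U_def mult.commute intro!: mult_right_mono \<mu>0)
  also have "s < real M * 2" using t L_less by (simp add: s_def)
  finally have "z < 2" using L_less by simp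
  moreover have "s \<le> real (M + L) * of_int z"
    unfolding sU[symmetric] z[symmetric] sum_distrib_left
  proof (intro sum_mono)
    fix j assume "j \<in> index"
    then show "\<mu> j * U (fst (snd j)) \<le> real (M + L) * \<mu> j"
      using \<mu>0[of j] mult_right_mono[of "U (fst (snd j))" "real (M + L)" "\<mu> j"]
      by (simp add: U_def mult.commute)
  qed
  then have "0 < real (M + L) * of_int z" using s by linarith
  then have "0 < z" by (simp add: zero_less_mult_iff)
  ultimately have \<mu>1: "sum \<mu> index = 1" using z by simp
  have const: "fst k = fst k'" if "k \<in> index" "0 < \<mu> k" "k' \<in> index" "0 < \<mu> k'" for k k'
  proof (rule lab_constant[of \<mu>])
    fix c assume "c < h"
    then have "(\<Sum>j\<in>index. \<mu> j * of_bool (lab (fst j) c)) = lookup x c"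
      unfolding look by (intro sum.cong) (auto simp: coord_def)
    then show "(\<Sum>j\<in>index. \<mu> j * of_bool (lab (fst j) c)) \<in> \<int>"
      using int by (simp add: integer_points_def)
  qed (use \<mu>0 \<mu>1 that in auto)
  have "\<not> (\<forall>k\<in>index. \<mu> k \<le> 0)"
    using sum_nonpos[of index \<mu>] \<mu>1 by auto
  then obtain k where k: "k \<in> index" "0 < \<mu> k" by (auto simp: not_le)
  define i where "i = fst k"
  have i: "i \<in> I" using k by (auto simp: i_def index_def)
  have only: "\<mu> j = 0" if "j \<in> index" "fst j \<noteq> i" for j
    using const[OF k that(1)] that \<mu>0[OF that(1)] by (auto simp: i_def less_le)
  have ind: "(\<Sum>(i', e, v)\<in>index. \<mu> (i', e, v) * f i' e v) =
    (\<Sum>v<V. \<mu> (i, False, v) * f i False v + \<mu> (i, True, v) * f i True v)" for f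
    by (rule sum_index_single[OF i]) (simp add: only)
  have xc: "lookup x (h + v) = (\<mu> (i, False, v) * R i False + \<mu> (i, True, v) * R i True) / W i v"
    if "v < V" for v
  proof -
    have "lookup x (h + v) = (\<Sum>v'<V. if v' = v then (\<mu> (i, False, v) * R i False + \<mu> (i, True, v) * R i True) / W i v else 0)"
      unfolding look ind by (intro sum.cong) (auto simp: coord_def add_divide_distrib)
    then show ?thesis using that by simp
  qed
  define y where "y v = (if v < V then nat \<lfloor>lookup x (h + v)\<rfloor> else 0)" for v
  have y: "real (y v) = lookup x (h + v)" if "v < V" for v
  proof -
    have "0 \<le> lookup x (h + v)"
      unfolding xc[OF that] using that \<mu>0 R_pos[OF i] W_pos[OF i that] i
      by (intro divide_nonneg_pos add_nonneg_nonneg mult_nonneg_nonneg) (auto simp: index_def R_nonneg)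
    moreover have "lookup x (h + v) \<in> \<int>" using int by (simp add: integer_points_def)
    ultimately show ?thesis using that by (auto simp: y_def elim: Ints_cases)
  qed
  define \<theta> where "\<theta> e = (\<Sum>v<V. \<mu> (i, e, v))" for e
  have \<theta>1: "\<theta> False + \<theta> True = 1"
    using ind[of "\<lambda>_ _ _. 1"] \<mu>1 by (simp add: \<theta>_def sum.distrib case_prod_unfold)
  \<comment> \<open>The mean of \<open>U\<close> under \<open>\<mu>\<close> is M + t, while
    \<open>U\<close> is either M or M + L; hence the far end carries the weight t / L.\<close>
  have "(\<Sum>j\<in>index. \<mu> j * U (fst (snd j))) = \<theta> False * real M + \<theta> True * real (M + L)"
    using ind[of "\<lambda>_ e _. U e"]
    by (simp add: \<theta>_def sum.distrib case_prod_unfold U_def sum_distrib_right)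
  then have "\<theta> False * real M + \<theta> True * real (M + L) = s" using sU by simp
  then have "(\<theta> False + \<theta> True) * real M + \<theta> True * real L = real M + real t"
    by (simp add: s_def algebra_simps)
  then have \<theta>t: "\<theta> True = real t / real L" using \<theta>1 L_pos by (simp add: field_simps)
  have "(\<Sum>v<V. W i v * real (y v)) = (\<Sum>v<V. \<mu> (i, False, v) * R i False + \<mu> (i, True, v) * R i True)"
  proof (intro sum.cong refl)
    fix v assume "v \<in> {..<V}"
    then show "W i v * real (y v) = \<mu> (i, False, v) * R i False + \<mu> (i, True, v) * R i True"
      using y[of v] xc[of v] W_pos[OF i, of v] by simp
  qed
  also have "\<dots> = \<theta> False * R i False + \<theta> True * R i True"
    by (simp add: \<theta>_def sum.distrib sum_distrib_right)
  also have "\<theta> False = (real L - real t) / real L" using \<theta>1 \<theta>t L_pos by (simp add: field_simps)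
  finally have "(\<Sum>v<V. W i v * real (y v)) = level i t"
    unfolding \<theta>t by (simp add: level_def add_divide_distrib)
  then have "y \<in> sols i t" by (simp add: sols_def y_def)
  moreover have "x = lattice_point i y"
  proof (rule poly_mapping_eqI)
    fix c show "lookup x c = lookup (lattice_point i y) c"
    proof (cases "c < h")
      case True
      then have "(\<Sum>v<V. \<mu> (i, False, v) * coord i False v c + \<mu> (i, True, v) * coord i True v c) =
        of_bool (lab i c) * (\<theta> False + \<theta> True)"
        by (simp add: \<theta>_def coord_def sum.distrib sum_distrib_left algebra_simps)
      then show ?thesis using True unfolding look ind by (simp add: \<theta>1 lookup_lattice_point)
    next
      case c: False
      show ?thesis
      proof (cases "c < h + V")
        case True
        then show ?thesis using c y[of "c - h"] by (simp add: lookup_lattice_point)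
      next
        case False
        then show ?thesis unfolding look
          by (subst sum.neutral) (auto simp: coord_def index_def lookup_lattice_point)
      qed
    qed
  qed
  ultimately show ?thesis using i by blast
qed

lemma lattice_point_integer: "lattice_point i y \<in> integer_points"
  by (auto simp: integer_points_def lookup_lattice_point)

theorem ehrhart_Q:
  assumes t: "t \<le> L" and fin: "\<And>i. i \<in> I \<Longrightarrow> finite (sols i t)"
  shows "ehrhart Q (t + M) = (\<Sum>i\<in>I. card (sols i t))"
proof -
  have "(\<lambda>x. real (M + t) *\<^sub>R x) ` Q \<inter> integer_points = (\<lambda>(i, y). lattice_point i y) ` (SIGMA i:I. sols i t)"
    (is "?A = ?B")
  proof (intro equalityI subsetI)
    fix x assume "x \<in> ?A"
    then obtain i y where "i \<in> I" "y \<in> sols i t" "x = lattice_point i y"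
      using integer_point_of_dilate[OF t, of x] by blast
    then show "x \<in> ?B" by auto
  next
    fix x assume "x \<in> ?B"
    then obtain i y where "i \<in> I" "y \<in> sols i t" "x = lattice_point i y" by auto
    then show "x \<in> ?A"
      using lattice_point_in_dilate[OF _ t] lattice_point_integer by simp
  qed
  moreover have "inj_on (\<lambda>(i, y). lattice_point i y) (SIGMA i:I. sols i t)"
  proof (rule inj_onI, clarify)
    fix i y i' y' assume "i \<in> I" "y \<in> sols i t" "i' \<in> I" "y' \<in> sols i' t" "lattice_point i y = lattice_point i' y'"
    then show "i = i' \<and> y = y'"
      by (intro lattice_point_inj) (auto simp: sols_def)
  qed
  ultimately have "ehrhart Q (t + M) = card (SIGMA i:I. sols i t)"
    unfolding ehrhart_def add.commute[of t] by (simp add: card_image)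
  then show ?thesis using finite_I fin by simp
qed

end

section \<open>Products of floors as numbers of solutions of one equation\<close>

lemma digits_unique:
  fixes u w :: "nat \<Rightarrow> int"
  assumes "\<And>j. j < k \<Longrightarrow> 0 \<le> u j \<and> u j < B \<and> 0 \<le> w j \<and> w j < B"
    and "(\<Sum>j<k. B ^ j * u j) = (\<Sum>j<k. B ^ j * w j)" and "j < k"
  shows "u j = w j"
  using assms
proof (induction k arbitrary: u w j)
  case (Suc k)
  have B: "0 < B" using Suc.prems(1)[of 0] by auto
  have split: "(\<Sum>j<Suc k. B ^ j * f j) = f 0 + B * (\<Sum>j<k. B ^ j * f (Suc j))" for f :: "nat \<Rightarrow> int"
    by (subst sum.lessThan_Suc_shift) (simp add: sum_distrib_left mult.assoc)
  have eq: "u 0 + B * (\<Sum>j<k. B ^ j * u (Suc j)) = w 0 + B * (\<Sum>j<k. B ^ j * w (Suc j))"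
    using Suc.prems(2) unfolding split .
  have "u 0 = (u 0 + B * (\<Sum>j<k. B ^ j * u (Suc j))) mod B"
    using Suc.prems(1)[of 0] by simp
  also have "\<dots> = w 0"
    unfolding eq using Suc.prems(1)[of 0] by simp
  finally have 0: "u 0 = w 0" .
  then have "(\<Sum>j<k. B ^ j * u (Suc j)) = (\<Sum>j<k. B ^ j * w (Suc j))"
    using eq B by simp
  then have "u (Suc j) = w (Suc j)" if "j < k" for j
    using Suc.IH[of "\<lambda>j. u (Suc j)" "\<lambda>j. w (Suc j)" j] Suc.prems(1) that by auto
  then show ?case using 0 Suc.prems(3) by (cases j) auto
qed simp

definition weight :: "nat \<Rightarrow> int \<Rightarrow> nat \<Rightarrow> int" where
  "weight k B j = B ^ (k + 1) + B ^ j"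

text \<open>The leading term of \<^const>\<open>weight\<close> bounds the sum of the unknowns, so that no carries can occur.\<close>

lemma weighted_sum_unique:
  fixes u w :: "nat \<Rightarrow> int"
  assumes u: "\<And>j. j < k \<Longrightarrow> 0 \<le> u j" and w: "\<And>j. j < k \<Longrightarrow> 0 \<le> w j" and B: "sum w {..<k} < B"
    and eq: "(\<Sum>j<k. weight k B j * u j) = (\<Sum>j<k. weight k B j * w j)" and j: "j < k"
  shows "u j = w j"
proof -
  have B0: "0 < B" using sum_nonneg[of "{..<k}" w] w B by auto
  let ?P = "B ^ (k + 1)" and ?lo = "\<lambda>f. \<Sum>j<k. B ^ j * f j"
  have split: "(\<Sum>j<k. weight k B j * f j) = sum f {..<k} * ?P + ?lo f" for f
    unfolding sum_distrib_right sum.distrib[symmetric]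
    by (intro sum.cong) (auto simp: weight_def algebra_simps)
  have lo0: "0 \<le> ?lo f" if "\<And>j. j < k \<Longrightarrow> 0 \<le> f j" for f
    using that B0 by (auto intro!: sum_nonneg)
  have lo: "?lo f < ?P" if f: "\<And>j. j < k \<Longrightarrow> 0 \<le> f j" "sum f {..<k} < B" for f
  proof -
    have "?lo f \<le> (\<Sum>j<k. B ^ k * f j)"
      using B0 f by (intro sum_mono mult_right_mono power_increasing) auto
    also have "\<dots> = B ^ k * sum f {..<k}" by (simp add: sum_distrib_left)
    also have "\<dots> < B ^ k * B" using B0 f(2) by (intro mult_strict_left_mono) auto
    finally show ?thesis by (simp add: mult.commute)
  qed
  \<comment> \<open>A surplus in the sum of the unknowns costs at least one unit of the leading
    power \<open>?P\<close>, more than the lower part of w can supply.\<close>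
  have "sum u {..<k} \<le> sum w {..<k}"
  proof (rule ccontr)
    assume "\<not> ?thesis"
    then have "(sum w {..<k} + 1) * ?P \<le> sum u {..<k} * ?P" using B0 by (intro mult_right_mono) auto
    moreover have "0 \<le> ?lo u" using u by (intro lo0)
    moreover have "?lo w < ?P" using w B by (intro lo)
    ultimately show False using eq unfolding split by (simp add: distrib_right)
  qed
  then have lou: "?lo u < ?P" using B u by (intro lo) auto
  have P0: "0 < ?P" using B0 by simp
  \<comment> \<open>Both lower parts are below \<open>?P\<close>, so reduction modulo
    \<open>?P\<close> isolates them.\<close>
  have "?lo u = (sum u {..<k} * ?P + ?lo u) mod ?P"
    using lou u lo0[of u] by simp
  also have "\<dots> = ?lo w"
    using eq unfolding split using w lo0[of w] lo[of w] B by simp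
  finally have los: "?lo u = ?lo w" .
  have ub: "u j < B" if "j < k" for j
    using that u member_le_sum[of j "{..<k}" u] \<open>sum u {..<k} \<le> sum w {..<k}\<close> B by fastforce
  have wb: "w j < B" if "j < k" for j
    using that w member_le_sum[of j "{..<k}" w] B by fastforce
  show ?thesis
    by (rule digits_unique[OF _ los j]) (use u w ub wb in auto)
qed

lemma sum_pairs: "(\<Sum>v<2 * k. f v) = (\<Sum>j<k. f (2 * j) + f (2 * j + 1))"
  for f :: "nat \<Rightarrow> 'a::comm_monoid_add"
  by (induction k) (auto simp: add.assoc)

text \<open>Slot 2 j holds the unknown of digit j with coefficient \<open>d j\<close>, slot 2 j + 1
  its slack with coefficient 1; both carry the weight of that digit.\<close>

definition slot_weight :: "nat \<Rightarrow> int \<Rightarrow> (nat \<Rightarrow> int) \<Rightarrow> nat \<Rightarrow> int" where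
  "slot_weight k B d v = weight k B (v div 2) * (if even v then d (v div 2) else 1)"

text \<open>The weights split the equation into k separate equations d_j y_j + y'_j = q_j. In each,
  y_j ranges freely over 0, ..., q_j div d_j and determines the slack, so the numbers of choices
  multiply.\<close>

lemma card_solutions:
  fixes d q :: "nat \<Rightarrow> int"
  assumes d: "\<And>j. j < k \<Longrightarrow> 0 < d j" and q: "\<And>j. j < k \<Longrightarrow> 0 \<le> q j" and B: "sum q {..<k} < B"
  defines "S \<equiv> {y :: nat \<Rightarrow> nat. (\<forall>v\<ge>2 * k. y v = 0) \<and>
    (\<Sum>v<2 * k. slot_weight k B d v * int (y v)) = (\<Sum>j<k. weight k B j * q j)}"
  shows "finite S" and "int (card S) = (\<Prod>j<k. q j div d j + 1)"
proof -
  let ?T = "PiE {..<k} (\<lambda>j. {..nat (q j div d j)})"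
  define G where "G x v = (if v < 2 * k then if even v then x (v div 2)
    else nat (q (v div 2) - d (v div 2) * int (x (v div 2))) else 0)" for x :: "nat \<Rightarrow> nat" and v :: nat
  have S_iff: "y \<in> S \<longleftrightarrow> (\<forall>v\<ge>2 * k. y v = 0) \<and> (\<forall>j<k. d j * int (y (2 * j)) + int (y (2 * j + 1)) = q j)"
    for y
  proof -
    have eq: "(\<Sum>v<2 * k. slot_weight k B d v * int (y v)) =
      (\<Sum>j<k. weight k B j * (d j * int (y (2 * j)) + int (y (2 * j + 1))))"
      unfolding sum_pairs by (simp add: slot_weight_def distrib_left mult.assoc)
    have "d j * int (y (2 * j)) + int (y (2 * j + 1)) = q j"
      if "(\<Sum>v<2 * k. slot_weight k B d v * int (y v)) = (\<Sum>j<k. weight k B j * q j)" "j < k" for j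
      by (rule weighted_sum_unique[OF _ q B _ that(2)]) (use d that eq in \<open>auto simp: less_imp_le\<close>)
    then show ?thesis unfolding S_def using eq by auto
  qed
  have bound: "int x \<le> q j div d j \<longleftrightarrow> d j * int x \<le> q j" if "j < k" for x j
  proof
    assume "int x \<le> q j div d j"
    then have "d j * int x \<le> d j * (q j div d j)" using d[OF that] by simp
    also have "\<dots> \<le> q j" using mult_div_mod_eq[of "d j" "q j"] pos_mod_sign[of "d j" "q j"] d[OF that] by linarith
    finally show "d j * int x \<le> q j" .
  next
    assume "d j * int x \<le> q j"
    then have "(d j * int x) div d j \<le> q j div d j" using d[OF that] by (intro zdiv_mono1)
    then show "int x \<le> q j div d j" using d[OF that] by simp
  qed
  have img: "G ` ?T = S"
  proof (intro set_eqI iffI)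
    fix y assume "y \<in> G ` ?T"
    then obtain x where x: "x \<in> ?T" "y = G x" by blast
    have "d j * int (x j) \<le> q j" if "j < k" for j
    proof -
      have "x j \<le> nat (q j div d j)" using x(1) that by auto
      moreover have "0 \<le> q j div d j" using q[OF that] d[OF that] by (simp add: pos_imp_zdiv_nonneg_iff)
      ultimately have "int (x j) \<le> q j div d j" by linarith
      then show ?thesis using bound[OF that] by simp
    qed
    then show "y \<in> S" unfolding S_iff x(2) by (auto simp: G_def)
  next
    fix y assume y: "y \<in> S"
    define x where "x = restrict (\<lambda>j. y (2 * j)) {..<k}"
    have eqj: "d j * int (y (2 * j)) + int (y (2 * j + 1)) = q j" if "j < k" for j
      using y that unfolding S_iff by blast
    have "x \<in> ?T"
    proof (rule PiE_I)
      fix j assume "j \<in> {..<k}"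
      then have "int (y (2 * j)) \<le> q j div d j"
        using eqj[of j] bound[of j "y (2 * j)"] by simp
      then show "x j \<in> {..nat (q j div d j)}" using \<open>j \<in> {..<k}\<close> by (simp add: x_def)
    qed (simp add: x_def)
    moreover have "y = G x"
    proof
      fix v :: nat
      show "y v = G x v"
      proof (cases "v < 2 * k")
        case True
        obtain j where "v = 2 * j \<or> v = 2 * j + 1" by (meson oddE evenE)
        then show ?thesis using True eqj[of j] by (auto simp: G_def x_def)
      next
        case False
        then show ?thesis using y unfolding S_iff by (simp add: G_def)
      qed
    qed
    ultimately show "y \<in> G ` ?T" by blast
  qed
  have inj: "inj_on G ?T"
  proof (rule inj_onI)
    fix x x' assume x: "x \<in> ?T" "x' \<in> ?T" "G x = G x'"
    show "x = x'"
    proof (rule PiE_ext[OF x(1,2)])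
      fix j assume "j \<in> {..<k}"
      then show "x j = x' j" using fun_cong[OF x(3), of "2 * j"] by (simp add: G_def)
    qed
  qed
  show "finite S" unfolding img[symmetric] by (intro finite_imageI finite_PiE) auto
  have "card S = (\<Prod>j<k. nat (q j div d j) + 1)"
    unfolding img[symmetric] card_image[OF inj] by (subst card_PiE) auto
  also have "int \<dots> = (\<Prod>j<k. q j div d j + 1)"
    unfolding of_nat_prod using q d by (intro prod.cong) (auto simp: pos_imp_zdiv_nonneg_iff)
  finally show "int (card S) = (\<Prod>j<k. q j div d j + 1)" .
qed

section \<open>Two identities for products\<close>

text \<open>Summand m is z_0 ... z_(m-1) C^(n-m) minus z_0 ... z_m C^(n-m-1), so neighbours cancel.
  Over the integers every summand is nonnegative when 0 \<le> z_j \<le> C.\<close>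

lemma prod_telescope:
  fixes z :: "nat \<Rightarrow> 'a::comm_ring_1"
  shows "(\<Sum>m<n. \<Prod>j<n. if j < m then z j else if j = m then C - z j else C) = C ^ n - (\<Prod>j<n. z j)"
proof (induction n)
  case (Suc n)
  let ?f = "\<lambda>m j. if j < m then z j else if j = m then C - z j else C"
  have "(\<Sum>m<Suc n. \<Prod>j<Suc n. ?f m j) = (\<Sum>m<n. (\<Prod>j<n. ?f m j) * C) + (\<Prod>j<n. z j) * (C - z n)"
    by simp
  also have "\<dots> = C ^ Suc n - (\<Prod>j<Suc n. z j)"
    unfolding sum_distrib_right[symmetric] Suc.IH by (simp add: algebra_simps)
  finally show ?case .
qed simp

text \<open>A finite difference of order m kills polynomials of degree n < m. The last factor x_n +
  k L is split: x_n falls under the induction hypothesis, and for k L the identity k (m choose k) =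
  m (m-1 choose k-1) leads to the difference of order m - 1 at the shifted arguments x + L.\<close>

lemma alternating_binomial_sum_prod:
  fixes x :: "nat \<Rightarrow> 'a::idom"
  assumes "n < m"
  shows "(\<Sum>k\<le>m. (-1) ^ k * of_nat (m choose k) * (\<Prod>j<n. x j + of_nat k * L)) = 0"
  using assms
proof (induction n arbitrary: m x)
  case 0
  then show ?case using choose_alternating_sum[of m, where 'a = 'a] by simp
next
  case (Suc n)
  obtain m' where m: "m = Suc m'" using Suc.prems by (cases m) auto
  let ?P = "\<lambda>k. \<Prod>j<n. x j + of_nat k * L"
  have "(\<Sum>k\<le>m. (-1) ^ k * of_nat (m choose k) * (\<Prod>j<Suc n. x j + of_nat k * L)) =
    x n * (\<Sum>k\<le>m. (-1) ^ k * of_nat (m choose k) * ?P k) +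
    L * (\<Sum>k\<le>m. (-1) ^ k * of_nat (k * (m choose k)) * ?P k)"
    by (simp add: sum_distrib_left sum.distrib[symmetric] algebra_simps)
  also have "(\<Sum>k\<le>m. (-1) ^ k * of_nat (m choose k) * ?P k) = 0"
    using Suc by simp
  also have "(\<Sum>k\<le>m. (-1) ^ k * of_nat (k * (m choose k)) * ?P k) =
    (\<Sum>k\<le>m'. - of_nat m * ((-1) ^ k * of_nat (m' choose k) * (\<Prod>j<n. (x j + L) + of_nat k * L)))"
  proof -
    have "(-1) ^ Suc k * of_nat (Suc k * (Suc m' choose Suc k)) * ?P (Suc k) =
      - of_nat m * ((-1) ^ k * of_nat (m' choose k) * (\<Prod>j<n. (x j + L) + of_nat k * L))" for k
      unfolding Suc_times_binomial m by (simp add: algebra_simps)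
    then show ?thesis
      unfolding m sum.atMost_Suc_shift by simp
  qed
  also have "\<dots> = - of_nat m * 0"
    unfolding sum_distrib_left[symmetric] using Suc.IH[of m' "\<lambda>j. x j + L"] Suc.prems m by simp
  finally show ?case by simp
qed

text \<open>The vanishing difference of order n + 1, solved for its term k = 0. The other terms
  contain only shifts by at least L, which a large L makes positive.\<close>

lemma prod_eq_shifted_sum:
  fixes x :: "nat \<Rightarrow> 'a::idom"
  shows "(\<Sum>k\<le>n. (-1) ^ k * of_nat (Suc n choose Suc k) * (\<Prod>j<n. x j + of_nat (Suc k) * L)) = (\<Prod>j<n. x j)"
proof -
  have "0 = (\<Sum>k\<le>Suc n. (-1) ^ k * of_nat (Suc n choose k) * (\<Prod>j<n. x j + of_nat k * L))"
    using alternating_binomial_sum_prod[of n "Suc n" x L] by simp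
  also have "\<dots> = (\<Prod>j<n. x j) -
    (\<Sum>k\<le>n. (-1) ^ k * of_nat (Suc n choose Suc k) * (\<Prod>j<n. x j + of_nat (Suc k) * L))"
    unfolding sum.atMost_Suc_shift by (simp add: sum_negf del: binomial_Suc_Suc)
  finally show ?thesis by simp
qed

section \<open>The polytope of a sum of products of floors\<close>

text \<open>
  \<open>X\<close> exceeds every number of the input; the shift \<open>S\<close>, the bound \<open>C\<close> and the base of the digits are
  \<open>X ^ 4\<close>, \<open>X ^ 6\<close> and \<open>X ^ 12\<close>. The pieces are indexed by a summand \<open>i\<close>, a shift \<open>(k + 1) S\<close> and a step
  \<open>m\<close> of the telescoping sum, where \<open>m = n\<close> stands for the untelescoped product. Row 0 contributes the
  multiplicity \<open>\<bar>coef i k\<bar>\<close>, row \<open>j + 1\<close> the factor \<open>z\<^sub>j\<close>, \<open>C - z\<^sub>j\<close> or \<open>C\<close>.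
\<close>

locale floor_instance =
  fixes r n lg :: nat and X :: int and g :: "nat \<Rightarrow> int" and a b D :: "nat \<Rightarrow> nat \<Rightarrow> int"
  assumes n_pos: "1 \<le> n" and X_n: "int n + 2 \<le> X" and X_pow: "2 ^ (n + 1) \<le> X"
    and g_le: "i < r \<Longrightarrow> \<bar>g i\<bar> \<le> X"
    and a_le: "i < r \<Longrightarrow> j < n \<Longrightarrow> \<bar>a i j\<bar> \<le> X ^ 2"
    and b_le: "i < r \<Longrightarrow> j < n \<Longrightarrow> \<bar>b i j\<bar> \<le> X ^ 2"
    and D_pos: "i < r \<Longrightarrow> j < n \<Longrightarrow> 0 < D i j"
    and D_le: "i < r \<Longrightarrow> j < n \<Longrightarrow> D i j \<le> X ^ 2"
    and lg: "r \<le> 2 ^ lg"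
begin

definition coef :: "nat \<Rightarrow> nat \<Rightarrow> int" where
  "coef i k = (-1) ^ k * int (Suc n choose Suc k) * g i"

fun slope :: "nat \<Rightarrow> nat \<Rightarrow> nat \<Rightarrow> int" where
  "slope i m 0 = 0"
| "slope i m (Suc j) = (if j < m then a i j else if j = m then - a i j else 0)"

text \<open>A row has \<open>row div dens + 1\<close> solutions, so the wanted factor is lowered by
  1, as a multiple of the denominator. For C - z_j the identity \<lfloor>(-x - 1) / D\<rfloor> + 1 =
  -\<lfloor>x / D\<rfloor> absorbs this 1 and accounts for \<open>- b i j - 1\<close>.\<close>

fun offset :: "nat \<Rightarrow> nat \<Rightarrow> nat \<Rightarrow> nat \<Rightarrow> int" where
  "offset i k m 0 = \<bar>coef i k\<bar> - 1"
| "offset i k m (Suc j) = (if j < m then b i j + ((int k + 1) * X ^ 4 - 1) * D i j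
     else if j = m then - b i j - 1 + (X ^ 6 - (int k + 1) * X ^ 4) * D i j
     else (X ^ 6 - 1) * D i j)"

fun dens :: "nat \<Rightarrow> nat \<Rightarrow> int" where
  "dens i 0 = 1"
| "dens i (Suc j) = D i j"

definition row :: "nat \<Rightarrow> nat \<Rightarrow> nat \<Rightarrow> int \<Rightarrow> nat \<Rightarrow> int" where
  "row i k m t j = slope i m j * t + offset i k m j"

definition wt :: "nat \<Rightarrow> int" where
  "wt = weight (Suc n) (X ^ 12)"

definition rhs0 :: "nat \<Rightarrow> nat \<Rightarrow> nat \<Rightarrow> int" where
  "rhs0 i k m = (\<Sum>j<Suc n. wt j * offset i k m j)"

definition rhs1 :: "nat \<Rightarrow> nat \<Rightarrow> nat \<Rightarrow> int" where
  "rhs1 i k m = (\<Sum>j<Suc n. wt j * slope i m j)"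

definition ms :: "nat \<Rightarrow> nat \<Rightarrow> nat set" where
  "ms i k = (if 0 < coef i k then {n} else if coef i k < 0 then {..<n} else {})"

definition pieces :: "(nat \<times> nat \<times> nat) set" where
  "pieces = (SIGMA i:{..<r}. SIGMA k:{..n}. ms i k)"

text \<open>The code is odd because label bit 0 must be set.\<close>

definition code :: "nat \<Rightarrow> nat \<Rightarrow> nat \<Rightarrow> nat" where
  "code i k m = 2 * ((i * (n + 1) + k) * (n + 1) + m) + 1"

definition slot :: "nat \<Rightarrow> nat \<Rightarrow> int" where
  "slot i = slot_weight (Suc n) (X ^ 12) (dens i)"

definition rhs :: "nat \<Rightarrow> nat \<Rightarrow> nat \<Rightarrow> bool \<Rightarrow> int" where
  "rhs i k m e = rhs0 i k m + (if e then X else 0) * rhs1 i k m"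

definition vv :: nat where "vv = 2 * Suc n"

text \<open>The bit that is always set, \<open>lg\<close> bits for i, and n bits each for k and m,
  since n + 1 \<le> 2^n.\<close>

definition hh :: nat where "hh = 1 + lg + 2 * n"

definition val_floor :: "nat \<Rightarrow> nat \<Rightarrow> int \<Rightarrow> int" where
  "val_floor i j t = (a i j * t + b i j) div D i j"

definition total :: "int \<Rightarrow> int" where
  "total t = (\<Sum>i<r. g i * (\<Prod>j<n. val_floor i j t))"

definition KK :: int where
  "KK = (\<Sum>i<r. \<Sum>k\<le>n. if coef i k < 0 then - coef i k * (X ^ 6) ^ n else 0)"

section \<open>Sizes of rows and right-hand sides\<close>

lemma X2: "2 \<le> X" "1 \<le> X" "0 < X" using X_n by linarith+

lemma X_mono: "p \<le> q \<Longrightarrow> X ^ p \<le> X ^ q"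
  using X2 by (intro power_increasing) auto

lemma ms_le: "m \<in> ms i k \<Longrightarrow> m \<le> n"
  by (auto simp: ms_def split: if_splits)

lemma coef_nonzero: "m \<in> ms i k \<Longrightarrow> coef i k \<noteq> 0"
  by (auto simp: ms_def split: if_splits)

lemma coef_le:
  assumes "i < r" shows "\<bar>coef i k\<bar> \<le> X ^ 2"
proof -
  have "int (Suc n choose Suc k) \<le> int (2 ^ Suc n)"
    by (subst of_nat_le_iff) (rule binomial_le_pow2)
  also have "\<dots> \<le> X" using X_pow by simp
  finally have "int (Suc n choose Suc k) * \<bar>g i\<bar> \<le> X * X"
    using g_le[OF assms] X2 by (intro mult_mono) auto
  then show ?thesis by (simp add: coef_def abs_mult power_abs power2_eq_square)
qed

text \<open>The linear forms stay below S = X^4, so adding any positive multiple of S makes the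
  floors positive.\<close>

lemma lin_le:
  assumes "i < r" "j < n" "0 \<le> t" "t \<le> X"
  shows "\<bar>a i j * t + b i j\<bar> \<le> X ^ 4 - 2"
proof -
  have "\<bar>a i j * t\<bar> \<le> X ^ 2 * X"
    unfolding abs_mult using a_le[OF assms(1,2)] assms(3,4) X2 by (intro mult_mono) auto
  moreover have "X ^ 2 * X + X ^ 2 \<le> X ^ 4 - 2"
  proof -
    have "X ^ 2 * 1 \<le> X ^ 2 * (X ^ 2 - X - 1)"
      using X2 mult_right_mono[of 2 X X] unfolding power2_eq_square
      by (intro mult_left_mono) (linarith, simp)
    moreover have "2 \<le> X ^ 2" using X_mono[of 1 2] X2 by simp
    ultimately show ?thesis by (simp add: algebra_simps power_numeral_reduce)
  qed
  ultimately show ?thesis using b_le[OF assms(1,2)] by linarith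
qed

lemma k_le: "k \<le> n \<Longrightarrow> (int k + 1) * X ^ 4 \<le> X ^ 5 - X ^ 4"
proof -
  assume "k \<le> n"
  then have "(int k + 1) * X ^ 4 \<le> (X - 1) * X ^ 4" using X_n X2 by (intro mult_right_mono) auto
  then show ?thesis by (simp add: algebra_simps power_numeral_reduce)
qed

lemma k_ge: "X ^ 4 \<le> (int k + 1) * X ^ 4"
  using X2 by simp

lemma X4: "16 \<le> X ^ 4" using power_mono[of 2 X 4] X2 by simp

text \<open>The shift (k + 1) S lies between X^4 and X^5 - X^4. It dominates the linear form and
  stays so far below C = X^6 that the complement dominates it too. Row 0 may vanish, namely for a
  coefficient 1 or -1, hence strict positivity only for the others.\<close>

lemma row_bounds:
  assumes "i < r" "k \<le> n" "0 \<le> t" "t \<le> X" "m \<in> ms i k"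
  shows "j < Suc n \<Longrightarrow> 0 \<le> row i k m t j"
    and "j < Suc n \<Longrightarrow> row i k m t j < X ^ 9"
    and "0 < j \<Longrightarrow> j < Suc n \<Longrightarrow> 0 < row i k m t j"
proof -
  have main: "0 < row i k m t (Suc j) \<and> row i k m t (Suc j) < X ^ 9" if j: "j < n" for j
  proof -
    let ?l = "a i j * t + b i j" and ?k = "(int k + 1) * X ^ 4"
    have l: "\<bar>?l\<bar> \<le> X ^ 4 - 2" using lin_le assms j by blast
    have D: "1 \<le> D i j" "D i j \<le> X ^ 2" using D_pos[of i j] D_le[of i j] assms j by auto
    have X56: "2 * X ^ 5 \<le> X ^ 6"
      using mult_right_mono[of 2 X "X ^ 5"] X2 by (simp add: power_numeral_reduce)
    have X45: "X ^ 4 \<le> X ^ 5" by (rule X_mono) simp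
    have bound: "c * D i j + X ^ 4 < X ^ 9" if "0 \<le> c" "c \<le> X ^ 6" for c
    proof -
      have "c * D i j \<le> X ^ 6 * X ^ 2" using that D X2 by (intro mult_mono) auto
      moreover have "X ^ 6 * X ^ 2 = X ^ 8" by (simp flip: power_add)
      moreover have "X ^ 4 < X ^ 8" using X2 by (intro power_strict_increasing) auto
      moreover have "2 * X ^ 8 \<le> X ^ 9" using mult_right_mono[of 2 X "X ^ 8"] X2 by (simp add: power_numeral_reduce)
      ultimately show ?thesis by linarith
    qed
    have pos: "c \<le> c * D i j" if "0 \<le> c" for c
      using mult_left_mono[of 1 "D i j" c] D that by simp
    consider "j < m" | "j = m" | "m < j" by linarith
    then show ?thesis
    proof cases
      case 1
      then have "row i k m t (Suc j) = ?l + (?k - 1) * D i j" by (simp add: row_def algebra_simps)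
      then show ?thesis using pos[of "?k - 1"] bound[of "?k - 1"] l k_ge[of k] k_le[OF assms(2)] X45 X56 X4 by linarith
    next
      case 2
      then have "row i k m t (Suc j) = - ?l - 1 + (X ^ 6 - ?k) * D i j" by (simp add: row_def algebra_simps)
      then show ?thesis using pos[of "X ^ 6 - ?k"] bound[of "X ^ 6 - ?k"] l k_ge[of k] k_le[OF assms(2)] X45 X56 X4 by linarith
    next
      case 3
      then have "row i k m t (Suc j) = (X ^ 6 - 1) * D i j" by (simp add: row_def)
      then show ?thesis using pos[of "X ^ 6 - 1"] bound[of "X ^ 6 - 1"] X45 X56 X4 by linarith
    qed
  qed
  have zero: "row i k m t 0 = \<bar>coef i k\<bar> - 1" by (simp add: row_def)
  have "1 \<le> \<bar>coef i k\<bar>" using coef_nonzero[OF assms(5)] by linarith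
  moreover have "\<bar>coef i k\<bar> \<le> X ^ 9" using coef_le[OF assms(1), of k] X_mono[of 2 9] by linarith
  ultimately show "j < Suc n \<Longrightarrow> 0 \<le> row i k m t j" "j < Suc n \<Longrightarrow> row i k m t j < X ^ 9"
    "0 < j \<Longrightarrow> j < Suc n \<Longrightarrow> 0 < row i k m t j"
    using main zero by (cases j; force)+
qed

text \<open>This is the no-carry condition for the base X^12: at most X rows below X^9 add up to at
  most X^10.\<close>

lemma sum_row_less:
  assumes "i < r" "k \<le> n" "0 \<le> t" "t \<le> X" "m \<in> ms i k"
  shows "sum (row i k m t) {..<Suc n} < X ^ 12"
proof -
  have "sum (row i k m t) {..<Suc n} \<le> (\<Sum>j<Suc n. X ^ 9)"
    using row_bounds(2)[OF assms] by (intro sum_mono less_imp_le) auto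
  also have "\<dots> = (int n + 1) * X ^ 9" by (simp add: algebra_simps)
  also have "\<dots> \<le> X * X ^ 9" using X_n X2 by (intro mult_right_mono) auto
  also have "\<dots> = X ^ 10" by (simp add: power_numeral_reduce)
  also have "\<dots> < X ^ 12" using X2 by (intro power_strict_increasing) auto
  finally show ?thesis .
qed

lemma wt_pos: "0 < wt j"
  using X2 by (simp add: wt_def weight_def add_pos_pos)

lemma dens_pos: "i < r \<Longrightarrow> j < Suc n \<Longrightarrow> 0 < dens i j"
  using D_pos by (cases j) auto

lemma rhs_eq: "rhs0 i k m + t * rhs1 i k m = (\<Sum>j<Suc n. wt j * row i k m t j)"
  unfolding rhs0_def rhs1_def sum_distrib_left sum.distrib[symmetric]
  by (intro sum.cong refl) (simp add: row_def algebra_simps)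

text \<open>The bundle requires positive right-hand sides. As row 0 may be zero, positivity comes
  from row 1, which exists because n is at least 1.\<close>

lemma rhs_pos:
  assumes "i < r" "k \<le> n" "0 \<le> t" "t \<le> X" "m \<in> ms i k"
  shows "0 < rhs0 i k m + t * rhs1 i k m"
  unfolding rhs_eq
proof (rule sum_pos2[of _ 1])
  show "0 < wt 1 * row i k m t 1" using row_bounds(3)[OF assms, of 1] n_pos wt_pos by simp
  show "0 \<le> wt j * row i k m t j" if "j \<in> {..<Suc n}" for j
    using row_bounds(1)[OF assms, of j] that wt_pos[of j] by simp
qed (use n_pos in auto)

section \<open>Labels and the instance of the bundle\<close>

lemma pieces_iff: "(i, k, m) \<in> pieces \<longleftrightarrow> i < r \<and> k \<le> n \<and> m \<in> ms i k"
  by (auto simp: pieces_def)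

lemma code_bound:
  assumes "i < r" "k \<le> n" "m \<le> n"
  shows "(i * (n + 1) + k) * (n + 1) + m < r * (n + 1) * (n + 1)"
proof -
  have "(i * (n + 1) + k) * (n + 1) + m < (i * (n + 1) + k + 1) * (n + 1)"
    using assms by simp
  also have "\<dots> \<le> (r * (n + 1)) * (n + 1)"
  proof (rule mult_right_mono)
    have "i * (n + 1) + k + 1 \<le> (i + 1) * (n + 1)" using assms by simp
    also have "\<dots> \<le> r * (n + 1)" using assms by (intro mult_right_mono) auto
    finally show "i * (n + 1) + k + 1 \<le> r * (n + 1)" .
  qed simp
  finally show ?thesis .
qed

lemma code_less:
  assumes "i < r" "k \<le> n" "m \<le> n"
  shows "code i k m < 2 ^ hh"
proof -
  have "r * (n + 1) * (n + 1) \<le> 2 ^ lg * 2 ^ n * 2 ^ n"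
    using lg less_exp[of n] by (intro mult_mono) (auto simp: Suc_le_eq)
  also have "\<dots> = 2 ^ (lg + 2 * n)" by (simp add: power_add mult_2)
  finally show ?thesis using code_bound[OF assms] by (simp add: code_def hh_def)
qed

lemma code_inj:
  assumes "code i k m = code i' k' m'" "k \<le> n" "m \<le> n" "k' \<le> n" "m' \<le> n"
  shows "i = i' \<and> k = k' \<and> m = m'"
proof -
  have split: "x = x' \<and> y = y'" if "x * (n + 1) + y = x' * (n + 1) + y'" "y \<le> n" "y' \<le> n" for x y x' y' :: nat
  proof -
    have "x = (x * (n + 1) + y) div (n + 1)" "x' = (x' * (n + 1) + y') div (n + 1)"
      using that(2,3) by (subst div_mult_self3; simp)+
    then have "x = x'" using that(1) by metis
    then show ?thesis using that by simp
  qed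
  have "(i * (n + 1) + k) * (n + 1) + m = (i' * (n + 1) + k') * (n + 1) + m'"
    using assms(1) by (simp add: code_def)
  then show ?thesis using split assms by metis
qed

lemma slot_pos: "i < r \<Longrightarrow> v < vv \<Longrightarrow> 0 < slot i v"
  using dens_pos[of i "v div 2"] wt_pos[of "v div 2"]
  by (auto simp: vv_def slot_def slot_weight_def wt_def less_mult_imp_div_less mult.commute)

lemma rhs_piece_pos: "(i, k, m) \<in> pieces \<Longrightarrow> 0 < rhs i k m e"
  using X2 rhs_pos[of i k "if e then X else 0" m] by (auto simp: pieces_iff rhs_def)

text \<open>The ends are t = 0 and t = X, the offset M is X^2, and the labels are the binary digits
  of \<open>code\<close>, of which \<open>hh\<close> suffice by \<open>code_less\<close>.\<close>

sublocale B: simplex_bundle hh vv pieces "\<lambda>(i, k, m). bit (code i k m)"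
  "\<lambda>(i, k, m) v. of_int (slot i v)" "\<lambda>(i, k, m) e. of_int (rhs i k m e)" "nat (X ^ 2)" "nat X"
proof
  have "finite (ms i k)" for i k by (auto simp: ms_def)
  then show "finite pieces" by (auto simp: pieces_def)
  show "0 < hh" by (simp add: hh_def)
  show "(case p of (i, k, m) \<Rightarrow> bit (code i k m)) 0" if "p \<in> pieces" for p
    by (simp add: code_def bit_0 split: prod.splits)
  show "p = p'" if p: "p \<in> pieces" "p' \<in> pieces"
    and eq: "\<And>c. c < hh \<Longrightarrow> (case p of (i, k, m) \<Rightarrow> bit (code i k m)) c = (case p' of (i, k, m) \<Rightarrow> bit (code i k m)) c"
    for p p'
  proof -
    obtain i k m i' k' m' where p': "p = (i, k, m)" "p' = (i', k', m')" by (metis prod_cases3)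
    have less: "code i k m < 2 ^ hh" "code i' k' m' < 2 ^ hh"
      using p ms_le by (auto simp: p' pieces_iff intro!: code_less)
    have "take_bit hh (code i k m) = take_bit hh (code i' k' m')"
      using eq by (intro bit_eqI) (auto simp: p' bit_take_bit_iff)
    then have "code i k m = code i' k' m'"
      using less by (simp add: take_bit_eq_mod)
    then show ?thesis using code_inj p ms_le unfolding p' pieces_iff by blast
  qed
  show "0 < (case p of (i, k, m) \<Rightarrow> \<lambda>v. real_of_int (slot i v)) v" if "p \<in> pieces" "v < vv" for p v
    using that by (auto simp: pieces_iff slot_pos split: prod.splits)
  show "0 < (case p of (i, k, m) \<Rightarrow> \<lambda>e. real_of_int (rhs i k m e)) e" if "p \<in> pieces" for p e
    using that by (auto simp: rhs_piece_pos split: prod.splits)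
  show "0 < nat X" using X2 by simp
  have "X * 1 < X * X" using X2 by (intro mult_strict_left_mono) auto
  then show "nat X < nat (X ^ 2)" using X2 by (simp add: power2_eq_square)
qed

section \<open>Counting the integer points\<close>

lemma level_eq:
  assumes "p = (i, k, m)"
  shows "B.level p t = of_int (\<Sum>j<Suc n. wt j * row i k m (int t) j)"
proof -
  have X0: "real (nat X) = of_int X" "0 < real_of_int X" using X2 by auto
  have "B.level p t = ((of_int X - real t) * of_int (rhs i k m False) + real t * of_int (rhs i k m True)) / of_int X"
    unfolding B.level_def assms prod.case X0(1) ..
  also have "\<dots> = of_int (rhs0 i k m + int t * rhs1 i k m)"
    unfolding rhs_def using X0(2) by (simp add: field_simps)
  finally have "B.level p t = of_int (rhs0 i k m + int t * rhs1 i k m)" .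
  then show ?thesis unfolding rhs_eq .
qed

lemma sols_eq:
  assumes "p = (i, k, m)"
  shows "B.sols p t = {y. (\<forall>v\<ge>2 * Suc n. y v = 0) \<and>
    (\<Sum>v<2 * Suc n. slot_weight (Suc n) (X ^ 12) (dens i) v * int (y v)) =
    (\<Sum>j<Suc n. weight (Suc n) (X ^ 12) j * row i k m (int t) j)}"
proof -
  have "(\<Sum>v<vv. real_of_int (slot i v) * real (y v)) = of_int (\<Sum>v<vv. slot i v * int (y v))" for y
    by (simp only: of_int_sum of_int_mult of_int_of_nat_eq)
  then show ?thesis
    unfolding B.sols_def level_eq[OF assms] unfolding assms prod.case
    by (simp only: of_int_eq_iff wt_def slot_def vv_def)
qed

text \<open>Row 0 has denominator 1 and yields the multiplicity. In every other row the multiple of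
  D passes through the division, and only the floor of the linear form or of its complement
  remains.\<close>

lemma card_sols:
  assumes p: "(i, k, m) \<in> pieces" and t: "int t \<le> X"
  shows "finite (B.sols (i, k, m) t)"
    and "int (card (B.sols (i, k, m) t)) = \<bar>coef i k\<bar> * (\<Prod>j<n. let z = val_floor i j (int t) + int (Suc k) * X ^ 4
      in if j < m then z else if j = m then X ^ 6 - z else X ^ 6)"
proof -
  have *: "i < r" "k \<le> n" "m \<in> ms i k" using p by (auto simp: pieces_iff)
  note sol = card_solutions[of "Suc n" "dens i" "row i k m (int t)" "X ^ 12", OF dens_pos[OF *(1)]
      row_bounds(1)[OF *(1,2) _ t *(3)] sum_row_less[OF *(1,2) _ t *(3)], folded sols_eq[OF refl]]
  show "finite (B.sols (i, k, m) t)" using sol(1) by simp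
  have "int (card (B.sols (i, k, m) t)) = (\<Prod>j<Suc n. row i k m (int t) j div dens i j + 1)"
    using sol(2) by simp
  also have "\<dots> = \<bar>coef i k\<bar> * (\<Prod>j<n. row i k m (int t) (Suc j) div D i j + 1)"
    by (subst prod.lessThan_Suc_shift) (simp add: row_def)
  also have "(\<Prod>j<n. row i k m (int t) (Suc j) div D i j + 1) =
    (\<Prod>j<n. let z = val_floor i j (int t) + int (Suc k) * X ^ 4
      in if j < m then z else if j = m then X ^ 6 - z else X ^ 6)"
  proof (intro prod.cong refl)
    fix j assume "j \<in> {..<n}"
    then have D: "0 < D i j" using D_pos * by auto
    let ?l = "a i j * int t + b i j" and ?z = "val_floor i j (int t) + int (Suc k) * X ^ 4"
    have mult: "(x + c * D i j) div D i j = x div D i j + c" for x c using D by simp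
    consider "j < m" | "j = m" | "m < j" by linarith
    then have "row i k m (int t) (Suc j) div D i j + 1 = (if j < m then ?z else if j = m then X ^ 6 - ?z else X ^ 6)"
    proof cases
      case 1
      then have "row i k m (int t) (Suc j) = ?l + (int (Suc k) * X ^ 4 - 1) * D i j"
        by (simp add: row_def algebra_simps)
      then show ?thesis using 1 mult[of ?l "int (Suc k) * X ^ 4 - 1"] by (simp add: val_floor_def)
    next
      case 2
      then have "row i k m (int t) (Suc j) = (- ?l - 1) + (X ^ 6 - int (Suc k) * X ^ 4) * D i j"
        by (simp add: row_def algebra_simps)
      moreover have "(- ?l - 1) div D i j = - (?l div D i j) - 1"
      proof (rule int_div_pos_eq)
        show "- ?l - 1 = D i j * (- (?l div D i j) - 1) + (D i j - 1 - ?l mod D i j)"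
          using mult_div_mod_eq[of "D i j" ?l] by (simp add: algebra_simps)
      qed (use D pos_mod_bound[OF D, of ?l] pos_mod_sign[OF D, of ?l] in linarith)+
      ultimately show ?thesis using 2 mult[of "- ?l - 1" "X ^ 6 - int (Suc k) * X ^ 4"]
        by (simp add: val_floor_def)
    next
      case 3
      then have "row i k m (int t) (Suc j) = 0 + (X ^ 6 - 1) * D i j" by (simp add: row_def)
      then show ?thesis using 3 mult[of 0 "X ^ 6 - 1"] by simp
    qed
    then show "row i k m (int t) (Suc j) div D i j + 1 =
      (let z = ?z in if j < m then z else if j = m then X ^ 6 - z else X ^ 6)" by (simp add: Let_def)
  qed
  finally show "int (card (B.sols (i, k, m) t)) = \<bar>coef i k\<bar> * (\<Prod>j<n. let z = val_floor i j (int t) + int (Suc k) * X ^ 4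
      in if j < m then z else if j = m then X ^ 6 - z else X ^ 6)" .
qed

text \<open>A positive coefficient has a single untelescoped piece. For a negative one the pieces
  count \<open>\<bar>coef i k\<bar>\<close> times (C^n minus the product), which is the signed
  contribution plus a constant.\<close>

lemma sum_ms:
  assumes "i < r" "k \<le> n" "int t \<le> X"
  shows "(\<Sum>m\<in>ms i k. int (card (B.sols (i, k, m) t))) =
    coef i k * (\<Prod>j<n. val_floor i j (int t) + int (Suc k) * X ^ 4) +
    (if coef i k < 0 then - coef i k * (X ^ 6) ^ n else 0)"
proof -
  let ?z = "\<lambda>j. val_floor i j (int t) + int (Suc k) * X ^ 4"
  let ?P = "\<lambda>m. \<Prod>j<n. if j < m then ?z j else if j = m then X ^ 6 - ?z j else X ^ 6"
  have c: "int (card (B.sols (i, k, m) t)) = \<bar>coef i k\<bar> * ?P m" if "m \<in> ms i k" for m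
    using card_sols(2)[of i k m t] that assms unfolding pieces_iff Let_def by blast
  consider "0 < coef i k" | "coef i k < 0" | "coef i k = 0" by linarith
  then show ?thesis
  proof cases
    case 1
    then have "ms i k = {n}" by (simp add: ms_def)
    then show ?thesis using c 1 by simp
  next
    case 2
    then have ms: "ms i k = {..<n}" by (simp add: ms_def)
    have "(\<Sum>m\<in>ms i k. int (card (B.sols (i, k, m) t))) = \<bar>coef i k\<bar> * (\<Sum>m<n. ?P m)"
      using c unfolding sum_distrib_left ms by (intro sum.cong) auto
    then show ?thesis using 2 unfolding prod_telescope by (simp add: algebra_simps)
  next
    case 3
    then show ?thesis by (simp add: ms_def)
  qed
qed

text \<open>Summing over k removes the shifts: \<open>coef\<close> carries exactly the alternating
  binomials of \<open>prod_eq_shifted_sum\<close>.\<close>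

lemma ehrhart_eq:
  assumes "int t \<le> X"
  shows "int (ehrhart B.Q (t + nat (X ^ 2))) = total (int t) + KK"
proof -
  have "finite (ms i k)" for i k by (auto simp: ms_def)
  note fin = this
  have "int (ehrhart B.Q (t + nat (X ^ 2))) = (\<Sum>p\<in>pieces. int (card (B.sols p t)))"
  proof -
    have "finite (B.sols p t)" if "p \<in> pieces" for p
      using card_sols(1) that assms by (cases p) auto
    then show ?thesis
      using assms by (subst B.ehrhart_Q) auto
  qed
  also have "\<dots> = (\<Sum>i<r. \<Sum>k\<le>n. \<Sum>m\<in>ms i k. int (card (B.sols (i, k, m) t)))"
    unfolding pieces_def using fin by (subst sum.Sigma[symmetric] sum.Sigma, auto)+
  also have "\<dots> = (\<Sum>i<r. \<Sum>k\<le>n. coef i k * (\<Prod>j<n. val_floor i j (int t) + int (Suc k) * X ^ 4)) + KK"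
    unfolding KK_def sum.distrib[symmetric] by (intro sum.cong refl sum_ms assms) auto
  also have "(\<Sum>i<r. \<Sum>k\<le>n. coef i k * (\<Prod>j<n. val_floor i j (int t) + int (Suc k) * X ^ 4)) = total (int t)"
    unfolding total_def
  proof (intro sum.cong refl)
    fix i
    have "(\<Sum>k\<le>n. coef i k * (\<Prod>j<n. val_floor i j (int t) + int (Suc k) * X ^ 4)) =
      g i * (\<Sum>k\<le>n. (-1) ^ k * int (Suc n choose Suc k) * (\<Prod>j<n. val_floor i j (int t) + int (Suc k) * X ^ 4))"
      unfolding sum_distrib_left by (intro sum.cong refl) (simp add: coef_def)
    then show "(\<Sum>k\<le>n. coef i k * (\<Prod>j<n. val_floor i j (int t) + int (Suc k) * X ^ 4)) =
      g i * (\<Prod>j<n. val_floor i j (int t))"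
      unfolding prod_eq_shifted_sum .
  qed
  finally show ?thesis .
qed

lemma KK_nonneg: "0 \<le> KK"
  unfolding KK_def using X2 by (intro sum_nonneg) (auto simp: mult_nonneg_nonneg mult_nonpos_nonneg)

section \<open>The vertices as lists of fractions\<close>

lemma lookup_point_of_fractions:
  "lookup (point_of_fractions vs) c =
    (if c < length vs then of_int (fst (vs ! c)) / of_int (snd (vs ! c)) else 0)"
proof -
  have "lookup (point_of_fractions vs) c =
    (\<Sum>k<length vs. if k = c then of_int (fst (vs ! k)) / of_int (snd (vs ! k)) else 0)"
    by (simp add: point_of_fractions_def lookup_sum lookup_single when_def)
  then show ?thesis by simp
qed

text \<open>All coordinates of a vertex get the common denominator W U: a set label bit is 1 / U,
  the axis coordinate R / (W U).\<close>

definition den :: "nat \<Rightarrow> bool \<Rightarrow> nat \<Rightarrow> int" where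
  "den i e v = slot i v * (X ^ 2 + (if e then X else 0))"

definition vertex :: "nat \<Rightarrow> nat \<Rightarrow> nat \<Rightarrow> bool \<Rightarrow> nat \<Rightarrow> (int \<times> int) list" where
  "vertex i k m e v = map (\<lambda>c. (slot i v * of_bool (bit (code i k m) c), den i e v)) [0..<hh] @
     map (\<lambda>v'. (rhs i k m e * of_bool (v' = v), den i e v)) [0..<vv]"

text \<open>Vertices are grouped by row j, in the order in which the program writes them, so that
  the data of a row are loaded once for four vertices.\<close>

definition block :: "nat \<Rightarrow> nat \<Rightarrow> nat \<Rightarrow> nat \<Rightarrow> (int \<times> int) list list" where
  "block i k m j = [vertex i k m False (2 * j), vertex i k m False (2 * j + 1),
     vertex i k m True (2 * j), vertex i k m True (2 * j + 1)]"

definition ms_list :: "nat \<Rightarrow> nat \<Rightarrow> nat list" where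
  "ms_list i k = (if 0 < coef i k then [n] else if coef i k < 0 then [0..<n] else [])"

definition all_vertices :: "(int \<times> int) list list" where
  "all_vertices = concat (map (\<lambda>i. concat (map (\<lambda>k. concat (map (\<lambda>m. concat (map (block i k m) [0..<Suc n]))
     (ms_list i k))) [0..<Suc n])) [0..<r])"

lemma den_pos: "i < r \<Longrightarrow> v < vv \<Longrightarrow> 0 < den i e v"
  using slot_pos X2 by (simp add: den_def add_pos_nonneg)

lemma length_vertex: "length (vertex i k m e v) = hh + vv"
  by (simp add: vertex_def)

lemma point_of_vertex:
  assumes "(i, k, m) \<in> pieces" "v < vv"
  shows "point_of_fractions (vertex i k m e v) = B.corner ((i, k, m), e, v)"
proof (rule poly_mapping_eqI)
  fix c
  have *: "0 < slot i v" "B.U e = of_int (X ^ 2 + (if e then X else 0))"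
    using assms X2 by (auto simp: pieces_iff slot_pos B.U_def)
  have "lookup (B.corner ((i, k, m), e, v)) c =
    (if c < hh then of_bool (bit (code i k m) c)
      else if c = hh + v then of_int (rhs i k m e) / of_int (slot i v) else 0) / B.U e"
    unfolding B.lookup_corner[OF assms(2)] B.coord_def by simp
  moreover have "lookup (point_of_fractions (vertex i k m e v)) c =
    (if c < hh then of_int (slot i v * of_bool (bit (code i k m) c)) / of_int (den i e v)
     else if c = hh + v then of_int (rhs i k m e) / of_int (den i e v) else 0)"
  proof -
    consider "c < hh" | "hh \<le> c" "c < hh + vv" | "hh + vv \<le> c" by linarith
    then show ?thesis
    proof cases
      case 2
      then have "vertex i k m e v ! c = (rhs i k m e * of_bool (c - hh = v), den i e v)"
        by (simp add: vertex_def nth_append del: upt_Suc)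
      then show ?thesis using 2 by (auto simp: lookup_point_of_fractions length_vertex)
    qed (use assms(2) in \<open>auto simp: lookup_point_of_fractions length_vertex vertex_def nth_append\<close>)
  qed
  ultimately show "lookup (point_of_fractions (vertex i k m e v)) c = lookup (B.corner ((i, k, m), e, v)) c"
    using *(1) unfolding *(2) by (simp add: den_def)
qed

lemma set_ms_list: "set (ms_list i k) = ms i k"
  by (auto simp: ms_list_def ms_def)

lemma set_all_vertices:
  "set all_vertices = (\<lambda>((i, k, m), e, v). vertex i k m e v) ` B.index"
proof -
  have "set (concat (map (block i k m) [0..<Suc n])) = (\<Union>v<vv. {vertex i k m False v, vertex i k m True v})"
    for i k m
  proof (intro set_eqI iffI)
    fix x assume "x \<in> set (concat (map (block i k m) [0..<Suc n]))"
    then obtain j where "j < Suc n" "x \<in> set (block i k m j)" by (auto simp del: upt_Suc)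
    moreover then have "2 * j < vv" "2 * j + 1 < vv" by (auto simp: vv_def)
    ultimately show "x \<in> (\<Union>v<vv. {vertex i k m False v, vertex i k m True v})"
      unfolding block_def by fastforce
  next
    fix x assume "x \<in> (\<Union>v<vv. {vertex i k m False v, vertex i k m True v})"
    then obtain v where v: "v < vv" "x = vertex i k m False v \<or> x = vertex i k m True v" by auto
    obtain j where "v = 2 * j \<or> v = 2 * j + 1" by (meson oddE evenE)
    then have "x \<in> set (block i k m j)" "j < Suc n" using v by (auto simp: block_def vv_def)
    then show "x \<in> set (concat (map (block i k m) [0..<Suc n]))" by (auto simp del: upt_Suc)
  qed
  then have "set all_vertices = (\<Union>i<r. \<Union>k<Suc n. \<Union>m\<in>ms i k. \<Union>v<vv. {vertex i k m False v, vertex i k m True v})"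
    by (simp add: all_vertices_def set_ms_list atLeast0LessThan del: upt_Suc)
  also have "\<dots> = (\<lambda>((i, k, m), e, v). vertex i k m e v) ` B.index" (is "?A = ?f ` _")
  proof (intro equalityI subsetI)
    fix x assume "x \<in> ?A"
    then obtain i k m v e where "i < r" "k < Suc n" "m \<in> ms i k" "v < vv" "x = vertex i k m e v" by blast
    then have "((i, k, m), e, v) \<in> B.index" "x = ?f ((i, k, m), e, v)"
      by (auto simp: B.index_def pieces_iff)
    then show "x \<in> ?f ` B.index" by (rule rev_image_eqI)
  next
    fix x assume "x \<in> ?f ` B.index"
    then obtain p where "p \<in> B.index" "x = ?f p" by blast
    moreover obtain i k m e v where "p = ((i, k, m), e, v)" by (metis prod.exhaust)
    ultimately have "i < r" "k < Suc n" "m \<in> ms i k" "v < vv" "x = vertex i k m e v"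
      by (auto simp: B.index_def pieces_iff)
    moreover then have "x \<in> {vertex i k m False v, vertex i k m True v}" by (cases e) auto
    ultimately show "x \<in> ?A" by blast
  qed
  finally show ?thesis .
qed

lemma vertices_eq: "vertices B.Q = point_of_fractions ` set all_vertices"
proof -
  have "B.corner p = point_of_fractions ((\<lambda>((i, k, m), e, v). vertex i k m e v) p)" if "p \<in> B.index" for p
  proof -
    obtain i k m e v where p: "p = ((i, k, m), e, v)" by (metis prod.exhaust)
    then have "(i, k, m) \<in> pieces" "v < vv" using that by (simp_all add: B.index_def)
    then show ?thesis by (simp add: p point_of_vertex)
  qed
  then show ?thesis
    unfolding B.vertices_Q set_all_vertices image_image by (rule image_cong[OF refl])
qed

lemma rational_polytope_Q: "rational_polytope (hh + vv) B.Q"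
  unfolding rational_polytope_def vertices_eq
  using B.polytope_Q B.Q_euclidean by (auto simp: lookup_point_of_fractions)

text \<open>A summand has at most n (n + 1) pieces with 4 (n + 1) vertices each, so n (n + 1)^2
  \<le> 4^n is wanted. This holds for n = 1 and n \<ge> 3 but fails for n = 2, where 18 exceeds
  16.\<close>

lemma card_vertices_le: "card (vertices B.Q) \<le> r * 4 ^ (n + 1)"
proof -
  have ms_n: "card (ms i k) \<le> n" for i k using n_pos by (simp add: ms_def)
  have finms: "finite (ms i k)" for i k by (auto simp: ms_def)
  have one: "(\<Sum>k\<le>n. card (ms i k)) * (4 * (n + 1)) \<le> 4 ^ (n + 1)" for i
  proof (cases "n = 2")
    case True
    \<comment> \<open>The coefficients 3 g, -3 g, g alternate in sign, so they cannot all require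
      two pieces. At most 5 pieces with 12 vertices each occur, and 60 \<le> 64.\<close>
    have "card (ms i k) = (if 0 < coef i k then 1 else if coef i k < 0 then 2 else 0)" for k
      unfolding ms_def using True by simp
    moreover have "coef i 0 = 3 * g i" "coef i 1 = - (3 * g i)" "coef i 2 = g i"
      unfolding coef_def by (simp_all add: True numeral_2_eq_2)
    ultimately have "card (ms i 0) + card (ms i 1) + card (ms i 2) \<le> 5" by (simp split: if_splits)
    moreover have "(\<Sum>k\<le>n. card (ms i k)) = card (ms i 0) + card (ms i 1) + card (ms i 2)"
      using True by (simp add: numeral_2_eq_2)
    ultimately show ?thesis using True by simp
  next
    case False
    have "(n + 1) * n * (n + 1) \<le> 4 ^ n"
    proof (cases "n = 1")
      case n1: False
      then have "3 \<le> n" using False n_pos by linarith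
      then show ?thesis
      proof (induction n rule: dec_induct)
        case (step k)
        have "(Suc k + 1) * Suc k * (Suc k + 1) \<le> 4 * ((k + 1) * k * (k + 1))"
        proof -
          have "(k + 2) * (k + 2) \<le> (2 * k) * (2 * (k + 1))"
            using step(1) by (intro mult_le_mono) auto
          then have "(k + 2) * (k + 2) * (k + 1) \<le> (2 * k) * (2 * (k + 1)) * (k + 1)" by (rule mult_le_mono1)
          then show ?thesis by (simp add: algebra_simps)
        qed
        then show ?case using step by simp
      qed simp
    qed simp
    moreover have "(\<Sum>k\<le>n. card (ms i k)) \<le> (n + 1) * n"
      using sum_bounded_above[of "{..n}" "\<lambda>k. card (ms i k)" n] ms_n by simp
    ultimately have "4 * ((\<Sum>k\<le>n. card (ms i k)) * (n + 1)) \<le> 4 * 4 ^ n"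
      by (meson le_trans mult_le_mono1 mult_le_mono2)
    then show ?thesis by (simp add: algebra_simps)
  qed
  have "card (vertices B.Q) \<le> card B.index"
    unfolding B.vertices_Q by (rule card_image_le) simp
  also have "\<dots> = card pieces * (4 * (n + 1))"
    unfolding B.index_def card_cartesian_product by (simp add: vv_def algebra_simps)
  also have "card pieces = (\<Sum>i<r. \<Sum>k\<le>n. card (ms i k))"
    unfolding pieces_def using finms by simp
  also have "\<dots> * (4 * (n + 1)) = (\<Sum>i<r. (\<Sum>k\<le>n. card (ms i k)) * (4 * (n + 1)))"
    by (rule sum_distrib_right)
  also have "\<dots> \<le> of_nat (card {..<r}) * 4 ^ (n + 1)"
    by (rule sum_bounded_above) (rule one)
  finally show ?thesis by (simp only: card_lessThan of_nat_id)
qed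

definition flat :: "(int \<times> int) list \<Rightarrow> int list" where
  "flat v = concat (map (\<lambda>(a, b). [a, b]) v)"

definition result :: "int list" where
  "result = [int (hh + vv), KK, X ^ 2, int (length all_vertices)] @ concat (map flat all_vertices)"

lemma encodes_output_Q: "encodes_output (hh + vv) (vertices B.Q) (nat KK) (nat (X ^ 2)) result"
  unfolding encodes_output_def
proof (intro exI conjI)
  show "vertices B.Q = point_of_fractions ` set all_vertices" by (rule vertices_eq)
  show "result = [int (hh + vv), int (nat KK), int (nat (X ^ 2)), int (length all_vertices)] @
      concat (map (\<lambda>v. concat (map (\<lambda>(a, b). [a, b]) v)) all_vertices)"
    using KK_nonneg by (simp add: result_def flat_def[abs_def])
  show "\<forall>v\<in>set all_vertices. length v = hh + vv \<and> (\<forall>(a, b)\<in>set v. b > 0)"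
  proof
    fix w assume "w \<in> set all_vertices"
    then obtain p where "p \<in> B.index" "w = (\<lambda>((i, k, m), e, v). vertex i k m e v) p"
      unfolding set_all_vertices by blast
    moreover obtain i k m e v where "p = ((i, k, m), e, v)" by (metis prod.exhaust)
    ultimately have "w = vertex i k m e v" "(i, k, m) \<in> pieces" "v < vv" by (simp_all add: B.index_def)
    then show "length w = hh + vv \<and> (\<forall>(a, b)\<in>set w. b > 0)"
      using den_pos by (auto simp: length_vertex vertex_def pieces_iff)
  qed
qed

end

section \<open>Reasoning about running time\<close>

lemma bits_le_iff: "bits x \<le> Suc k \<longleftrightarrow> \<bar>x\<bar> < 2 ^ k"
proof -
  have "floorlog 2 (nat \<bar>x\<bar>) \<le> k \<longleftrightarrow> nat \<bar>x\<bar> < 2 ^ k"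
    using floorlog_leD[of 2 "nat \<bar>x\<bar>" k] floorlog_leI[of "nat \<bar>x\<bar>" 2 k] by auto
  also have "\<dots> \<longleftrightarrow> \<bar>x\<bar> < 2 ^ k"
    by (simp add: nat_less_iff flip: of_nat_power)
  finally show ?thesis by (simp add: bits_def)
qed

lemma bits_pos: "0 < bits x"
  by (simp add: bits_def)

lemma abs_less_bits: "\<bar>x\<bar> < 2 ^ (bits x - 1)"
  using bits_le_iff[of x "bits x - 1"] bits_pos[of x] by simp

lemma bits_leI: "\<bar>x\<bar> < 2 ^ (k - 1) \<Longrightarrow> 0 < k \<Longrightarrow> bits x \<le> k"
  using bits_le_iff[of x "k - 1"] by simp

lemma bits_mono: "\<bar>x\<bar> \<le> \<bar>y\<bar> \<Longrightarrow> bits x \<le> bits y"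
  using abs_less_bits[of y] bits_pos[of y] by (intro bits_leI) auto

lemma bits_mult: "bits (x * y) \<le> bits x + bits y"
proof (rule bits_leI)
  have "\<bar>x * y\<bar> < 2 ^ (bits x - 1) * 2 ^ (bits y - 1)"
    unfolding abs_mult by (intro mult_strict_mono' abs_less_bits) auto
  also have "\<dots> \<le> (2 :: int) ^ (bits x + bits y - 1)"
    unfolding power_add[symmetric] by (intro power_increasing) auto
  finally show "\<bar>x * y\<bar> < 2 ^ (bits x + bits y - 1)" .
qed (use bits_pos in simp)

lemma bits_add: "bits (x + y) \<le> bits x + bits y"
proof (rule bits_leI)
  have "(2 :: int) ^ (bits x - 1) \<le> 2 ^ (bits x + bits y - 2)" "(2 :: int) ^ (bits y - 1) \<le> 2 ^ (bits x + bits y - 2)"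
    using bits_pos[of x] bits_pos[of y] by (auto intro!: power_increasing)
  then have "\<bar>x + y\<bar> < 2 * 2 ^ (bits x + bits y - 2)"
    using abs_less_bits[of x] abs_less_bits[of y] by linarith
  also have "\<dots> = 2 ^ (bits x + bits y - 1)"
  proof -
    have "bits x + bits y - 1 = Suc (bits x + bits y - 2)" using bits_pos[of x] bits_pos[of y] by linarith
    then show ?thesis by simp
  qed
  finally show "\<bar>x + y\<bar> < 2 ^ (bits x + bits y - 1)" .
qed (use bits_pos in simp)

lemma bits_sub: "bits (x - y) \<le> bits x + bits y"
  using bits_add[of x "- y"] by (simp add: bits_def)

lemma bits_div: "bits (x div y) \<le> bits x"
proof (rule bits_mono)
  show "\<bar>x div y\<bar> \<le> \<bar>x\<bar>"
  proof (cases "y = 0")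
    case False
    have "\<bar>real_of_int x / real_of_int y\<bar> \<le> \<bar>real_of_int x\<bar> / 1"
      unfolding abs_divide using False by (intro divide_left_mono) (auto simp flip: of_int_abs)
    then have "\<bar>\<lfloor>real_of_int x / real_of_int y\<rfloor>\<bar> \<le> \<bar>x\<bar>" by linarith
    then show ?thesis by (simp add: floor_divide_of_int_eq)
  qed simp
qed

text \<open>The factor of the cell bound \<beta> in a bound for the bit length of a value. A linear
  bound suffices, since an operation at most adds up the bit lengths of its operands.\<close>

fun val_size :: "expr \<Rightarrow> nat" where
  "val_size (Const c) = bits c"
| "val_size (Cell a) = 1"
| "val_size (Add a b) = val_size a + val_size b"
| "val_size (Sub a b) = val_size a + val_size b"
| "val_size (Mul a b) = val_size a + val_size b"
| "val_size (Div a b) = val_size a + val_size b"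

fun cost_size :: "expr \<Rightarrow> nat" where
  "cost_size (Const c) = bits c"
| "cost_size (Cell a) = cost_size a + 1"
| "cost_size (Add a b) = cost_size a + cost_size b + val_size (Add a b)"
| "cost_size (Sub a b) = cost_size a + cost_size b + val_size (Sub a b)"
| "cost_size (Mul a b) = cost_size a + cost_size b + val_size (Mul a b)"
| "cost_size (Div a b) = cost_size a + cost_size b + val_size (Div a b)"

text \<open>Running time when every cell has at most \<open>\<beta>\<close> bits and no loop makes more than \<open>Y\<close> iterations.\<close>

fun time_bound :: "nat \<Rightarrow> nat \<Rightarrow> program \<Rightarrow> nat" where
  "time_bound \<beta> Y Skip = 1"
| "time_bound \<beta> Y (Assign a e) = (cost_size a + cost_size e) * \<beta> + 1"
| "time_bound \<beta> Y (Seq P P') = time_bound \<beta> Y P + time_bound \<beta> Y P'"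
| "time_bound \<beta> Y (Cond e P P') = cost_size e * \<beta> + 1 + time_bound \<beta> Y P + time_bound \<beta> Y P'"
| "time_bound \<beta> Y (While e P) = (Y + 1) * (cost_size e * \<beta> + 1 + time_bound \<beta> Y P)"

text \<open>A fixed program has fixed loop nesting, so polynomial bounds for cells and iterations
  compose to one polynomial for all inputs.\<close>

lemma time_bound_poly:
  fixes b y :: "nat poly"
  shows "\<exists>q :: nat poly. \<forall>S. time_bound (poly b S) (poly y S) P = poly q S"
proof (induction P)
  case Skip
  show ?case by (rule exI[of _ 1]) simp
next
  case (Assign a e)
  show ?case by (rule exI[of _ "[:cost_size a + cost_size e:] * b + 1"]) simp
next
  case (Seq P P')
  then obtain q q' where "\<forall>S. time_bound (poly b S) (poly y S) P = poly q S"
    "\<forall>S. time_bound (poly b S) (poly y S) P' = poly q' S" by blast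
  then show ?case by (intro exI[of _ "q + q'"]) simp
next
  case (Cond e P P')
  then obtain q q' where "\<forall>S. time_bound (poly b S) (poly y S) P = poly q S"
    "\<forall>S. time_bound (poly b S) (poly y S) P' = poly q' S" by blast
  then show ?case by (intro exI[of _ "[:cost_size e:] * b + 1 + q + q'"]) simp
next
  case (While e P)
  then obtain q where "\<forall>S. time_bound (poly b S) (poly y S) P = poly q S" by blast
  then show ?case by (intro exI[of _ "(y + 1) * ([:cost_size e:] * b + 1 + q)"]) simp
qed

locale bounded_machine =
  fixes \<beta> Y :: nat
  assumes \<beta>_pos: "0 < \<beta>"
begin

definition small :: "memory \<Rightarrow> bool" where
  "small m \<longleftrightarrow> (\<forall>a. bits (m a) \<le> \<beta>)"

lemma bits_val: "small m \<Longrightarrow> bits (val e m) \<le> val_size e * \<beta>"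
proof (induction e)
  case (Const c)
  then show ?case using \<beta>_pos mult_le_mono2[of 1 \<beta> "bits c"] by simp
qed (simp_all add: small_def distrib_right order_trans[OF bits_add add_mono] order_trans[OF bits_sub add_mono]
    order_trans[OF bits_mult add_mono] order_trans[OF bits_div trans_le_add1])

lemma cost_le:
  assumes "small m" shows "cost e m \<le> cost_size e * \<beta>"
proof (induction e)
  case (Const c)
  then show ?case using \<beta>_pos mult_le_mono2[of 1 \<beta> "bits c"] by simp
next
  case (Cell e)
  then show ?case using bits_val[OF assms, of "Cell e"] by (simp add: distrib_right)
qed (use bits_val[OF assms] in \<open>simp_all only: cost.simps cost_size.simps distrib_right add_mono\<close>)

text \<open>Total correctness with running time: the time bound and the preservation of
  \<open>small\<close> belong to the claim. As \<open>small m\<close> is a premise, an assignment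
  only has to show that the new value is small.\<close>

definition wp :: "program \<Rightarrow> memory \<Rightarrow> (memory \<Rightarrow> bool) \<Rightarrow> bool" where
  "wp P m R \<longleftrightarrow> (small m \<longrightarrow> (\<exists>s m'. exec P m s m' \<and> s \<le> time_bound \<beta> Y P \<and> small m' \<and> R m'))"

lemma wp_mono: "wp P m R \<Longrightarrow> (\<And>m'. R m' \<Longrightarrow> R' m') \<Longrightarrow> wp P m R'"
  by (auto simp: wp_def)

lemma wp_Assign:
  assumes "bits (val e m) \<le> \<beta>" "R (m(val a m := val e m))"
  shows "wp (Assign a e) m R"
  unfolding wp_def
proof
  assume m: "small m"
  show "\<exists>s m'. exec (Assign a e) m s m' \<and> s \<le> time_bound \<beta> Y (Assign a e) \<and> small m' \<and> R m'"
    using exec.Assign[of a e m] cost_le[OF m, of a] cost_le[OF m, of e] assms m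
    by (intro exI[of _ "cost a m + cost e m + 1"] exI[of _ "m(val a m := val e m)"])
      (auto simp: distrib_right small_def)
qed

lemma wp_Seq:
  assumes "wp P m (\<lambda>m'. wp P' m' R)"
  shows "wp (Seq P P') m R"
  unfolding wp_def
proof
  assume m: "small m"
  obtain s m' where 1: "exec P m s m'" "s \<le> time_bound \<beta> Y P" "small m'" "wp P' m' R"
    using assms m by (auto simp: wp_def)
  then obtain s' m'' where 2: "exec P' m' s' m''" "s' \<le> time_bound \<beta> Y P'" "small m''" "R m''"
    by (auto simp: wp_def)
  show "\<exists>s m'. exec (Seq P P') m s m' \<and> s \<le> time_bound \<beta> Y (Seq P P') \<and> small m' \<and> R m'"
    using exec.Seq[OF 1(1) 2(1)] 1 2 by (intro exI[of _ "s + s'"] exI[of _ m'']) auto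
qed

lemma wp_Cond:
  assumes "val e m > 0 \<Longrightarrow> wp P m R" "\<not> val e m > 0 \<Longrightarrow> wp P' m R"
  shows "wp (Cond e P P') m R"
  unfolding wp_def
proof
  assume m: "small m"
  show "\<exists>s m'. exec (Cond e P P') m s m' \<and> s \<le> time_bound \<beta> Y (Cond e P P') \<and> small m' \<and> R m'"
  proof (cases "val e m > 0")
    case True
    then obtain s m' where 1: "exec P m s m'" "s \<le> time_bound \<beta> Y P" "small m'" "R m'"
      using assms m by (auto simp: wp_def)
    show ?thesis
      using exec.CondTrue[OF True 1(1), of P'] 1 cost_le[OF m, of e]
      by (intro exI[of _ "cost e m + 1 + s"] exI[of _ m']) auto
  next
    case False
    then obtain s m' where 1: "exec P' m s m'" "s \<le> time_bound \<beta> Y P'" "small m'" "R m'"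
      using assms m by (auto simp: wp_def)
    show ?thesis
      using exec.CondFalse[OF False 1(1), of P] 1 cost_le[OF m, of e]
      by (intro exI[of _ "cost e m + 1 + s"] exI[of _ m']) auto
  qed
qed

text \<open>The number k of iterations is fixed in advance and the invariant is indexed by the
  completed ones. The guard holds exactly while i < k, which gives termination and the time bound at
  once.\<close>

lemma wp_While_aux:
  assumes "I i m" and "i \<le> k"
    and step: "\<And>i m. i < k \<Longrightarrow> I i m \<Longrightarrow> val e m > 0 \<and> wp P m (I (Suc i))"
    and stop: "\<And>m. I k m \<Longrightarrow> \<not> val e m > 0" and "small m"
  shows "\<exists>s m'. exec (While e P) m s m' \<and> s \<le> (k - i + 1) * (cost_size e * \<beta> + 1 + time_bound \<beta> Y P) \<and>
    small m' \<and> I k m'"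
  using assms(1,2,5)
proof (induction "k - i" arbitrary: i m)
  case 0
  then have "i = k" by simp
  then show ?case
    using exec.WhileFalse[OF stop, of m P] cost_le[of m e] 0
    by (intro exI[of _ "cost e m + 1"] exI[of _ m]) auto
next
  case (Suc d)
  then have i: "i < k" by simp
  let ?u = "cost_size e * \<beta> + 1 + time_bound \<beta> Y P"
  have v: "val e m > 0" and w: "wp P m (I (Suc i))" using step[OF i Suc.prems(1)] by auto
  obtain s m' where 1: "exec P m s m'" "s \<le> time_bound \<beta> Y P" "small m'" "I (Suc i) m'"
    using w Suc.prems(3) by (auto simp: wp_def)
  obtain s' m'' where 2: "exec (While e P) m' s' m''"
    "s' \<le> (k - Suc i + 1) * ?u" "small m''" "I k m''"
    using Suc.hyps(1)[OF _ 1(4) _ 1(3)] Suc.hyps(2) i by fastforce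
  have "cost e m + 1 + s + s' \<le> ?u + (k - Suc i + 1) * ?u"
    using 1(2) 2(2) cost_le[OF Suc.prems(3), of e] by linarith
  also have "\<dots> = (k - i + 1) * ?u" using Suc.hyps(2) i by (simp add: Suc_diff_Suc)
  finally show ?case using exec.WhileTrue[OF v 1(1) 2(1)] 2 by blast
qed

lemma wp_While:
  assumes "I 0 m" and "k \<le> Y"
    and step: "\<And>i m. i < k \<Longrightarrow> I i m \<Longrightarrow> val e m > 0 \<and> wp P m (I (Suc i))"
    and stop: "\<And>m. I k m \<Longrightarrow> \<not> val e m > 0 \<and> R m"
  shows "wp (While e P) m R"
  unfolding wp_def
proof
  assume m: "small m"
  let ?u = "cost_size e * \<beta> + 1 + time_bound \<beta> Y P"
  obtain s m' where 1: "exec (While e P) m s m'" "s \<le> (k - 0 + 1) * ?u" "small m'" "I k m'"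
    using wp_While_aux[of I 0 m k e P] assms m by blast
  have "(k - 0 + 1) * ?u \<le> (Y + 1) * ?u" using \<open>k \<le> Y\<close> by (intro mult_le_mono1) simp
  then show "\<exists>s m'. exec (While e P) m s m' \<and> s \<le> time_bound \<beta> Y (While e P) \<and> small m' \<and> R m'"
    using 1 stop by (intro exI[of _ s] exI[of _ m']) auto
qed

end

section \<open>The program\<close>

text \<open>
  The input is moved from \<open>0, 1, \<dots>\<close> to the addresses \<open>-100, -101, \<dots>\<close>, since the output overwrites it.
  Constants: \<open>-1\<close> \<open>r\<close>, \<open>-2\<close> \<open>n\<close>, \<open>-3\<close> \<open>X\<close>, \<open>-4\<close> number of label bits, \<open>-5\<close> leading term of the weights,
  \<open>-6\<close> \<open>C\<^sup>n\<close>, \<open>-7\<close> \<open>S\<close>, \<open>-8\<close> base, \<open>-9\<close> \<open>C\<close>, \<open>-10\<close> \<open>M\<close>. Variables: \<open>-11\<close> output pointer, \<open>-12\<close> \<open>K\<close>,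
  \<open>-13\<close> \<open>i\<close>, \<open>-14\<close> \<open>k\<close>, \<open>-15\<close> \<open>m\<close>, \<open>-16\<close> end of the range of \<open>m\<close>, \<open>-17\<close> \<open>coef i k\<close>, \<open>-18\<close> its absolute
  value, \<open>-20\<close> \<open>j\<close>, \<open>-21\<close> denominator, \<open>-22\<close> weight, \<open>-23\<close> power of the base, \<open>-24\<close> and \<open>-25\<close> right-hand
  side, \<open>-26\<close> to \<open>-29\<close> current factor and row, \<open>-30\<close> to \<open>-33\<close> numerator, slot weight, denominator and
  slot of a vertex, \<open>-34\<close> shifted code, \<open>-35\<close> loop counter,
  \<open>-37\<close> code, \<open>-38\<close> first slot of a block.
\<close>

abbreviation var :: "int \<Rightarrow> expr" where "var c \<equiv> Cell (Const c)"

abbreviation assign :: "int \<Rightarrow> expr \<Rightarrow> program" (infix "::=" 61) where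
  "c ::= e \<equiv> Assign (Const c) e"

notation Seq (infixr ";;" 60)
notation Add (infixl "[+]" 65)
notation Sub (infixl "[-]" 65)
notation Mul (infixl "[*]" 70)
notation Div (infixl "[div]" 70)

definition append_cell :: "expr \<Rightarrow> program" where
  "append_cell e = Assign (var (-11)) e;; -11 ::= var (-11) [+] Const 1"

text \<open>Tests are replaced by arithmetic: q - 2 (q div 2) is the lowest bit of the shifted code,
  and 1 div (1 + (c - v)^2) is 1 for c = v and 0 otherwise.\<close>

definition emit_vertex :: program where
  "emit_vertex =
    -35 ::= Const 0;;
    -34 ::= var (-37);;
    While (var (-4) [-] var (-35))
      (append_cell (var (-31) [*] (var (-34) [-] Const 2 [*] (var (-34) [div] Const 2)));;
       append_cell (var (-32));;
       -34 ::= var (-34) [div] Const 2;;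
       -35 ::= var (-35) [+] Const 1);;
    -35 ::= Const 0;;
    While (Const 2 [*] var (-2) [+] Const 2 [-] var (-35))
      (append_cell (var (-30) [*] (Const 1 [div]
         (Const 1 [+] (var (-35) [-] var (-33)) [*] (var (-35) [-] var (-33)))));;
       append_cell (var (-32));;
       -35 ::= var (-35) [+] Const 1)"

text \<open>\<open>e\<close> selects the end t = X, and \<open>s\<close> the slack slot of the
  current row.\<close>

definition emit_corner :: "bool \<Rightarrow> bool \<Rightarrow> program" where
  "emit_corner e s =
    -31 ::= (if s then var (-22) else var (-22) [*] var (-21));;
    -32 ::= var (-31) [*] (if e then var (-10) [+] var (-3) else var (-10));;
    -30 ::= (if e then var (-24) [+] var (-3) [*] var (-25) else var (-24));;
    -33 ::= (if s then var (-38) [+] Const 1 else var (-38));;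
    emit_vertex"

definition emit_block :: program where
  "emit_block = emit_corner False False;; emit_corner False True;; emit_corner True False;; emit_corner True True"

text \<open>Input cell p is copied to -100 - p. Cells 0 to 3 hold the length, N, r and n, then come
  r coefficients, then four integers for each pair (i, j).\<close>

abbreviation entry :: "int \<Rightarrow> expr" where
  "entry c \<equiv> Cell (Const (-104) [-] var (-1) [-] Const 4 [*] (var (-13) [*] var (-2) [+] var (-20)) [-] Const c)"

definition load_factor :: program where
  "load_factor =
    -26 ::= entry 0 [*] entry 3;;
    -27 ::= entry 2 [*] entry 1;;
    -21 ::= entry 1 [*] entry 3;;
    -22 ::= var (-5) [+] var (-23)"

definition set_row :: program where
  "set_row =
    Cond (var (-15) [-] var (-20))
      (-28 ::= var (-26);;
       -29 ::= var (-27) [+] ((var (-14) [+] Const 1) [*] var (-7) [-] Const 1) [*] var (-21))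
      (Cond (var (-20) [-] var (-15))
        (-28 ::= Const 0;;
         -29 ::= (var (-9) [-] Const 1) [*] var (-21))
        (-28 ::= Const 0 [-] var (-26);;
         -29 ::= Const 0 [-] var (-27) [-] Const 1 [+] (var (-9) [-] (var (-14) [+] Const 1) [*] var (-7)) [*] var (-21)))"

definition next_factor :: program where
  "next_factor = -23 ::= var (-23) [*] var (-8);; -20 ::= var (-20) [+] Const 1"

text \<open>Every vertex needs the complete right-hand side, so the rows are traversed twice: once
  to accumulate it, once to write vertices. Row 0 has no input factor and is treated before each
  loop.\<close>

definition emit_piece :: program where
  "emit_piece =
    -37 ::= Const 2 [*] ((var (-13) [*] (var (-2) [+] Const 1) [+] var (-14)) [*] (var (-2) [+] Const 1) [+] var (-15)) [+] Const 1;;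
    -22 ::= var (-5) [+] Const 1;;
    -24 ::= var (-22) [*] (var (-18) [-] Const 1);;
    -25 ::= Const 0;;
    -23 ::= var (-8);;
    -20 ::= Const 0;;
    While (var (-2) [-] var (-20))
      (load_factor;; set_row;;
       -24 ::= var (-24) [+] var (-22) [*] var (-29);;
       -25 ::= var (-25) [+] var (-22) [*] var (-28);;
       next_factor);;
    -21 ::= Const 1;;
    -22 ::= var (-5) [+] Const 1;;
    -38 ::= Const 0;;
    emit_block;;
    -23 ::= var (-8);;
    -20 ::= Const 0;;
    While (var (-2) [-] var (-20))
      (load_factor;;
       -38 ::= Const 2 [*] var (-20) [+] Const 2;;
       emit_block;;
       next_factor)"

text \<open>Consecutive coefficients differ by the factor -(n - k) / (k + 2), so the next one is
  obtained by an exact division.\<close>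

definition emit_shift :: program where
  "emit_shift =
    Cond (var (-17))
      (-15 ::= var (-2);; -16 ::= var (-2) [+] Const 1;; -18 ::= var (-17))
      (Cond (Const 0 [-] var (-17))
        (-15 ::= Const 0;; -16 ::= var (-2);; -18 ::= Const 0 [-] var (-17);;
         -12 ::= var (-12) [+] var (-18) [*] var (-6))
        (-15 ::= Const 0;; -16 ::= Const 0));;
    While (var (-16) [-] var (-15)) (emit_piece;; -15 ::= var (-15) [+] Const 1);;
    -17 ::= ((Const 0 [-] var (-17)) [*] (var (-2) [-] var (-14))) [div] (var (-14) [+] Const 2);;
    -14 ::= var (-14) [+] Const 1"

definition emit_summand :: program where
  "emit_summand =
    -17 ::= (var (-2) [+] Const 1) [*] Cell (Const (-104) [-] var (-13));;
    -14 ::= Const 0;;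
    While (var (-2) [+] Const 1 [-] var (-14)) emit_shift;;
    -13 ::= var (-13) [+] Const 1"

text \<open>The header is filled in last: K and the number of vertices are known only when all
  vertices have been written.\<close>

definition emit_all :: program where
  "emit_all =
    -11 ::= Const 5;; -12 ::= Const 0;; -13 ::= Const 0;;
    While (var (-1) [-] var (-13)) emit_summand;;
    1 ::= var (-4) [+] Const 2 [*] var (-2) [+] Const 2;;
    2 ::= var (-12);;
    3 ::= var (-10);;
    4 ::= (var (-11) [-] Const 5) [div] (Const 2 [*] var 1);;
    0 ::= var (-11) [-] Const 1"

definition copy_input :: program where
  "copy_input =
    -3 ::= Const 1;; -35 ::= Const 0;;
    While (var 0 [+] Const 1 [-] var (-35))
      (-3 ::= var (-3) [*] (Cell (var (-35)) [*] Cell (var (-35)) [+] Const 2);;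
       Assign (Const (-100) [-] var (-35)) (Cell (var (-35)));;
       -35 ::= var (-35) [+] Const 1)"

text \<open>Doubling finds the least \<open>lg\<close> with r \<le> 2^lg. Cell -5 starts at the
  square of the base and ends at its power n + 2, the leading term of \<open>weight\<close> for n +
  1 rows.\<close>

definition set_constants :: program where
  "set_constants =
    -1 ::= var (-102);; -2 ::= var (-103);;
    -4 ::= Const 1 [+] Const 2 [*] var (-2);; -35 ::= Const 1;;
    While (var (-1) [-] var (-35)) (-35 ::= Const 2 [*] var (-35);; -4 ::= var (-4) [+] Const 1);;
    -10 ::= var (-3) [*] var (-3);;
    -7 ::= var (-10) [*] var (-10);;
    -9 ::= var (-7) [*] var (-10);;
    -8 ::= var (-9) [*] var (-9);;
    -5 ::= var (-8) [*] var (-8);; -6 ::= Const 1;; -35 ::= Const 0;;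
    While (var (-2) [-] var (-35))
      (-5 ::= var (-5) [*] var (-8);; -6 ::= var (-6) [*] var (-9);; -35 ::= var (-35) [+] Const 1)"

definition polytope_program :: program where
  "polytope_program = copy_input;; set_constants;; emit_all"

section \<open>Correctness of the program\<close>

text \<open>A frame condition for negative cells only, where the working state lives; the
  nonnegative cells receive the output.\<close>

definition keeps :: "int set \<Rightarrow> memory \<Rightarrow> memory \<Rightarrow> bool" where
  "keeps A m m' \<longleftrightarrow> (\<forall>x<0. x \<notin> A \<longrightarrow> m' x = m x)"

lemma keepsD: "keeps A m m' \<Longrightarrow> x < 0 \<Longrightarrow> x \<notin> A \<Longrightarrow> m' x = m x"
  by (simp add: keeps_def)

lemma keeps_refl [simp]: "keeps A m m"
  by (simp add: keeps_def)

lemma keeps_extend: "keeps A m m' \<Longrightarrow> keeps B m' m'' \<Longrightarrow> B \<subseteq> A \<Longrightarrow> keeps A m m''"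
  unfolding keeps_def by (metis subsetD)

lemma keeps_upd [simp]: "x \<in> A \<or> 0 \<le> x \<Longrightarrow> keeps A m (m'(x := v)) \<longleftrightarrow> keeps A m m'"
  unfolding keeps_def by (metis fun_upd_other linorder_not_less)

text \<open>Vertex data start at cell 5, behind the length and the four header entries; cell -11
  points to the first free cell.\<close>

definition out :: "memory \<Rightarrow> int list \<Rightarrow> bool" where
  "out m ys \<longleftrightarrow> m (-11) = 5 + int (length ys) \<and> (\<forall>i<length ys. m (5 + int i) = ys ! i)"

lemma out_upd [simp]: "x < 5 \<Longrightarrow> x \<noteq> -11 \<Longrightarrow> out (m(x := v)) ys \<longleftrightarrow> out m ys"
  by (auto simp: out_def)

text \<open>X^(12n+40) bounds every number that the program stores, and \<open>cap\<close> bounds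
  the number of vertex entries so that the output pointer obeys this too. \<open>a1\<close>,
  \<open>a2\<close> and \<open>b1\<close>, \<open>b2\<close> are the numerators and denominators of
  the input fractions.\<close>

locale floor_program = floor_instance r n lg X g a b D + bounded_machine \<beta> Y
  for r n lg X g a b D \<beta> Y +
  fixes a1 a2 b1 b2 :: "nat \<Rightarrow> nat \<Rightarrow> int" and cap :: nat
  assumes a_eq: "i < r \<Longrightarrow> j < n \<Longrightarrow> a i j = a1 i j * b2 i j"
    and b_eq: "i < r \<Longrightarrow> j < n \<Longrightarrow> b i j = b1 i j * a2 i j"
    and D_eq: "i < r \<Longrightarrow> j < n \<Longrightarrow> D i j = a2 i j * b2 i j"
    and bits_le: "\<bar>v\<bar> \<le> X ^ (12 * n + 40) \<Longrightarrow> bits v \<le> \<beta>"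
    and X_r: "int r \<le> X" and X_lg: "int lg \<le> X"
    and Y_r: "r \<le> Y" and Y_h: "hh \<le> Y" and Y_v: "vv \<le> Y"
    and cap: "int cap + 5 \<le> X ^ (12 * n + 40)"
begin

definition env :: "memory \<Rightarrow> bool" where
  "env m \<longleftrightarrow> m (-1) = int r \<and> m (-2) = int n \<and> m (-3) = X \<and> m (-4) = int hh \<and>
    m (-5) = (X ^ 12) ^ (n + 2) \<and> m (-6) = (X ^ 6) ^ n \<and> m (-7) = X ^ 4 \<and> m (-8) = X ^ 12 \<and>
    m (-9) = X ^ 6 \<and> m (-10) = X ^ 2 \<and> (\<forall>i<r. m (-104 - int i) = g i) \<and>
    (\<forall>i<r. \<forall>j<n. let c = -104 - int r - 4 * (int i * int n + int j) in
      m c = a1 i j \<and> m (c - 1) = a2 i j \<and> m (c - 2) = b1 i j \<and> m (c - 3) = b2 i j)"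

text \<open>Constants occupy -10 to -1 and the input copy starts at -100 going down; the variables
  lie strictly between, so writing to them preserves \<open>env\<close>.\<close>

lemma env_cong:
  assumes "\<And>x. -10 \<le> x \<and> x < 0 \<or> x \<le> -100 \<Longrightarrow> m' x = m x"
  shows "env m' \<longleftrightarrow> env m"
proof -
  let ?c = "\<lambda>i j. -104 - int r - 4 * (int i * int n + int j)"
  have le: "?c i j \<le> -100" for i j
  proof -
    have "0 \<le> 4 * (int i * int n + int j)" by simp
    then show ?thesis by linarith
  qed
  have "m' (?c i j) = m (?c i j)" "m' (?c i j - 1) = m (?c i j - 1)"
    "m' (?c i j - 2) = m (?c i j - 2)" "m' (?c i j - 3) = m (?c i j - 3)" for i j
    using le[of i j] by (intro assms; linarith)+
  moreover have "m' (-104 - int i) = m (-104 - int i)" for i by (rule assms) simp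
  moreover have "m' (-1) = m (-1)" "m' (-2) = m (-2)" "m' (-3) = m (-3)" "m' (-4) = m (-4)" "m' (-5) = m (-5)"
    "m' (-6) = m (-6)" "m' (-7) = m (-7)" "m' (-8) = m (-8)" "m' (-9) = m (-9)" "m' (-10) = m (-10)"
    by (rule assms, simp)+
  ultimately show ?thesis unfolding env_def Let_def by (simp only:)
qed

lemma env_upd [simp]: "-100 < x \<and> x < -10 \<or> 0 \<le> x \<Longrightarrow> env (m(x := v)) \<longleftrightarrow> env m"
  by (rule env_cong) auto

lemma env_keeps:
  assumes "env m" "keeps A m m'" "A \<subseteq> {-99..-11}"
  shows "env m'"
proof -
  have "m' x = m x" if "-10 \<le> x \<and> x < 0 \<or> x \<le> -100" for x
    using that assms(3) by (intro keepsD[OF assms(2)]) auto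
  then show ?thesis using env_cong[of m' m] assms(1) by blast
qed

lemma envD:
  assumes "env m"
  shows "m (-1) = int r" "m (-2) = int n" "m (-3) = X" "m (-4) = int hh"
    "m (-5) = (X ^ 12) ^ (n + 2)" "m (-6) = (X ^ 6) ^ n" "m (-7) = X ^ 4" "m (-8) = X ^ 12"
    "m (-9) = X ^ 6" "m (-10) = X ^ 2"
  using assms by (simp_all add: env_def)

lemma bits_leI: "\<bar>v\<bar> \<le> X ^ p \<Longrightarrow> p \<le> 12 * n + 40 \<Longrightarrow> bits v \<le> \<beta>"
  using X_mono[of p "12 * n + 40"] bits_le[of v] by linarith

lemma wp_append_cell:
  assumes "out m ys" "val e m = v" "\<bar>v\<bar> \<le> X ^ (12 * n + 40)" "length ys < cap"
    and R: "\<And>m'. out m' (ys @ [v]) \<Longrightarrow> keeps {-11} m m' \<Longrightarrow> R m'"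
  shows "wp (append_cell e) m R"
  unfolding append_cell_def
proof (rule wp_Seq, rule wp_Assign)
  have m: "m (-11) = 5 + int (length ys)" using assms(1) by (simp add: out_def)
  show "bits (val e m) \<le> \<beta>" using assms(2,3) bits_le by simp
  let ?m = "m(val (var (-11)) m := val e m)"
  have "?m (-11) = 5 + int (length ys)" using m by simp
  then have v: "val (var (-11) [+] Const 1) ?m = 6 + int (length ys)" by simp
  show "wp (-11 ::= var (-11) [+] Const 1) ?m R"
  proof (rule wp_Assign)
    show "bits (val (var (-11) [+] Const 1) ?m) \<le> \<beta>"
      unfolding v using cap assms(4) by (intro bits_le) simp
    show "R (?m(val (Const (-11)) ?m := val (var (-11) [+] Const 1) ?m))"
      unfolding v using m assms(1,2)
      by (intro R) (auto simp: out_def nth_append keeps_def less_Suc_eq)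
  qed
qed

lemma wp_append_pair:
  assumes "out m ys" "val e m = v" "\<bar>v\<bar> \<le> X ^ (12 * n + 40)" "\<bar>m (-32)\<bar> \<le> X ^ (12 * n + 40)" "length ys + 2 \<le> cap"
    and R: "\<And>m'. out m' (ys @ [v, m (-32)]) \<Longrightarrow> keeps {-11} m m' \<Longrightarrow> wp P m' R"
  shows "wp (append_cell e;; append_cell (var (-32));; P) m R"
  apply (rule wp_Seq, rule wp_append_cell[OF assms(1-3)])
  subgoal using assms(5) by simp
  subgoal premises p for m1
    apply (rule wp_Seq, rule wp_append_cell[OF p(1) _ assms(4)])
    subgoal by (simp add: keepsD[OF p(2)])
    subgoal using assms(5) by simp
    subgoal premises p2 for m2 using p2 p by (intro R) (auto intro: keeps_extend)
    done
  done

lemma flat_Cons: "flat [] = []" "flat (p # v) = fst p # snd p # flat v"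
  by (simp_all add: flat_def split: prod.splits)

lemma flat_append: "flat (v @ w) = flat v @ flat w"
  by (simp add: flat_def)

lemma length_flat: "length (flat v) = 2 * length v"
  by (induction v) (auto simp: flat_Cons)

lemma X_ge: "int n \<le> X" "int hh \<le> X ^ 4" "int vv \<le> X ^ 2"
proof -
  show n: "int n \<le> X" using X_n by simp
  have X: "2 * X \<le> X ^ 2" "2 * X ^ 2 \<le> X ^ 3" "2 * X ^ 3 \<le> X ^ 4" "2 \<le> X"
    using mult_right_mono[of 2 X X] mult_right_mono[of 2 X "X ^ 2"] mult_right_mono[of 2 X "X ^ 3"] X2
    by (simp_all add: power_numeral_reduce)
  show "int vv \<le> X ^ 2" using X X_n by (simp add: vv_def)
  show "int hh \<le> X ^ 4" using X n X_lg by (simp add: hh_def)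
qed

lemma wp_emit_vertex:
  assumes "env m" "out m ys" "length ys + 2 * (hh + vv) \<le> cap"
    and q: "m (-37) = int q" "int q \<le> X ^ (12 * n + 40)"
    and le: "\<bar>m (-31)\<bar> \<le> X ^ (12 * n + 40)" "\<bar>m (-32)\<bar> \<le> X ^ (12 * n + 40)" "\<bar>m (-30)\<bar> \<le> X ^ (12 * n + 40)"
    and v: "m (-33) = int v"
  shows "wp emit_vertex m (\<lambda>m'. out m' (ys @ flat (map (\<lambda>c. (m (-31) * of_bool (bit q c), m (-32))) [0..<hh] @
      map (\<lambda>v'. (m (-30) * of_bool (v' = v), m (-32))) [0..<vv])) \<and> keeps {-35, -34, -11} m m')"
proof -
  let ?f = "\<lambda>c. (m (-31) * of_bool (bit q c), m (-32))" and ?h = "\<lambda>v'. (m (-30) * of_bool (v' = v), m (-32))"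
  let ?zs = "ys @ flat (map ?f [0..<hh])"
  let ?A = "{-35, -34, -11} :: int set"
  have X0: "0 \<le> X ^ p" for p using X2 by simp
  have q_le: "\<bar>int (q div 2 ^ c)\<bar> \<le> X ^ (12 * n + 40)" for c
    using q(2) div_le_dividend[of q "2 ^ c"] by linarith
  have small_int: "\<bar>int c\<bar> \<le> X ^ (12 * n + 40)" if "c \<le> hh \<or> c \<le> vv" for c
    using that X_ge(2,3) X_mono[of 4 "12 * n + 40"] X_mono[of 2 "12 * n + 40"] by linarith
  show ?thesis
    unfolding emit_vertex_def
    apply (rule wp_Seq, rule wp_Assign)
    subgoal using bits_leI[of 0 0] by simp
    apply (rule wp_Seq, rule wp_Assign)
    subgoal using q bits_le by simp
    apply (rule wp_Seq, rule wp_While[where k = hh and I = "\<lambda>c m'. keeps ?A m m' \<and> m' (-35) = int c \<and>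
      m' (-34) = int (q div 2 ^ c) \<and> out m' (ys @ flat (map ?f [0..<c]))"])
    subgoal using assms by (simp add: flat_def)
    subgoal by (rule Y_h)
    subgoal premises p for c m'
    proof -
      have c: "c < hh" and I: "keeps ?A m m'" "m' (-35) = int c" "m' (-34) = int (q div 2 ^ c)"
        "out m' (ys @ flat (map ?f [0..<c]))" using p by auto
      note k = keepsD[OF I(1)] envD[OF assms(1)]
      have qs: "int (q div 2 ^ c) div 2 = int (q div 2 ^ Suc c)"
        unfolding power_Suc2 div_mult2_eq by (simp add: zdiv_int)
      have odd: "int x - 2 * (int x div 2) = of_bool (odd x)" for x :: nat
        by (cases "even x") (auto elim!: evenE oddE)
      show ?thesis
        apply (rule conjI)
        subgoal using c I(2) by (simp add: k)
        apply (rule wp_append_pair[OF I(4), where v = "fst (?f c)"])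
        subgoal by (simp add: k I odd bit_iff_odd)
        subgoal using le(1) X0 by (simp add: abs_mult)
        subgoal using le(2) by (simp add: k)
        subgoal using assms(3) c by (simp add: length_flat)
        subgoal premises p2 for m2
          apply (rule wp_Seq, rule wp_Assign)
          subgoal using q_le[of "Suc c"] by (simp add: keepsD[OF p2(2)] I bits_le qs)
          apply (rule wp_Assign)
          subgoal using small_int[of "Suc c"] c by (simp add: keepsD[OF p2(2)] I bits_le)
          subgoal using p2(1) keeps_extend[OF I(1) p2(2)] by (simp add: keepsD[OF p2(2)] k I flat_Cons flat_append qs)
          done
        done
    qed
    subgoal premises p for m'
    proof -
      have I: "keeps ?A m m'" "m' (-35) = int hh" "out m' ?zs" using p by auto
      note k = keepsD[OF I(1)] envD[OF assms(1)]
      show ?thesis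
        apply (rule conjI)
        subgoal using I by (simp add: k)
        apply (rule wp_Seq, rule wp_Assign)
        subgoal using bits_leI[of 0 0] by simp
        apply (rule wp_While[where k = vv and I = "\<lambda>c m'. keeps ?A m m' \<and> m' (-35) = int c \<and>
          out m' (?zs @ flat (map ?h [0..<c]))"])
        subgoal using I by (simp add: flat_def)
        subgoal by (rule Y_v)
        subgoal premises p for c m'
        proof -
          have c: "c < vv" and I: "keeps ?A m m'" "m' (-35) = int c"
            "out m' (?zs @ flat (map ?h [0..<c]))" using p by auto
          note k = keepsD[OF I(1)] envD[OF assms(1)]
          have ind: "1 div (1 + (int c - int v) * (int c - int v)) = of_bool (c = v)"
          proof (cases "c = v")
            case False
            then have "0 < (int c - int v) * (int c - int v)" by (auto simp: zero_less_mult_iff)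
            then show ?thesis using False by simp
          qed simp
          show ?thesis
            apply (rule conjI)
            subgoal using c I(2) by (simp add: k vv_def)
            apply (rule wp_append_pair[OF I(3), where v = "fst (?h c)"])
            subgoal by (simp add: k I ind v)
            subgoal using le(3) X0 by (simp add: abs_mult)
            subgoal using le(2) by (simp add: k)
            subgoal using assms(3) c by (simp add: length_flat)
            subgoal premises p2 for m2
              apply (rule wp_Assign)
              subgoal using small_int[of "Suc c"] c by (simp add: keepsD[OF p2(2)] I bits_le)
              subgoal using p2(1) keeps_extend[OF I(1) p2(2)] by (simp add: keepsD[OF p2(2)] k I flat_Cons flat_append)
              done
            done
        qed
        subgoal by (auto simp: vv_def keepsD envD[OF assms(1)] flat_append)
        done
    qed
    done
qed

lemma wp_set:
  assumes "val e m = v" "\<bar>v\<bar> \<le> X ^ p" "p \<le> 12 * n + 40" "wp P (m(c := v)) R"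
  shows "wp (c ::= e;; P) m R"
  using assms bits_leI by (intro wp_Seq wp_Assign) auto

lemma wp_set_last:
  assumes "val e m = v" "\<bar>v\<bar> \<le> X ^ p" "p \<le> 12 * n + 40" "R (m(c := v))"
  shows "wp (c ::= e) m R"
  using assms bits_leI by (intro wp_Assign) auto

lemma wp_const: "0 \<le> v \<Longrightarrow> v \<le> 5 \<Longrightarrow> wp P (m(c := v)) R \<Longrightarrow> wp (c ::= Const v;; P) m R"
  using X4 by (intro wp_set[where p = 4 and v = v]) auto

lemma wp_count:
  "m c = int q \<Longrightarrow> int q + 1 \<le> X \<Longrightarrow> R (m(c := int (Suc q))) \<Longrightarrow> wp (c ::= var c [+] Const 1) m R"
  by (rule wp_set_last[where p = 1 and v = "int (Suc q)"]) simp_all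

section \<open>Bounds for the numbers written by the program\<close>

lemma abs_mult_le: "\<bar>u\<bar> \<le> X ^ p \<Longrightarrow> \<bar>v\<bar> \<le> X ^ q \<Longrightarrow> \<bar>u * v\<bar> \<le> X ^ (p + q)"
  using X2 unfolding abs_mult power_add by (intro mult_mono) auto

lemma abs_add_le:
  assumes "\<bar>u\<bar> \<le> X ^ p" "\<bar>v\<bar> \<le> X ^ q" "p \<le> s" "q \<le> s"
  shows "\<bar>u + v\<bar> \<le> X ^ Suc s"
proof -
  have "\<bar>u + v\<bar> \<le> 2 * X ^ s"
    using assms X_mono[of p s] X_mono[of q s] by linarith
  also have "\<dots> \<le> X ^ Suc s" using X2 by simp
  finally show ?thesis .
qed

lemma wt_le:
  assumes "j \<le> n" shows "\<bar>wt j\<bar> \<le> X ^ (12 * n + 25)"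
proof -
  have "X ^ (12 * j) \<le> X ^ (12 * n + 24)" using assms by (intro X_mono) simp
  then have "wt j \<le> 2 * X ^ (12 * n + 24)"
    by (simp add: wt_def weight_def power_mult[symmetric] algebra_simps flip: power_Suc power_add)
  also have "\<dots> \<le> X * X ^ (12 * n + 24)" using X2 by (intro mult_right_mono) auto
  also have "\<dots> = X ^ (12 * n + 25)" by (simp add: add.commute flip: power_Suc)
  finally show ?thesis using wt_pos[of j] by simp
qed

lemma dens_le: "i < r \<Longrightarrow> j < Suc n \<Longrightarrow> \<bar>dens i j\<bar> \<le> X ^ 2"
  using D_le[of i "j - 1"] dens_pos[of i j] X2 by (cases j) (auto simp: one_le_power)

lemma slot_even: "slot i (2 * j) = wt j * dens i j"
  and slot_odd: "slot i (Suc (2 * j)) = wt j"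
  by (simp_all add: slot_def slot_weight_def wt_def)

lemma slot_le:
  assumes "i < r" "v < vv" shows "\<bar>slot i v\<bar> \<le> X ^ (12 * n + 27)"
proof -
  obtain j where j: "v = 2 * j \<or> v = Suc (2 * j)" by (metis Suc_eq_plus1 evenE oddE)
  then have "j < Suc n" using assms by (auto simp: vv_def)
  then have "\<bar>wt j\<bar> \<le> X ^ (12 * n + 25)" "\<bar>dens i j\<bar> \<le> X ^ 2" "\<bar>wt j * dens i j\<bar> \<le> X ^ (12 * n + 25 + 2)"
    using wt_le[of j] dens_le[of i j] assms abs_mult_le[of "wt j" "12 * n + 25" "dens i j" 2] by auto
  moreover have "X ^ (12 * n + 25) \<le> X ^ (12 * n + 27)" by (rule X_mono) simp
  ultimately show ?thesis using j by (auto simp: slot_even slot_odd add.commute)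
qed

lemma den_le:
  assumes "i < r" "v < vv" shows "\<bar>den i e v\<bar> \<le> X ^ (12 * n + 30)"
proof -
  have "\<bar>X ^ 2 + (if e then X else 0)\<bar> \<le> X ^ Suc 2"
    using X2 by (intro abs_add_le[of _ 2 _ 1]) auto
  from abs_mult_le[OF slot_le[OF assms] this] show ?thesis
    by (simp add: den_def add.commute)
qed

lemma code_le:
  assumes "i < r" "k \<le> n" "m \<le> n" shows "\<bar>int (code i k m)\<bar> \<le> X ^ 4"
proof -
  have "code i k m \<le> 2 * (r * (n + 1) * (n + 1))"
    using code_bound[OF assms] by (simp add: code_def)
  then have "int (code i k m) \<le> int (2 * (r * (n + 1) * (n + 1)))" by (rule zle_int[THEN iffD2])
  also have "\<dots> = 2 * (int r * (int n + 1) * (int n + 1))" by (simp add: algebra_simps)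
  also have "\<dots> \<le> X * (X * X * X)"
    using X2 X_r X_n by (intro mult_mono) auto
  finally show ?thesis by (simp add: power_numeral_reduce)
qed

lemma partial_sum_le:
  assumes "\<And>j. j < Suc n \<Longrightarrow> \<bar>f j\<bar> \<le> X ^ 9" "q \<le> Suc n"
  shows "\<bar>\<Sum>j<q. wt j * f j\<bar> \<le> X ^ (12 * n + 35)"
proof -
  have "\<bar>\<Sum>j<q. wt j * f j\<bar> \<le> (\<Sum>j<q. X ^ (12 * n + 25 + 9))"
    using assms wt_le by (intro order_trans[OF sum_abs] sum_mono abs_mult_le) auto
  also have "\<dots> = int q * X ^ (12 * n + 34)" by (simp add: add.commute)
  also have "\<dots> \<le> X * X ^ (12 * n + 34)" using assms X_n X2 by (intro mult_right_mono) auto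
  finally show ?thesis by (simp add: add.commute flip: power_Suc)
qed

lemma offset_le:
  assumes "i < r" "k \<le> n" "m \<in> ms i k" "j < Suc n"
  shows "\<bar>offset i k m j\<bar> \<le> X ^ 9"
  using row_bounds(1,2)[OF assms(1,2) _ _ assms(3,4), of 0] X2 by (simp add: row_def)

lemma slope_le:
  assumes "i < r" "j < Suc n" shows "\<bar>slope i m j\<bar> \<le> X ^ 9"
proof -
  have "X ^ 2 \<le> X ^ 9" by (rule X_mono) simp
  moreover have "0 \<le> X ^ 9" using X2 by simp
  ultimately show ?thesis using a_le[OF assms(1), of "j - 1"] assms(2) by (cases j) auto
qed

text \<open>The exponents add up: 12 n + 25 for a weight, 9 for a row entry, 1 for the number of
  rows, and in \<open>rhs\<close> one each for the multiplication by X and for the addition.\<close>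

lemma rhs_le:
  assumes "i < r" "k \<le> n" "m \<in> ms i k"
  shows "\<bar>rhs0 i k m\<bar> \<le> X ^ (12 * n + 35)" "\<bar>rhs1 i k m\<bar> \<le> X ^ (12 * n + 35)"
    "\<bar>rhs i k m e\<bar> \<le> X ^ (12 * n + 37)"
proof -
  show 0: "\<bar>rhs0 i k m\<bar> \<le> X ^ (12 * n + 35)"
    unfolding rhs0_def using offset_le assms by (intro partial_sum_le) auto
  show 1: "\<bar>rhs1 i k m\<bar> \<le> X ^ (12 * n + 35)"
    unfolding rhs1_def using slope_le assms by (intro partial_sum_le) auto
  have "\<bar>(if e then X else 0) * rhs1 i k m\<bar> \<le> X ^ (1 + (12 * n + 35))"
    using X2 by (intro abs_mult_le 1) auto
  then have "\<bar>rhs i k m e\<bar> \<le> X ^ Suc (12 * n + 36)"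
    unfolding rhs_def by (intro abs_add_le[OF 0]) auto
  then show "\<bar>rhs i k m e\<bar> \<le> X ^ (12 * n + 37)" by (simp add: add.commute)
qed

lemma wp_emit_vertex':
  assumes "env m" "out m ys" "length ys + 2 * (hh + vv) \<le> cap"
    and ikm: "i < r" "k \<le> n" "mm \<in> ms i k" "v < vv"
    and m: "m (-37) = int (code i k mm)" "m (-31) = slot i v" "m (-32) = den i e v" "m (-30) = rhs i k mm e"
      "m (-33) = int v"
    and R: "\<And>m'. out m' (ys @ flat (vertex i k mm e v)) \<Longrightarrow> keeps {-35, -34, -11} m m' \<Longrightarrow> R m'"
  shows "wp emit_vertex m R"
proof -
  have big: "\<bar>u\<bar> \<le> X ^ (12 * n + 40)" if "\<bar>u\<bar> \<le> X ^ p" "p \<le> 12 * n + 40" for u p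
    using that X_mono[of p "12 * n + 40"] by linarith
  have "wp emit_vertex m (\<lambda>m'. out m' (ys @ flat (map (\<lambda>c. (m (-31) * of_bool (bit (code i k mm) c), m (-32))) [0..<hh] @
      map (\<lambda>v'. (m (-30) * of_bool (v' = v), m (-32))) [0..<vv])) \<and> keeps {-35, -34, -11} m m')"
  proof (rule wp_emit_vertex[OF assms(1-3) m(1) _ _ _ _ m(5)])
    show "int (code i k mm) \<le> X ^ (12 * n + 40)"
      using big[OF code_le[OF ikm(1,2) ms_le[OF ikm(3)]]] by simp
  qed (use big[OF slot_le[OF ikm(1,4)]] big[OF den_le[OF ikm(1,4), of e]] big[OF rhs_le(3)[OF ikm(1-3), of e]] m in simp_all)
  then show ?thesis
    by (rule wp_mono) (use m R in \<open>simp add: vertex_def\<close>)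
qed

lemma wp_emit_corner:
  fixes e s :: bool
  defines "v j \<equiv> if s then Suc (2 * j) else 2 * j"
  assumes env: "env m" and out: "out m ys" and cap_ys: "length ys + 2 * (hh + vv) \<le> cap"
    and ikm: "i < r" "k \<le> n" "mm \<in> ms i k" "j < Suc n"
    and m: "m (-37) = int (code i k mm)" "m (-24) = rhs0 i k mm" "m (-25) = rhs1 i k mm"
      "m (-21) = dens i j" "m (-22) = wt j" "m (-38) = 2 * int j"
    and R: "\<And>m'. out m' (ys @ flat (vertex i k mm e (v j))) \<Longrightarrow>
      keeps {-35, -34, -33, -32, -31, -30, -11} m m' \<Longrightarrow> R m'"
  shows "wp (emit_corner e s) m R"
proof -
  have v: "v j < vv" using ikm(4) by (auto simp: vv_def v_def)
  have vle: "\<bar>int (v j)\<bar> \<le> X ^ 2" using v X_ge(3) by linarith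
  note env' = envD[OF env]
  show ?thesis
    unfolding emit_corner_def
    apply (rule wp_set[OF _ slot_le[OF ikm(1) v]], simp add: m v_def slot_even slot_odd, simp)
    apply (rule wp_set[OF _ den_le[OF ikm(1) v, of e]], simp add: m env' den_def, simp)
    apply (rule wp_set[OF _ rhs_le(3)[OF ikm(1-3), of e]], simp add: m env' rhs_def, simp)
    apply (rule wp_set[OF _ vle], simp add: m v_def, simp)
    apply (rule wp_emit_vertex'[OF _ _ cap_ys ikm(1-3) v, where e = e])
    apply (use env out m in simp_all)[7]
    subgoal premises p for m'
      using p by (intro R) (auto simp: keeps_def)
    done
qed

lemma wp_emit_block:
  assumes env: "env m" and out: "out m ys" and cap_ys: "length ys + 8 * (hh + vv) \<le> cap"
    and ikm: "i < r" "k \<le> n" "mm \<in> ms i k" "j < Suc n"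
    and m: "m (-37) = int (code i k mm)" "m (-24) = rhs0 i k mm" "m (-25) = rhs1 i k mm"
      "m (-21) = dens i j" "m (-22) = wt j" "m (-38) = 2 * int j"
    and R: "\<And>m'. out m' (ys @ concat (map flat (block i k mm j))) \<Longrightarrow>
      keeps {-35, -34, -33, -32, -31, -30, -11} m m' \<Longrightarrow> R m'"
  shows "wp emit_block m R"
proof -
  let ?A = "{-35, -34, -33, -32, -31, -30, -11} :: int set"
  have corner: "wp (emit_corner e s) m' R'"
    if k: "keeps ?A m m'" and out: "out m' zs" and len: "length zs + 2 * (hh + vv) \<le> cap"
      and R': "\<And>m''. out m'' (zs @ flat (vertex i k mm e (if s then Suc (2 * j) else 2 * j))) \<Longrightarrow> keeps ?A m m'' \<Longrightarrow> R' m''"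
    for e s m' zs R'
  proof -
    have env': "env m'" by (rule env_keeps[OF env k]) auto
    show ?thesis
      apply (rule wp_emit_corner[OF env' out len ikm])
      apply (use m in \<open>simp_all add: keepsD[OF k]\<close>)[6]
      subgoal premises p by (rule R'[OF p(1) keeps_extend[OF k p(2)]]) simp
      done
  qed
  have len: "length (flat (vertex i k mm e v)) = 2 * (hh + vv)" for e v
    by (simp add: length_flat length_vertex)
  show ?thesis
    unfolding emit_block_def
    apply (rule wp_Seq, rule corner[OF keeps_refl out])
    subgoal using cap_ys by simp
    apply (rule wp_Seq, rule corner, assumption+)
    subgoal using cap_ys by (simp add: len)
    apply (rule wp_Seq, rule corner, assumption+)
    subgoal using cap_ys by (simp add: len)
    apply (rule corner, assumption+)
    subgoal using cap_ys by (simp add: len)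
    subgoal by (rule R) (simp_all add: block_def)
    done
qed

section \<open>Loading a factor and writing a piece\<close>

lemma val_entry:
  assumes "env m" "m (-13) = int i" "m (-20) = int j" "i < r" "j < n"
  shows "val (entry 0) m = a1 i j" "val (entry 1) m = a2 i j" "val (entry 2) m = b1 i j" "val (entry 3) m = b2 i j"
  using assms unfolding env_def Let_def by simp_all

lemma wp_load_factor:
  assumes env: "env m" and m: "m (-13) = int i" "m (-20) = int j" "i < r" "j < n" "m (-23) = (X ^ 12) ^ Suc j"
    and R: "R (m(-26 := a i j, -27 := b i j, -21 := D i j, -22 := wt (Suc j)))"
  shows "wp load_factor m R"
proof -
  have le: "\<bar>a i j\<bar> \<le> X ^ 2" "\<bar>b i j\<bar> \<le> X ^ 2" "\<bar>D i j\<bar> \<le> X ^ 2"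
    using a_le b_le D_le[of i j] D_pos[of i j] m by auto
  note eqs = a_eq[OF m(3,4)] b_eq[OF m(3,4)] D_eq[OF m(3,4)]
  let ?m1 = "m(-26 := a i j)" and ?m2 = "m(-26 := a i j, -27 := b i j)"
  have e: "env ?m1" "env ?m2" using env by simp_all
  have c: "?m1 (-13) = int i" "?m1 (-20) = int j" "?m2 (-13) = int i" "?m2 (-20) = int j" using m by simp_all
  show ?thesis
    unfolding load_factor_def
    apply (rule wp_set[OF _ le(1)])
    subgoal using val_entry[OF env m(1-4)] by (simp only: val.simps(5) eqs)
    apply simp
    apply (rule wp_set[OF _ le(2)])
    subgoal using val_entry[OF e(1) c(1,2) m(3,4)] by (simp only: val.simps(5) eqs)
    apply simp
    apply (rule wp_set[OF _ le(3)])
    subgoal using val_entry[OF e(2) c(3,4) m(3,4)] by (simp only: val.simps(5) eqs)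
    apply simp
    apply (rule wp_set_last[OF _ wt_le[of "Suc j"]])
    subgoal using envD(5)[OF env] m(5) by (simp add: wt_def weight_def)
    subgoal using m by simp
    apply simp
    subgoal by (rule R)
    done
qed

lemma wp_set_row:
  assumes env: "env m" and ikm: "i < r" "k \<le> n" "mm \<in> ms i k" "j < n"
    and m: "m (-15) = int mm" "m (-20) = int j" "m (-14) = int k" "m (-26) = a i j" "m (-27) = b i j" "m (-21) = D i j"
    and R: "R (m(-28 := slope i mm (Suc j), -29 := offset i k mm (Suc j)))"
  shows "wp set_row m R"
proof -
  have j: "Suc j < Suc n" using ikm(4) by simp
  note le = slope_le[OF ikm(1) j, of mm] offset_le[OF ikm(1-3) j]
  note e = envD[OF env]
  have set: "wp (-28 ::= e1;; -29 ::= e2) m R"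
    if "val e1 m = slope i mm (Suc j)" "val e2 (m(-28 := slope i mm (Suc j))) = offset i k mm (Suc j)" for e1 e2
    by (rule wp_set[OF that(1) le(1)], simp, rule wp_set_last[OF that(2) le(2)], simp, rule R)
  show ?thesis
    unfolding set_row_def
    by (intro wp_Cond set) (simp_all add: m e)
qed

lemma weight_base_le: "q \<le> Suc n \<Longrightarrow> \<bar>(X ^ 12) ^ q\<bar> \<le> X ^ (12 * n + 12)"
  using X_mono[of "12 * q" "12 * n + 12"] X2 by (simp add: power_mult)

lemma wp_next_factor:
  assumes env: "env m" and m: "m (-23) = (X ^ 12) ^ Suc q" "m (-20) = int q" "q < n"
    and R: "R (m(-23 := (X ^ 12) ^ Suc (Suc q), -20 := int (Suc q)))"
  shows "wp next_factor m R"
  unfolding next_factor_def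
  apply (rule wp_set[OF _ weight_base_le[of "Suc (Suc q)"]])
  subgoal using m envD[OF env] by simp
  subgoal using m by simp
  apply simp
  apply (rule wp_count[where q = q])
  subgoal using m by simp
  subgoal using m X_n by simp
  subgoal by (rule R)
  done

lemma length_block: "length (concat (map flat (block i k m j))) = 8 * (hh + vv)"
  by (simp add: block_def length_flat length_vertex)

lemma length_blocks: "length (concat (map flat (concat (map (block i k m) js)))) = length js * (8 * (hh + vv))"
  by (induction js) (simp_all add: length_block)

definition piece :: "nat \<Rightarrow> nat \<Rightarrow> nat \<Rightarrow> int list" where
  "piece i k m = concat (map flat (concat (map (block i k m) [0..<Suc n])))"

abbreviation piece_length :: nat where "piece_length \<equiv> Suc n * (8 * (hh + vv))"

lemma length_pieces: "length (concat (map (piece i k) js)) = length js * piece_length"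
  unfolding piece_def[abs_def] by (induction js) (simp_all add: length_blocks del: upt_Suc)

lemma wp_emit_piece:
  assumes env: "env m" and out: "out m ys" and cap_ys: "length ys + piece_length \<le> cap"
    and ikm: "i < r" "k \<le> n" "mm \<in> ms i k"
    and m: "m (-13) = int i" "m (-14) = int k" "m (-15) = int mm" "m (-18) = \<bar>coef i k\<bar>"
    and R: "\<And>m'. out m' (ys @ piece i k mm) \<Longrightarrow> keeps ({-38..-20} \<union> {-11}) m m' \<Longrightarrow> R m'"
  shows "wp emit_piece m R"
proof -
  let ?A = "{-38..-20} \<union> {-11} :: int set"
  let ?B = "\<lambda>q. concat (map flat (concat (map (block i k mm) [0..<q])))"
  let ?s0 = "\<lambda>q. \<Sum>j<Suc q. wt j * offset i k mm j" and ?s1 = "\<lambda>q. \<Sum>j<Suc q. wt j * slope i mm j"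
  have off: "\<bar>?s0 q\<bar> \<le> X ^ (12 * n + 35)" "\<bar>?s1 q\<bar> \<le> X ^ (12 * n + 35)" if "q \<le> n" for q
    using offset_le[OF ikm] slope_le[OF ikm(1)] that by (intro partial_sum_le; auto)+
  have mn: "mm \<le> n" by (rule ms_le[OF ikm(3)])
  have Bsuc: "?B (Suc q) = ?B q @ concat (map flat (block i k mm q))" for q by simp
  have env': "env m'" if "keeps ?A m m'" for m'
    by (rule env_keeps[OF env that]) auto
  have nY: "n \<le> Y" using Y_v by (simp add: vv_def)
  show ?thesis
    unfolding emit_piece_def
    apply (rule wp_set[OF _ code_le[OF ikm(1,2) mn]], simp add: m envD[OF env] code_def algebra_simps, simp)
    apply (rule wp_set[OF _ wt_le[of 0]], simp add: envD[OF env] wt_def weight_def, simp, simp)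
    apply (rule wp_set[OF _ off(1)[of 0]], simp add: m, simp, simp)
    apply (rule wp_const, simp, simp)
    apply (rule wp_set[OF _ weight_base_le[of "Suc 0"]], simp add: envD[OF env], simp, simp)
    apply (rule wp_const, simp, simp)
    \<comment> \<open>Row 0 is accumulated before the loop, so after q iterations the sums contain
      \<open>Suc q\<close> rows.\<close>
    apply (rule wp_Seq, rule wp_While[where k = n and I = "\<lambda>q m'. keeps ?A m m' \<and> out m' ys \<and>
      m' (-37) = int (code i k mm) \<and> m' (-20) = int q \<and> m' (-23) = (X ^ 12) ^ Suc q \<and>
      m' (-24) = ?s0 q \<and> m' (-25) = ?s1 q"])
    subgoal using out by simp
    subgoal by (rule nY)
    subgoal premises p for q m1
    proof -
      have q: "q < n" and I: "keeps ?A m m1" "out m1 ys" "m1 (-37) = int (code i k mm)" "m1 (-20) = int q"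
        "m1 (-23) = (X ^ 12) ^ Suc q" "m1 (-24) = ?s0 q" "m1 (-25) = ?s1 q" using p by auto
      note e = env'[OF I(1)]
      note k = keepsD[OF I(1)] m
      show ?thesis
        apply (rule conjI)
        subgoal using q by (simp add: I envD[OF e])
        apply (rule wp_Seq, rule wp_load_factor[OF e, of i q])
        apply (use q ikm in \<open>simp_all add: I k\<close>)[4]
        subgoal by (simp add: I)
        apply (rule wp_Seq, rule wp_set_row[where i = i and k = k and mm = mm and j = q])
        subgoal using e by simp
        apply (use q ikm in \<open>simp_all add: I k\<close>)[10]
        apply (rule wp_set[OF _ off(1)[of "Suc q"]])
        subgoal by (simp add: I)
        subgoal using q by simp
        apply simp
        apply (rule wp_set[OF _ off(2)[of "Suc q"]])
        subgoal by (simp add: I)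
        subgoal using q by simp
        apply simp
        apply (rule wp_next_factor[where q = q])
        subgoal using e by simp
        subgoal by (simp add: I)
        subgoal by (simp add: I)
        subgoal by (rule q)
        subgoal using I by simp
        done
    qed
    subgoal premises p for m1
    proof -
      have I: "keeps ?A m m1" "out m1 ys" "m1 (-37) = int (code i k mm)" "m1 (-20) = int n"
        "m1 (-24) = rhs0 i k mm" "m1 (-25) = rhs1 i k mm" using p by (auto simp: rhs0_def rhs1_def)
      note e = env'[OF I(1)]
      note k = keepsD[OF I(1)] m
      show ?thesis
        apply (rule conjI)
        subgoal by (simp add: I envD[OF e])
        apply (rule wp_const, simp, simp)
        apply (rule wp_set[OF _ wt_le[of 0]], simp add: envD[OF e] wt_def weight_def, simp, simp)
        apply (rule wp_const, simp, simp)
        apply (rule wp_Seq, rule wp_emit_block[OF _ _ _ ikm, where ys = ys and j = 0])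
        subgoal using e by simp
        subgoal using I by simp
        subgoal using cap_ys by simp
        apply (use I in simp_all)[7]
        subgoal premises p2 for m2
        proof -
          have k2: "keeps ?A m m2"
            by (rule keeps_extend[OF _ p2(2)]) (use I(1) in auto)
          note e2 = env'[OF k2]
          show ?thesis
            apply (rule wp_set[OF _ weight_base_le[of "Suc 0"]], simp add: envD[OF e2], simp, simp)
            apply (rule wp_const, simp, simp)
            \<comment> \<open>The block of row 0 is already written, so q iterations account for
              \<open>Suc q\<close> blocks.\<close>
            apply (rule wp_While[where k = n and I = "\<lambda>q m'. keeps ?A m m' \<and> out m' (ys @ ?B (Suc q)) \<and>
              m' (-37) = int (code i k mm) \<and> m' (-20) = int q \<and> m' (-23) = (X ^ 12) ^ Suc q \<and>
              m' (-24) = rhs0 i k mm \<and> m' (-25) = rhs1 i k mm"])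
            subgoal using p2(1) k2 by (simp add: keepsD[OF p2(2)] I)
            subgoal by (rule nY)
            subgoal premises p3 for q m3
            proof -
              have q: "q < n" and J: "keeps ?A m m3" "out m3 (ys @ ?B (Suc q))" "m3 (-37) = int (code i k mm)"
                "m3 (-20) = int q" "m3 (-23) = (X ^ 12) ^ Suc q" "m3 (-24) = rhs0 i k mm" "m3 (-25) = rhs1 i k mm"
                using p3 by blast+
              note e3 = env'[OF J(1)]
              note k3 = keepsD[OF J(1)] m
              show ?thesis
                apply (rule conjI)
                subgoal using q by (simp add: J envD[OF e3])
                apply (rule wp_Seq, rule wp_load_factor[OF e3, of i q])
                apply (use q ikm in \<open>simp_all add: J k3\<close>)[4]
                subgoal by (simp add: J)
                apply (rule wp_set[where p = 2 and v = "2 * int (Suc q)"])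
                subgoal by (simp add: J)
                subgoal using q X_ge(3) by (simp add: vv_def)
                apply simp
                apply (rule wp_Seq, rule wp_emit_block[OF _ _ _ ikm, where ys = "ys @ ?B (Suc q)" and j = "Suc q"])
                subgoal using e3 by simp
                subgoal using J(2) by simp
                subgoal
                proof -
                  have "Suc (Suc q) * (8 * (hh + vv)) \<le> Suc n * (8 * (hh + vv))" using q by (intro mult_le_mono1) simp
                  then show ?thesis using cap_ys unfolding length_append length_blocks by simp
                qed
                apply (use J q in simp_all)[7]
                subgoal premises p4 for m4
                proof -
                  have k4: "keeps ?A m m4"
                    by (rule keeps_extend[OF _ p4(2)]) (use J(1) in auto)
                  show ?thesis
                    apply (rule wp_next_factor[where q = q])
                    subgoal by (rule env'[OF k4])
                    subgoal by (simp add: keepsD[OF p4(2)] J)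
                    subgoal by (simp add: keepsD[OF p4(2)] J)
                    subgoal by (rule q)
                    subgoal using p4(1) k4 unfolding Bsuc[of "Suc q"] by (simp add: keepsD[OF p4(2)] J del: upt_Suc)
                    done
                qed
                done
            qed
            subgoal premises p3 for m3
              using p3 by (auto simp: piece_def envD[OF env'] intro!: R simp del: upt_Suc)
            done
        qed
        done
    qed
    done
qed

lemma n_Y: "Suc n \<le> Y"
  using Y_v by (simp add: vv_def)

text \<open>This is (n - k) (n+1 choose k+1) = (k + 2) (n+1 choose k+2) with alternating signs. At k
  = n both sides vanish, so the last update is correct as well.\<close>

lemma coef_Suc:
  assumes "k \<le> n"
  shows "((0 - coef i k) * (int n - int k)) div (int k + 2) = coef i (Suc k)"
proof -
  have "(n - k) * (Suc n choose Suc k) = Suc (Suc k) * (Suc n choose Suc (Suc k))"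
    using binomial_absorb_comp[of "Suc n" "Suc k"] Suc_times_binomial[of "Suc k" n] by simp
  then have "int (n - k) * int (Suc n choose Suc k) = int (Suc (Suc k)) * int (Suc n choose Suc (Suc k))"
    unfolding of_nat_mult[symmetric] by (rule arg_cong)
  moreover have "int (n - k) = int n - int k" "int (Suc (Suc k)) = int k + 2" using assms by simp_all
  ultimately have "(int n - int k) * int (Suc n choose Suc k) = (int k + 2) * int (Suc n choose Suc (Suc k))"
    by (simp only:)
  moreover have "(0 - s * c1 * h) * (N - K) = (- s) * c2 * h * (K + 2)" if "(N - K) * c1 = (K + 2) * c2"
    for s c1 c2 h N K :: int using that by algebra
  ultimately have "(0 - coef i k) * (int n - int k) = coef i (Suc k) * (int k + 2)"
    unfolding coef_def power_Suc mult_minus1 by blast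
  then show ?thesis by simp
qed

definition Kpart :: "nat \<Rightarrow> nat \<Rightarrow> int" where
  "Kpart i k = (if coef i k < 0 then - coef i k * (X ^ 6) ^ n else 0)"

definition shift_list :: "nat \<Rightarrow> nat \<Rightarrow> int list" where
  "shift_list i k = concat (map (piece i k) (ms_list i k))"

lemma length_shift_list: "length (shift_list i k) \<le> n * piece_length"
proof -
  have "length (ms_list i k) \<le> n" using n_pos by (simp add: ms_list_def)
  then show ?thesis unfolding shift_list_def length_pieces by (rule mult_le_mono1)
qed

abbreviation shift_tail :: program where
  "shift_tail \<equiv>
    While (var (-16) [-] var (-15)) (emit_piece;; -15 ::= var (-15) [+] Const 1);;
    -17 ::= ((Const 0 [-] var (-17)) [*] (var (-2) [-] var (-14))) [div] (var (-14) [+] Const 2);;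
    -14 ::= var (-14) [+] Const 1"

text \<open>In all three sign cases the steps m form an interval, namely {n}, {0, ..., n - 1} or the
  empty one, so one loop with variable ends serves them.\<close>

lemma wp_shift_tail:
  assumes env: "env m" and out: "out m ys" and cap_ys: "length ys + n * piece_length \<le> cap"
    and ik: "i < r" "k \<le> n" and ms: "ms_list i k = [m0..<m1]" "m0 \<le> m1" "m1 \<le> Suc n"
    and m: "m (-13) = int i" "m (-14) = int k" "m (-15) = int m0" "m (-16) = int m1" "m0 < m1 \<Longrightarrow> m (-18) = \<bar>coef i k\<bar>"
      "m (-17) = coef i k"
    and R: "\<And>m'. out m' (ys @ shift_list i k) \<Longrightarrow> m' (-14) = int (Suc k) \<Longrightarrow> m' (-17) = coef i (Suc k) \<Longrightarrow>
      keeps ({-38..-20} \<union> {-18..-14} \<union> {-11}) m m' \<Longrightarrow> R m'"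
  shows "wp shift_tail m R"
proof -
  let ?A = "{-38..-20} \<union> {-18..-14} \<union> {-11} :: int set" and ?B = "{-38..-20} \<union> {-15, -11} :: int set"
  let ?P = "\<lambda>c. concat (map (piece i k) [m0..<m0 + c])"
  have ms_set: "ms i k = {m0..<m1}" unfolding set_ms_list[symmetric] ms(1) by simp
  have "length (ms_list i k) \<le> n" using n_pos by (simp add: ms_list_def)
  then have m10: "m1 - m0 \<le> n" unfolding ms by simp
  show ?thesis
    apply (rule wp_Seq, rule wp_While[where k = "m1 - m0" and
        I = "\<lambda>c m'. keeps ?B m m' \<and> out m' (ys @ ?P c) \<and> m' (-15) = int (m0 + c)"])
    subgoal using out m by simp
    subgoal using m10 n_Y by simp
    subgoal premises p for c m2
    proof -
      have c: "m0 + c < m1" and I: "keeps ?B m m2" "out m2 (ys @ ?P c)" "m2 (-15) = int (m0 + c)" using p by auto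
      have e: "env m2" by (rule env_keeps[OF env I(1)]) auto
      note k = keepsD[OF I(1)] m(1,2,4)
      have "Suc c * piece_length \<le> n * piece_length" using c m10 by (intro mult_le_mono1) simp
      then have cap2: "length (ys @ ?P c) + piece_length \<le> cap"
        using cap_ys unfolding length_append length_pieces by simp
      show ?thesis
        apply (rule conjI)
        subgoal using c by (simp add: I k)
        apply (rule wp_Seq, rule wp_emit_piece[OF e I(2) cap2 ik, of "m0 + c"])
        subgoal using c by (simp add: ms_set)
        apply (use c m(5) in \<open>simp_all add: I k\<close>)[4]
        subgoal premises p2 for m3
        proof -
          have "keeps ?B m m3" by (rule keeps_extend[OF I(1) p2(2)]) auto
          then show ?thesis
            apply (intro wp_count[where q = "m0 + c"])
            subgoal by (simp add: keepsD[OF p2(2)] I)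
            subgoal using c ms(3) X_n by simp
            subgoal using p2(1) by simp
            done
        qed
        done
    qed
    subgoal premises p for m2
    proof -
      have I: "keeps ?B m m2" "out m2 (ys @ shift_list i k)" "m2 (-15) = int m1"
        using p ms by (simp_all add: shift_list_def)
      have k2: "keeps ?A m m2" by (rule keeps_extend[OF keeps_refl I(1)]) auto
      have e: "env m2" by (rule env_keeps[OF env k2]) auto
      note k = keepsD[OF I(1)] m
      show ?thesis
        apply (rule conjI)
        subgoal by (simp add: I k)
        apply (rule wp_set[OF _ coef_le[OF ik(1), of "Suc k"]])
        subgoal using coef_Suc[OF ik(2), of i] by (simp add: k envD[OF e])
        apply simp
        apply (rule wp_count[where q = k])
        subgoal by (simp add: k)
        subgoal using ik X_n by simp
        subgoal using I k2 by (intro R) simp_all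
        done
    qed
    done
qed

lemma wp_emit_shift:
  assumes env: "env m" and out: "out m ys" and cap_ys: "length ys + n * piece_length \<le> cap"
    and ik: "i < r" "k \<le> n"
    and m: "m (-13) = int i" "m (-14) = int k" "m (-17) = coef i k" and K: "\<bar>m (-12) + Kpart i k\<bar> \<le> X ^ (6 * n + 4)"
    and R: "\<And>m'. out m' (ys @ shift_list i k) \<Longrightarrow> m' (-12) = m (-12) + Kpart i k \<Longrightarrow>
      m' (-14) = int (Suc k) \<Longrightarrow> m' (-17) = coef i (Suc k) \<Longrightarrow>
      keeps ({-38..-20} \<union> {-18..-14} \<union> {-12, -11}) m m' \<Longrightarrow> R m'"
  shows "wp emit_shift m R"
proof -
  let ?A = "{-38..-20} \<union> {-18..-14} \<union> {-12, -11} :: int set"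
  have zero: "\<bar>0\<bar> \<le> X ^ 1" using X2 by simp
  have nn: "\<bar>int n\<bar> \<le> X ^ 1" "\<bar>int (Suc n)\<bar> \<le> X ^ 1" using X_n by simp_all
  have tail: "wp shift_tail m2 R" if ms: "ms_list i k = [m0..<m1]" "m0 \<le> m1" "m1 \<le> Suc n"
    and m2: "keeps ?A m m2" "out m2 ys" "m2 (-14) = int k" "m2 (-17) = coef i k"
      "m2 (-15) = int m0" "m2 (-16) = int m1" "m0 < m1 \<Longrightarrow> m2 (-18) = \<bar>coef i k\<bar>"
      "m2 (-12) = m (-12) + Kpart i k" for m2 m0 m1
    apply (rule wp_shift_tail[OF _ m2(2) cap_ys ik ms _ m2(3,5,6,7,4)])
    subgoal by (rule env_keeps[OF env m2(1)]) auto
    subgoal using keepsD[OF m2(1), of "-13"] m by simp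
    subgoal by assumption
    subgoal premises p for m3
    proof (rule R)
      show "m3 (-12) = m (-12) + Kpart i k" using keepsD[OF p(4), of "-12"] m2(8) by simp
      show "keeps ?A m m3" by (rule keeps_extend[OF m2(1) p(4)]) auto
    qed (use p in auto)
    done
  show ?thesis
    unfolding emit_shift_def
    apply (rule wp_Seq, rule wp_Cond)
    subgoal premises p
    proof -
      have c: "0 < coef i k" using p m by simp
      show ?thesis
        apply (rule wp_set[OF _ nn(1)], simp add: envD[OF env], simp)
        apply (rule wp_set[OF _ nn(2)], simp add: envD[OF env], simp)
        apply (rule wp_set_last[OF _ coef_le[OF ik(1), of k]])
        subgoal using c by (simp add: m)
        apply simp
        apply (rule tail[of n "Suc n"])
        apply (use c out m in \<open>simp_all add: ms_list_def Kpart_def\<close>)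
        done
    qed
    subgoal premises p
      apply (rule wp_Cond)
      subgoal premises p2
      proof -
        have c: "coef i k < 0" using p2 m by simp
        show ?thesis
          apply (rule wp_const, simp, simp)
          apply (rule wp_set[OF _ nn(1)], simp add: envD[OF env], simp)
          apply (rule wp_set[where v = "- coef i k" and p = 2])
          subgoal by (simp add: m)
          subgoal using coef_le[OF ik(1), of k] by simp
          apply simp
          apply (rule wp_set_last[OF _ K])
          subgoal using c by (simp add: envD[OF env] Kpart_def)
          apply simp
          apply (rule tail[of 0 n])
          apply (use c out m in \<open>simp_all add: ms_list_def Kpart_def\<close>)
          done
      qed
      subgoal premises p2
      proof -
        have c: "coef i k = 0" using p p2 m by simp
        show ?thesis
          apply (rule wp_const, simp, simp)
          apply (rule wp_set_last[OF _ zero])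
          apply simp_all[2]
          apply (rule tail[of 0 0])
          apply (use c out m in \<open>simp_all add: ms_list_def Kpart_def\<close>)
          done
      qed
      done
    done
qed

section \<open>The loops over shifts and summands\<close>

definition summand_list :: "nat \<Rightarrow> int list" where
  "summand_list i = concat (map (shift_list i) [0..<Suc n])"

lemma length_shift_lists: "length (concat (map (shift_list i) js)) \<le> length js * (n * piece_length)"
  using length_shift_list by (induction js) (auto intro: add_mono)

lemma length_summand_list: "length (summand_list i) \<le> Suc n * (n * piece_length)"
  unfolding summand_list_def using length_shift_lists[of i "[0..<Suc n]"] by simp

text \<open>The content of cell -12 once all summands before i and the first k shifts of summand i
  are done.\<close>

definition Ksum :: "nat \<Rightarrow> nat \<Rightarrow> int" where
  "Ksum i k = (\<Sum>i'<i. \<Sum>k'\<le>n. Kpart i' k') + (\<Sum>k'<k. Kpart i k')"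

lemma Ksum_le:
  assumes "i < r" "k \<le> Suc n" shows "\<bar>Ksum i k\<bar> \<le> X ^ (6 * n + 4)"
proof -
  have part: "0 \<le> Kpart i' k'" "Kpart i' k' \<le> X ^ (6 * n + 2)" if "i' < r" for i' k'
  proof -
    show "0 \<le> Kpart i' k'" using X2 by (simp add: Kpart_def mult_nonpos_nonneg)
    have "\<bar>coef i' k' * (X ^ 6) ^ n\<bar> \<le> X ^ (2 + 6 * n)"
      using X2 by (intro abs_mult_le coef_le that) (simp add: power_mult)
    then have "\<bar>coef i' k' * (X ^ 6) ^ n\<bar> \<le> X ^ (6 * n + 2)" by (simp only: add.commute)
    moreover have "Kpart i' k' \<le> \<bar>coef i' k' * (X ^ 6) ^ n\<bar>" unfolding Kpart_def using abs_ge_minus_self[of "coef i' k' * (X ^ 6) ^ n"] by simp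
    ultimately show "Kpart i' k' \<le> X ^ (6 * n + 2)" by (rule order_trans[rotated])
  qed
  have "Ksum i k \<le> int i * (int (Suc n) * X ^ (6 * n + 2)) + int k * X ^ (6 * n + 2)"
    unfolding Ksum_def
  proof (rule add_mono)
    have "(\<Sum>k'\<le>n. Kpart i' k') \<le> int (Suc n) * X ^ (6 * n + 2)" if "i' < r" for i'
      using sum_bounded_above[of "{..n}" "Kpart i'" "X ^ (6 * n + 2)"] part that by simp
    then show "(\<Sum>i'<i. \<Sum>k'\<le>n. Kpart i' k') \<le> int i * (int (Suc n) * X ^ (6 * n + 2))"
      using sum_bounded_above[of "{..<i}" "\<lambda>i'. \<Sum>k'\<le>n. Kpart i' k'" "int (Suc n) * X ^ (6 * n + 2)"] assms by simp
    show "(\<Sum>k'<k. Kpart i k') \<le> int k * X ^ (6 * n + 2)"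
      using sum_bounded_above[of "{..<k}" "Kpart i" "X ^ (6 * n + 2)"] part assms by simp
  qed
  also have "\<dots> \<le> int i * (int (Suc n) * X ^ (6 * n + 2)) + int (Suc n) * X ^ (6 * n + 2)"
    using assms X2 by (intro add_left_mono mult_right_mono) auto
  also have "\<dots> = int (Suc i) * int (Suc n) * X ^ (6 * n + 2)" by (simp add: algebra_simps)
  also have "\<dots> \<le> X * X * X ^ (6 * n + 2)"
    using assms X_n X_r X2 by (intro mult_mono) auto
  also have "\<dots> = X ^ (6 * n + 4)" by (simp add: power_add power_numeral_reduce)
  finally have "Ksum i k \<le> X ^ (6 * n + 4)" .
  moreover have "0 \<le> Ksum i k"
    unfolding Ksum_def using assms part by (intro add_nonneg_nonneg sum_nonneg) auto
  ultimately show ?thesis by simp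
qed

lemma Ksum_Suc: "Ksum (Suc i) 0 = Ksum i (Suc n)"
  unfolding Ksum_def lessThan_Suc_atMost[of n] by simp

lemma wp_emit_summand:
  assumes env: "env m" and out: "out m ys" and cap_ys: "length ys + Suc n * (n * piece_length) \<le> cap"
    and i: "i < r" and m: "m (-13) = int i" "m (-12) = Ksum i 0"
    and R: "\<And>m'. out m' (ys @ summand_list i) \<Longrightarrow> m' (-12) = Ksum (Suc i) 0 \<Longrightarrow>
      m' (-13) = int (Suc i) \<Longrightarrow> keeps {-38..-11} m m' \<Longrightarrow> R m'"
  shows "wp emit_summand m R"
proof -
  let ?A = "{-38..-20} \<union> {-18..-14} \<union> {-12, -11} :: int set"
  let ?S = "\<lambda>k. concat (map (shift_list i) [0..<k])"
  have g: "m (-104 - int i) = g i" using env i by (simp add: env_def)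
  show ?thesis
    unfolding emit_summand_def
    apply (rule wp_set[OF _ coef_le[OF i, of 0]])
    subgoal using g by (simp add: m envD[OF env] coef_def)
    apply simp
    apply (rule wp_const, simp, simp)
    apply (rule wp_Seq, rule wp_While[where k = "Suc n" and I = "\<lambda>k m'. keeps ?A m m' \<and> out m' (ys @ ?S k) \<and>
      m' (-12) = Ksum i k \<and> m' (-14) = int k \<and> m' (-17) = coef i k"])
    subgoal using out m by simp
    subgoal by (rule n_Y)
    subgoal premises p for k m2
    proof -
      have k: "k \<le> n" and I: "keeps ?A m m2" "out m2 (ys @ ?S k)" "m2 (-12) = Ksum i k" "m2 (-14) = int k" "m2 (-17) = coef i k"
        using p by auto
      have e: "env m2" by (rule env_keeps[OF env I(1)]) auto
      have "Suc k * (n * piece_length) \<le> Suc n * (n * piece_length)" using k by (intro mult_le_mono1) simp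
      moreover have "length (?S k) \<le> k * (n * piece_length)" using length_shift_lists[of i "[0..<k]"] by simp
      moreover have "y + l + w \<le> cap" if "l \<le> k * w" "Suc k * w \<le> Suc n * w" "y + Suc n * w \<le> cap"
        for y l w using that unfolding mult_Suc by linarith
      ultimately have cap2: "length (ys @ ?S k) + n * piece_length \<le> cap"
        using cap_ys unfolding length_append by blast
      have K: "m2 (-12) + Kpart i k = Ksum i (Suc k)" using I by (simp add: Ksum_def)
      show ?thesis
        apply (rule conjI)
        subgoal using k by (simp add: I envD[OF e])
        apply (rule wp_emit_shift[OF e I(2) cap2 i k _ I(4,5)])
        subgoal by (simp add: keepsD[OF I(1)] m)
        subgoal unfolding K using k i by (intro Ksum_le) auto
        subgoal premises p2 for m3
          using p2 K keeps_extend[OF I(1) p2(5)] by simp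
        done
    qed
    subgoal premises p for m2
    proof -
      have I: "keeps ?A m m2" "out m2 (ys @ summand_list i)" "m2 (-12) = Ksum (Suc i) 0" "m2 (-14) = int (Suc n)"
        using p by (simp_all add: summand_list_def Ksum_Suc)
      have e: "env m2" by (rule env_keeps[OF env I(1)]) auto
      have k: "keeps {-38..-11} m m2" using I(1) by (auto simp: keeps_def)
      show ?thesis
        apply (rule conjI)
        subgoal using I by (simp add: envD[OF e])
        apply (rule wp_count[where q = i])
        subgoal by (simp add: keepsD[OF I(1)] m)
        subgoal using i X_r by simp
        subgoal using I k by (intro R) simp_all
        done
    qed
    done
qed

lemma summand_lists: "concat (map summand_list [0..<r]) = concat (map flat all_vertices)"
proof -
  have *: "map flat (concat (map f xs)) = concat (map (\<lambda>x. map flat (f x)) xs)" for f and xs :: "nat list"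
    by (simp add: map_concat o_def)
  have **: "concat (concat (map f xs)) = concat (map (\<lambda>x. concat (f x)) xs)" for f and xs :: "nat list"
    by (induction xs) auto
  show ?thesis
    unfolding all_vertices_def summand_list_def shift_list_def[abs_def] piece_def[abs_def] * ** ..
qed

lemma length_summand_lists: "length (concat (map summand_list [0..<i])) \<le> i * (Suc n * (n * piece_length))"
  using length_summand_list by (induction i) (auto intro: add_mono simp: add.commute)

lemma length_all_le: "length (concat (map flat all_vertices)) \<le> r * (Suc n * (n * piece_length))"
  unfolding summand_lists[symmetric] by (rule length_summand_lists)

text \<open>Hence the program recovers the number of vertices for the header by an exact division of
  the output length.\<close>

lemma length_all: "length (concat (map flat all_vertices)) = 2 * (hh + vv) * length all_vertices"
proof -
  have "length w = hh + vv" if "w \<in> set all_vertices" for w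
  proof -
    obtain p where "w = (\<lambda>((i, k, m), e, v). vertex i k m e v) p" using \<open>w \<in> set all_vertices\<close> unfolding set_all_vertices by blast
    then show ?thesis by (cases p) (auto simp: length_vertex split: prod.splits)
  qed
  moreover have "length (concat (map flat ws)) = 2 * (hh + vv) * length ws" if "\<And>w. w \<in> set ws \<Longrightarrow> length w = hh + vv" for ws
    using that by (induction ws) (simp_all add: length_flat)
  ultimately show ?thesis by blast
qed

lemma wp_emit_all:
  assumes env: "env m" and total: "r * (Suc n * (n * piece_length)) \<le> cap"
    and R: "\<And>m'. holds_list m' result \<Longrightarrow> R m'"
  shows "wp emit_all m R"
proof -
  let ?A = "{-38..-11} :: int set"
  let ?S = "\<lambda>i. concat (map summand_list [0..<i])"
  have five: "\<bar>5\<bar> \<le> X ^ 4" using X4 by simp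
  note len = length_summand_lists
  let ?L = "length (concat (map flat all_vertices))"
  have L: "?L \<le> cap" using length_all_le total by linarith
  have capX: "\<bar>int x\<bar> \<le> X ^ (12 * n + 40)" if "x \<le> cap + 5" for x using that cap by simp
  have KK: "Ksum r 0 = KK" by (simp add: Ksum_def KK_def Kpart_def)
  have KK_le: "\<bar>KK\<bar> \<le> X ^ (6 * n + 4)"
  proof (cases r)
    case 0
    then have "KK = 0" unfolding KK_def by simp
    then show ?thesis using X2 by simp
  next
    case (Suc r')
    have "KK = Ksum (Suc r') 0" by (subst Suc[symmetric]) (rule KK[symmetric])
    then show ?thesis using Ksum_le[of r' "Suc n"] Suc Ksum_Suc by simp
  qed
  have hv: "0 < hh + vv" by (simp add: hh_def)
  have "1 * length all_vertices \<le> 2 * (hh + vv) * length all_vertices"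
    using hv by (intro mult_le_mono1) presburger
  then have count: "length all_vertices \<le> ?L" unfolding length_all mult_1 .
  show ?thesis
    unfolding emit_all_def
    apply (rule wp_set[OF _ five])
    apply simp_all[2]
    apply (rule wp_const, simp, simp)
    apply (rule wp_const, simp, simp)
    apply (rule wp_Seq, rule wp_While[where k = r and I = "\<lambda>i m'. keeps ?A m m' \<and> out m' (?S i) \<and>
      m' (-12) = Ksum i 0 \<and> m' (-13) = int i"])
    subgoal by (simp add: out_def Ksum_def)
    subgoal by (rule Y_r)
    subgoal premises p for i m2
    proof -
      have i: "i < r" and I: "keeps ?A m m2" "out m2 (?S i)" "m2 (-12) = Ksum i 0" "m2 (-13) = int i"
        using p by auto
      have e: "env m2" by (rule env_keeps[OF env I(1)]) auto
      have "Suc i * (Suc n * (n * piece_length)) \<le> r * (Suc n * (n * piece_length))" using i by (intro mult_le_mono1) simp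
      then have cap2: "length (?S i) + Suc n * (n * piece_length) \<le> cap"
        using total len[of i] by simp
      show ?thesis
        apply (rule conjI)
        subgoal using i by (simp add: I envD[OF e])
        apply (rule wp_emit_summand[OF e I(2) cap2 i I(4,3)])
        subgoal premises p2 for m3
          using p2 keeps_extend[OF I(1) p2(4)] by simp
        done
    qed
    subgoal premises p for m2
    proof -
      have I: "keeps ?A m m2" "out m2 (concat (map flat all_vertices))" "m2 (-12) = KK" "m2 (-13) = int r"
        using p by (simp_all add: summand_lists KK)
      have e: "env m2" by (rule env_keeps[OF env I(1)]) auto
      have o: "m2 (-11) = 5 + int ?L" using I(2) by (simp add: out_def)
      show ?thesis
        apply (rule conjI)
        subgoal using I by (simp add: envD[OF e])
        apply (rule wp_set[where p = "5" and v = "int (hh + vv)"])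
        subgoal by (simp add: envD[OF e] vv_def)
        subgoal
        proof -
          have "X ^ 2 \<le> X ^ 4" by (rule X_mono) simp
          then have "int (hh + vv) \<le> 2 * X ^ 4" using X_ge(2,3) by simp
          also have "\<dots> \<le> X * X ^ 4" using X2 by (intro mult_right_mono) auto
          finally show ?thesis by (simp add: power_numeral_reduce)
        qed
        apply simp
        apply (rule wp_set[OF _ KK_le], simp add: I, simp)
        apply (rule wp_set[where p = 2 and v = "X ^ 2"], simp add: envD[OF e], simp, simp)
        apply (rule wp_set[where p = "12 * n + 40" and v = "int (length all_vertices)"])
        subgoal
        proof -
          have "int (2 * (hh + vv) * length all_vertices) div (2 * int (hh + vv)) = int (length all_vertices)"
            unfolding of_nat_mult of_nat_numeral by (rule nonzero_mult_div_cancel_left) (use hv in presburger)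
          then show ?thesis by (simp add: o length_all)
        qed
        subgoal using count L by (intro capX) simp
        apply simp
        apply (rule wp_set_last[where p = "12 * n + 40" and v = "int (4 + ?L)"])
        subgoal by (simp add: o)
        subgoal using L by (intro capX) simp
        apply simp
        subgoal premises
        proof (rule R)
          let ?m = "m2(1 := int (hh + vv), 2 := KK, 3 := X ^ 2, 4 := int (length all_vertices), 0 := int (4 + ?L))"
          have at: "m2 (5 + int i) = concat (map flat all_vertices) ! i" if "i < ?L" for i
            using I(2) that by (simp add: out_def)
          have "?m (int i + 1) = result ! i" if "i < length result" for i
          proof -
            consider "i = 0" | "i = 1" | "i = 2" | "i = 3" | "4 \<le> i" by linarith
            then show ?thesis
            proof cases
              case 5
              then have eq: "int i + 1 = 5 + int (i - 4)" by simp
              have gen: "?m (5 + int x) = m2 (5 + int x)" for x by simp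
              have "length result = 4 + ?L" by (simp only: result_def length_append list.size One_nat_def)
              then have "i - 4 < ?L" using 5 that by linarith
              then have "?m (int i + 1) = concat (map flat all_vertices) ! (i - 4)"
                unfolding eq gen by (rule at)
              also have "\<dots> = result ! i" unfolding result_def using 5 by (subst nth_append) (simp add: numeral_eq_Suc)
              finally show ?thesis .
            qed (simp_all add: result_def)
          qed
          moreover have "?m 0 = int (length result)" by (simp add: result_def)
          ultimately show "holds_list ?m result" unfolding holds_list_def by blast
        qed
        done
    qed
    done
qed

end

section \<open>The scale X of an input\<close>

lemma prod_list_ge_one: "(\<And>x. x \<in> set xs \<Longrightarrow> 1 \<le> x) \<Longrightarrow> 1 \<le> prod_list xs"
  for xs :: "int list"
proof (induction xs)
  case (Cons x xs)
  then have "1 \<le> x" "1 \<le> prod_list xs" by auto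
  then have "1 * 1 \<le> x * prod_list xs" by (intro mult_mono) auto
  then show ?case by simp
qed simp

lemma prod_list_ge_member:
  fixes xs :: "int list"
  assumes "x \<in> set xs" "\<And>x. x \<in> set xs \<Longrightarrow> 1 \<le> x" shows "x \<le> prod_list xs"
  using assms
proof (induction xs)
  case (Cons y ys)
  have "1 \<le> y" "1 \<le> prod_list ys" using Cons.prems(2) by (auto intro!: prod_list_ge_one)
  show ?case
  proof (cases "x = y")
    case True
    have "y * 1 \<le> y * prod_list ys" using \<open>1 \<le> y\<close> \<open>1 \<le> prod_list ys\<close> by (intro mult_left_mono) auto
    then show ?thesis using True by simp
  next
    case False
    then have "x \<le> prod_list ys" using Cons by auto
    moreover have "1 * prod_list ys \<le> y * prod_list ys"
      using \<open>1 \<le> y\<close> \<open>1 \<le> prod_list ys\<close> by (intro mult_right_mono) auto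
    ultimately show ?thesis by simp
  qed
qed simp

definition size_factor :: "int \<Rightarrow> int" where
  "size_factor x = x * x + 2"

lemma size_factor_ge: "2 \<le> size_factor x" "1 \<le> size_factor x" "\<bar>x\<bar> + 1 \<le> size_factor x"
proof -
  have "0 \<le> x * x" by simp
  then show "2 \<le> size_factor x" "1 \<le> size_factor x" unfolding size_factor_def by linarith+
  have "\<bar>x\<bar> * 2 \<le> x * x + 1"
    using zero_le_square[of "\<bar>x\<bar> - 1"] by (simp add: algebra_simps abs_mult_self_eq)
  then show "\<bar>x\<bar> + 1 \<le> size_factor x" unfolding size_factor_def by linarith
qed

text \<open>A product rather than a maximum: besides bounding every entry it exceeds 2 to the length
  of the list, which controls the binomials, and it is computed without comparisons.\<close>

definition size_bound :: "int list \<Rightarrow> int" where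
  "size_bound xs = prod_list (map size_factor (int (length xs) # xs))"

lemma size_bound_ge:
  assumes "x \<in> set (int (length xs) # xs)"
  shows "\<bar>x\<bar> + 1 \<le> size_bound xs"
proof -
  have "size_factor x \<le> size_bound xs"
    unfolding size_bound_def using assms size_factor_ge(2) by (intro prod_list_ge_member) auto
  then show ?thesis using size_factor_ge(3)[of x] by linarith
qed

lemma size_bound_pow: "2 ^ Suc (length xs) \<le> size_bound xs"
proof -
  have "2 ^ length ys \<le> prod_list (map size_factor ys)" for ys
  proof (induction ys)
    case (Cons y ys)
    then show ?case using size_factor_ge(1)[of y] by (simp add: mult_mono)
  qed simp
  from this[of "int (length xs) # xs"] show ?thesis unfolding size_bound_def by simp
qed

lemma length_le_bit_size: "length xs \<le> bit_size xs"
proof (induction xs)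
  case (Cons x xs)
  then show ?case using bits_pos[of x] by (simp add: bit_size_def)
qed (simp add: bit_size_def)

text \<open>Bit lengths add under multiplication. The factor for the length of the list is absorbed
  because every entry is charged at least one bit.\<close>

lemma size_bound_le: "size_bound xs \<le> 2 ^ (4 * bit_size xs + 2)"
proof -
  have factor: "size_factor x \<le> 2 ^ (2 * bits x)" for x
  proof -
    have "\<bar>x\<bar> < 2 ^ (bits x - 1)" by (rule abs_less_bits)
    then have "\<bar>x\<bar> * \<bar>x\<bar> \<le> (2 ^ (bits x - 1)) * (2 ^ (bits x - 1))" by (intro mult_mono) auto
    also have "\<dots> = (2 :: int) ^ (2 * (bits x - 1))" by (simp add: power_add mult_2)
    finally have "x * x + 2 \<le> 2 ^ (2 * (bits x - 1)) + 2" by (simp add: abs_mult_self_eq)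
    also have "\<dots> \<le> 4 * 2 ^ (2 * (bits x - 1))"
      using one_le_power[of "2 :: int" "2 * (bits x - 1)"] by linarith
    also have "\<dots> = 2 ^ (2 * (bits x - 1) + 2)" by (simp add: power_add)
    also have "2 * (bits x - 1) + 2 = 2 * bits x" using bits_pos[of x] by simp
    finally show ?thesis by (simp add: size_factor_def)
  qed
  have "prod_list (map size_factor ys) \<le> 2 ^ (2 * bit_size ys)" for ys
  proof (induction ys)
    case (Cons y ys)
    have "0 \<le> prod_list (map size_factor ys)"
      using prod_list_ge_one[of "map size_factor ys"] size_factor_ge(2) by fastforce
    then have "size_factor y * prod_list (map size_factor ys) \<le> 2 ^ (2 * bits y) * 2 ^ (2 * bit_size ys)"
      using Cons factor by (intro mult_mono) auto
    then show ?case by (simp add: bit_size_def power_add distrib_left)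
  qed (simp add: bit_size_def)
  from this[of "int (length xs) # xs"]
  have "size_bound xs \<le> 2 ^ (2 * (bits (int (length xs)) + bit_size xs))"
    by (simp add: size_bound_def bit_size_def)
  also have "\<dots> \<le> 2 ^ (4 * bit_size xs + 2)"
  proof (rule power_increasing)
    have "bits (int (length xs)) \<le> Suc (length xs)"
      unfolding bits_le_iff using of_nat_less_two_power[of "length xs", where 'a = int] by simp
    then show "2 * (bits (int (length xs)) + bit_size xs) \<le> 4 * bit_size xs + 2"
      using length_le_bit_size[of xs] by simp
  qed simp
  finally show ?thesis .
qed

lemma initial_memory_nth:
  "c \<le> length xs \<Longrightarrow> initial_memory xs (int c) = (int (length xs) # xs) ! c"
  by (cases c) (auto simp: initial_memory_def)

context floor_program begin

lemma wp_copy_input: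
  assumes X: "X = size_bound xs" and Y: "Suc (length xs) \<le> Y"
    and R: "\<And>m'. m' (-3) = X \<Longrightarrow> (\<And>c. c \<le> length xs \<Longrightarrow> m' (-100 - int c) = (int (length xs) # xs) ! c) \<Longrightarrow> R m'"
  shows "wp copy_input (initial_memory xs) R"
proof -
  let ?L = "int (length xs) # xs" and ?m = "initial_memory xs"
  let ?P = "\<lambda>c. prod_list (map size_factor (take c ?L))"
  have P: "\<bar>?P c\<bar> \<le> X ^ 1" for c
  proof -
    have ge: "1 \<le> prod_list (map size_factor ys)" for ys
      using size_factor_ge(2) by (intro prod_list_ge_one) auto
    have "?P c * 1 \<le> ?P c * prod_list (map size_factor (drop c ?L))"
      using ge[of "take c ?L"] ge[of "drop c ?L"] by (intro mult_left_mono) auto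
    also have "\<dots> = X"
      unfolding X size_bound_def prod_list.append[symmetric] map_append[symmetric] append_take_drop_id ..
    finally show ?thesis using ge[of "take c ?L"] by simp
  qed
  have entry_le: "\<bar>?L ! c\<bar> \<le> X ^ 1" if "c \<le> length xs" for c
  proof -
    have "?L ! c \<in> set ?L" using that by (intro nth_mem) simp
    from size_bound_ge[OF this] show ?thesis using X by simp
  qed
  have len_X: "int (length xs) + 1 \<le> X" using size_bound_ge[of "int (length xs)" xs] X by simp
  show ?thesis
    unfolding copy_input_def
    apply (rule wp_const, simp, simp)
    apply (rule wp_const, simp, simp)
    apply (rule wp_While[where k = "Suc (length xs)" and I = "\<lambda>c m'. m' (-35) = int c \<and> m' (-3) = ?P c \<and>
      (\<forall>x\<ge>0. m' x = ?m x) \<and> (\<forall>c'<c. m' (-100 - int c') = ?L ! c')"])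
    apply simp
    subgoal by (rule Y)
    subgoal premises p for c m2
    proof -
      have c: "c \<le> length xs" and I: "m2 (-35) = int c" "m2 (-3) = ?P c" "\<And>x. 0 \<le> x \<Longrightarrow> m2 x = ?m x"
        "\<And>c'. c' < c \<Longrightarrow> m2 (-100 - int c') = ?L ! c'" using p by auto
      have at: "m2 (int c) = ?L ! c" using I(3)[of "int c"] initial_memory_nth[OF c] by simp
      have Psuc: "?P (Suc c) = ?P c * size_factor (?L ! c)"
        using c by (subst take_Suc_conv_app_nth) auto
      show ?thesis
        apply (rule conjI)
        subgoal using c I(3)[of 0] I(1) by (simp add: initial_memory_def)
        apply (rule wp_set[OF _ P[of "Suc c"]])
        subgoal unfolding Psuc by (simp add: I(1,2) at size_factor_def)
        apply simp
        apply (rule wp_Seq, rule wp_Assign)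
        subgoal using bits_leI[OF entry_le[OF c]] by (simp add: I(1) at)
        apply (rule wp_count[where q = c])
        subgoal by (simp add: I(1))
        subgoal using c len_X by simp
        subgoal
        proof (intro conjI allI impI)
          fix c' assume "c' < Suc c"
          then show "((m2(-3 := ?P (Suc c)))(val (Const (- 100) [-] var (- 35)) (m2(-3 := ?P (Suc c))) :=
            val (Cell (var (- 35))) (m2(-3 := ?P (Suc c))), -35 := int (Suc c))) (-100 - int c') = ?L ! c'"
            using I(4)[of c'] by (cases "c' = c") (simp_all add: I(1) at)
        qed (use I in simp_all)
        done
    qed
    subgoal premises p for m2
    proof -
      have "m2 0 = int (length xs)" using p by (simp add: initial_memory_def)
      moreover have "?P (Suc (length xs)) = X" by (simp add: X size_bound_def)
      ultimately show ?thesis using p by (auto intro!: R)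
    qed
    done
qed

lemma wp_set_constants:
  assumes X: "m (-3) = X" and rn: "m (-102) = int r" "m (-103) = int n"
    and g: "\<And>i. i < r \<Longrightarrow> m (-104 - int i) = g i"
    and ab: "\<And>i j. i < r \<Longrightarrow> j < n \<Longrightarrow> let c = -104 - int r - 4 * (int i * int n + int j) in
      m c = a1 i j \<and> m (c - 1) = a2 i j \<and> m (c - 2) = b1 i j \<and> m (c - 3) = b2 i j"
    and lg_min: "\<And>c. c < lg \<Longrightarrow> 2 ^ c < r" and lg_Y: "lg \<le> Y"
    and R: "\<And>m'. env m' \<Longrightarrow> R m'"
  shows "wp set_constants m R"
proof -
  let ?inp = "\<lambda>m'. \<forall>x\<le>-100. m' x = m x"
  have le: "int n \<le> X" "int r \<le> X" "int lg \<le> X" using X_ge X_r X_lg by simp_all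
  have X4: "2 * X \<le> X ^ 2" "2 * X ^ 2 \<le> X ^ 3" "2 * X ^ 3 \<le> X ^ 4"
    using mult_right_mono[of 2 X X] mult_right_mono[of 2 X "X ^ 2"] mult_right_mono[of 2 X "X ^ 3"] X2
    by (simp_all add: power_numeral_reduce)
  have nY: "n \<le> Y" using n_Y by simp
  have P: "\<bar>(X ^ 12) ^ (c + 2)\<bar> \<le> X ^ (12 * n + 24)" "\<bar>(X ^ 6) ^ c\<bar> \<le> X ^ (6 * n)" if "c \<le> n" for c
    using X_mono[of "12 * c + 24" "12 * n + 24"] X_mono[of "6 * c" "6 * n"] that X2
    by (simp_all add: power_add flip: power_mult)
  have pow: "\<bar>X ^ p\<bar> \<le> X ^ p" for p using X2 by simp
  show ?thesis
    unfolding set_constants_def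
    apply (rule wp_set[where v = "int r" and p = 1])
    subgoal by (simp add: rn)
    subgoal using le by simp
    apply simp
    apply (rule wp_set[where v = "int n" and p = 1])
    subgoal by (simp add: rn)
    subgoal using le by simp
    apply simp
    apply (rule wp_set[where v = "1 + 2 * int n" and p = 4])
    apply simp
    subgoal using le X2 X4 by simp
    apply simp
    apply (rule wp_const, simp, simp)
    \<comment> \<open>Minimality of \<open>lg\<close> keeps the guard r - 2^c positive for every c <
      lg.\<close>
    apply (rule wp_Seq, rule wp_While[where k = lg and I = "\<lambda>c m'. m' (-35) = 2 ^ c \<and> m' (-4) = 1 + 2 * int n + int c \<and>
      m' (-1) = int r \<and> m' (-2) = int n \<and> m' (-3) = X \<and> ?inp m'"])
    subgoal by (simp add: X)
    subgoal by (rule lg_Y)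
    subgoal premises p for c m2
    proof -
      have c: "c < lg" and I: "m2 (-35) = 2 ^ c" "m2 (-4) = 1 + 2 * int n + int c" "m2 (-1) = int r"
        "m2 (-2) = int n" "m2 (-3) = X" "?inp m2" using p by auto
      have "int (2 ^ c) < int r" using lg_min[OF c] by (simp only: of_nat_less_iff)
      then have c2: "2 ^ c < int r" by simp
      have "(2 :: int) ^ Suc c \<le> 2 * X" unfolding power_Suc using c2 le(2) by linarith
      moreover have "\<bar>2 ^ Suc c\<bar> = (2 :: int) ^ Suc c" by simp
      ultimately have c3: "\<bar>2 ^ Suc c\<bar> \<le> X ^ 2" using X4(1) by linarith
      show ?thesis
        apply (rule conjI)
        subgoal using c2 by (simp add: I)
        apply (rule wp_set[where v = "2 ^ Suc c" and p = 2])
        subgoal by (simp add: I)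
        subgoal by (rule c3)
        apply simp
        apply (rule wp_set_last[where v = "1 + 2 * int n + int (Suc c)" and p = 4])
        subgoal by (simp add: I)
        subgoal using c le X2 X4 by simp
        apply simp
        subgoal using I by simp
        done
    qed
    subgoal premises p for m2
    proof -
      have I: "m2 (-35) = 2 ^ lg" "m2 (-4) = int hh" "m2 (-1) = int r"
        "m2 (-2) = int n" "m2 (-3) = X" "?inp m2" using p by (auto simp: hh_def)
      have "int r \<le> 2 ^ lg" using of_nat_mono[OF lg, where 'a = int] by simp
      then show ?thesis
        apply (intro conjI)
        subgoal by (simp add: I)
        apply (rule wp_set[OF _ pow[of 2]], simp add: I power2_eq_square, simp)
        apply (rule wp_set[OF _ pow[of 4]], simp add: power_numeral_reduce, simp)
        apply (rule wp_set[OF _ pow[of 6]], simp add: power_numeral_reduce, simp)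
        apply (rule wp_set[OF _ pow[of 12]], simp flip: power_add, simp)
        apply (rule wp_set[OF _ P(1)[of 0]], simp add: power2_eq_square, simp, simp)
        apply (rule wp_set[OF _ P(2)[of 0]])
        apply simp_all[3]
        apply (rule wp_const, simp, simp)
        apply (rule wp_While[where k = n and I = "\<lambda>c m'. m' (-35) = int c \<and> m' (-5) = (X ^ 12) ^ (c + 2) \<and>
          m' (-6) = (X ^ 6) ^ c \<and> m' (-1) = int r \<and> m' (-2) = int n \<and> m' (-3) = X \<and> m' (-4) = int hh \<and>
          m' (-10) = X ^ 2 \<and> m' (-7) = X ^ 4 \<and> m' (-9) = X ^ 6 \<and> m' (-8) = X ^ 12 \<and> ?inp m'"])
        subgoal using I by simp
        subgoal by (rule nY)
        subgoal premises p for c m3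
        proof -
          have c: "c < n" using p by simp
          show ?thesis
            apply (rule conjI)
            subgoal using p by simp
            apply (rule wp_set[OF _ P(1)[of "Suc c"]])
            subgoal using p by simp
            subgoal using c by simp
            apply simp
            apply (rule wp_set[OF _ P(2)[of "Suc c"]])
            subgoal using p by simp
            subgoal using c by simp
            apply simp
            apply (rule wp_count[where q = c])
            subgoal using p by simp
            subgoal using c le by simp
            subgoal using p by simp
            done
        qed
        subgoal premises p for m3
        proof -
          have inp: "m3 x = m x" if "x \<le> -100" for x using p that by blast
          have "env m3"
            unfolding env_def Let_def
          proof (intro conjI allI impI)
            fix i assume "i < r"
            then show "m3 (-104 - int i) = g i" using g[of i] inp by simp
          next
            fix i j assume ij: "i < r" "j < n"
            let ?c = "-104 - int r - 4 * (int i * int n + int j)"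
            have "0 \<le> 4 * (int i * int n + int j)" by simp
            then have le: "?c \<le> -100" by linarith
            then have "?c - 1 \<le> -100" "?c - 2 \<le> -100" "?c - 3 \<le> -100" by linarith+
            then show "m3 ?c = a1 i j" "m3 (?c - 1) = a2 i j" "m3 (?c - 2) = b1 i j" "m3 (?c - 3) = b2 i j"
              using ab[OF ij] inp le unfolding Let_def by simp_all
          qed (use p in simp_all)
          then show ?thesis using p R by simp
        qed
        done
    qed
    done
qed

lemma polytope_program_correct:
  assumes X: "X = size_bound xs" and Y: "Suc (length xs) \<le> Y" "lg \<le> Y"
    and total: "r * (Suc n * (n * piece_length)) \<le> cap" and lg_min: "\<And>c. c < lg \<Longrightarrow> 2 ^ c < r"
    and len: "length xs = 3 + r + 4 * (r * n)" and xs: "xs ! 1 = int r" "xs ! 2 = int n"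
    and g: "\<And>i. i < r \<Longrightarrow> xs ! (3 + i) = g i"
    and ab: "\<And>i j. i < r \<Longrightarrow> j < n \<Longrightarrow> let c = 3 + r + 4 * (i * n + j) in
      xs ! c = a1 i j \<and> xs ! (c + 1) = a2 i j \<and> xs ! (c + 2) = b1 i j \<and> xs ! (c + 3) = b2 i j"
  shows "\<exists>s m. exec polytope_program (initial_memory xs) s m \<and> s \<le> time_bound \<beta> Y polytope_program \<and>
    small m \<and> holds_list m result"
proof -
  have "wp polytope_program (initial_memory xs) (\<lambda>m. holds_list m result)"
    unfolding polytope_program_def
  proof (rule wp_Seq, rule wp_copy_input[OF X Y(1)], rule wp_Seq)
    fix m assume m: "m (-3) = X" and m': "\<And>c. c \<le> length xs \<Longrightarrow> m (-100 - int c) = (int (length xs) # xs) ! c"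
    have at: "m (-101 - int c) = xs ! c" if "c < length xs" for c using m'[of "Suc c"] that by simp
    show "wp set_constants m (\<lambda>m'. wp emit_all m' (\<lambda>m. holds_list m result))"
    proof (rule wp_set_constants[where m = m])
      show "m (-3) = X" by (rule m)
      show "m (-102) = int r" "m (-103) = int n" using at[of 1] at[of 2] xs len by simp_all
      show "m (-104 - int i) = g i" if "i < r" for i using at[of "3 + i"] g[OF that] that len by simp
      show "let c = -104 - int r - 4 * (int i * int n + int j) in
        m c = a1 i j \<and> m (c - 1) = a2 i j \<and> m (c - 2) = b1 i j \<and> m (c - 3) = b2 i j" if ij: "i < r" "j < n" for i j
      proof -
        define c where "c = 3 + r + 4 * (i * n + j)"
        have "i * n + j < Suc i * n" using ij by simp
        also have "\<dots> \<le> r * n" using ij by (intro mult_le_mono1) simp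
        finally have "Suc (i * n + j) \<le> r * n" by simp
        then have "4 * Suc (i * n + j) \<le> 4 * (r * n)" by (rule mult_le_mono2)
        then have "c + 3 < length xs" using len by (simp add: c_def)
        then have "m (-101 - int c) = xs ! c" "m (-101 - int (c + 1)) = xs ! (c + 1)"
          "m (-101 - int (c + 2)) = xs ! (c + 2)" "m (-101 - int (c + 3)) = xs ! (c + 3)"
          by (intro at; linarith)+
        moreover have "-101 - int c = -104 - int r - 4 * (int i * int n + int j)"
          "-101 - int (c + 1) = -104 - int r - 4 * (int i * int n + int j) - 1"
          "-101 - int (c + 2) = -104 - int r - 4 * (int i * int n + int j) - 2"
          "-101 - int (c + 3) = -104 - int r - 4 * (int i * int n + int j) - 3" by (simp_all add: c_def)
        ultimately show ?thesis using ab[OF ij] unfolding Let_def c_def[symmetric] by (simp only:)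
      qed
      show "wp emit_all m' (\<lambda>m. holds_list m result)" if "env m'" for m'
        by (rule wp_emit_all[OF that total]) assumption
    qed (use lg_min Y in auto)
  qed
  moreover have "small (initial_memory xs)"
    unfolding small_def
  proof
    fix x
    have "\<bar>initial_memory xs x\<bar> \<le> X ^ 1"
    proof (cases "0 \<le> x \<and> x \<le> int (length xs)")
      case True
      then obtain c where c: "x = int c" "c \<le> length xs" by (metis nat_0_le nat_le_iff)
      then have "(int (length xs) # xs) ! c \<in> set (int (length xs) # xs)" by (intro nth_mem) simp
      from size_bound_ge[OF this] show ?thesis using X c by (simp add: initial_memory_nth)
    next
      case False
      then show ?thesis using X2 by (auto simp: initial_memory_def)
    qed
    then show "bits (initial_memory xs x) \<le> \<beta>" by (rule bits_leI) simp
  qed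
  ultimately show ?thesis unfolding wp_def by blast
qed

end

section \<open>The encoding of the input\<close>

lemma length_concat_uniform:
  assumes "\<And>ys. ys \<in> set xss \<Longrightarrow> length ys = l" shows "length (concat xss) = length xss * l"
  using assms by (induction xss) auto

lemma nth_concat_uniform:
  assumes "\<And>ys. ys \<in> set xss \<Longrightarrow> length ys = l" "i < length xss" "j < l"
  shows "concat xss ! (i * l + j) = xss ! i ! j"
  using assms
proof (induction xss arbitrary: i)
  case (Cons ys xss)
  then show ?case by (cases i) (auto simp: nth_append add.assoc)
qed simp

definition rat_entries :: "rat \<Rightarrow> rat \<Rightarrow> int list" where
  "rat_entries p q = encode_rat p @ encode_rat q"

lemma encode_input_props:
  fixes N r n \<gamma> \<alpha> \<beta>
  defines "xs \<equiv> encode_input N r n \<gamma> \<alpha> \<beta>"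
  shows "length xs = 3 + r + 4 * (r * n)" and "xs ! 0 = int N" "xs ! 1 = int r" "xs ! 2 = int n"
    and "i < r \<Longrightarrow> xs ! (3 + i) = \<gamma> (Suc i)"
    and "i < r \<Longrightarrow> j < n \<Longrightarrow> e < 4 \<Longrightarrow>
      xs ! (3 + r + 4 * (i * n + j) + e) = rat_entries (\<alpha> (Suc i) (Suc j)) (\<beta> (Suc i) (Suc j)) ! e"
proof -
  let ?G = "\<lambda>i j. rat_entries (\<alpha> i j) (\<beta> i j)"
  let ?F = "\<lambda>i. concat (map (?G i) [1..<Suc n])"
  have xs: "xs = [int N, int r, int n] @ map \<gamma> [1..<Suc r] @ concat (map ?F [1..<Suc r])"
    by (simp add: xs_def encode_input_def rat_entries_def del: upt_Suc)
  have G: "length (?G i j) = 4" for i j by (simp add: rat_entries_def encode_rat_def)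
  have F: "length (?F i) = 4 * n" for i
    by (subst length_concat_uniform[where l = 4]) (auto simp: G)
  have FF: "length (concat (map ?F [1..<Suc r])) = r * (4 * n)"
    by (subst length_concat_uniform[where l = "4 * n"]) (auto simp: F simp del: upt_Suc One_nat_def)
  show "length xs = 3 + r + 4 * (r * n)" unfolding xs by (simp only: length_append FF) simp
  show "xs ! 0 = int N" "xs ! 1 = int r" "xs ! 2 = int n" by (simp_all add: xs)
  show "xs ! (3 + i) = \<gamma> (Suc i)" if "i < r"
    using that by (simp add: xs nth_append del: upt_Suc)
  show "xs ! (3 + r + 4 * (i * n + j) + e) = ?G (Suc i) (Suc j) ! e" if "i < r" "j < n" "e < 4"
  proof -
    have je: "j * 4 + e < 4 * n" using that by linarith
    have "xs ! (3 + r + 4 * (i * n + j) + e) = concat (map ?F [1..<Suc r]) ! (4 * (i * n + j) + e)"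
      by (simp add: xs nth_append add.assoc del: upt_Suc)
    also have "4 * (i * n + j) + e = i * (4 * n) + (j * 4 + e)" by (simp add: algebra_simps)
    also have "concat (map ?F [1..<Suc r]) ! (i * (4 * n) + (j * 4 + e)) = map ?F [1..<Suc r] ! i ! (j * 4 + e)"
    proof (rule nth_concat_uniform[OF _ _ je])
      show "length ys = 4 * n" if "ys \<in> set (map ?F [1..<Suc r])" for ys
        using that F by (auto simp del: upt_Suc One_nat_def)
    qed (use that in \<open>simp del: upt_Suc\<close>)
    also have "\<dots> = ?F (Suc i) ! (j * 4 + e)" using that by (simp del: upt_Suc)
    also have "\<dots> = map (?G (Suc i)) [1..<Suc n] ! j ! e"
    proof (rule nth_concat_uniform[OF _ _ that(3)])
      show "length ys = 4" if "ys \<in> set (map (?G (Suc i)) [1..<Suc n])" for ys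
        using that G by (auto simp del: upt_Suc One_nat_def)
    qed (use that in \<open>simp del: upt_Suc\<close>)
    also have "\<dots> = ?G (Suc i) (Suc j) ! e" using that by (simp del: upt_Suc)
    finally show ?thesis .
  qed
qed

text \<open>The common denominator stays unreduced, so the program never computes a greatest common
  divisor.\<close>

lemma floor_fractions:
  assumes "0 < a2" "0 < b2"
  shows "\<lfloor>of_int a1 / of_int a2 * of_int t + of_int b1 / (of_int b2 :: rat)\<rfloor> =
    (a1 * b2 * t + b1 * a2) div (a2 * b2)"
proof -
  have "of_int a1 / of_int a2 * of_int t + of_int b1 / (of_int b2 :: rat) =
    of_int (a1 * b2 * t + b1 * a2) / of_int (a2 * b2)"
    using assms by (simp add: field_simps)
  then show ?thesis by (simp only: floor_divide_of_int_eq)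
qed

section \<open>Polynomial-time construction\<close>

text \<open>X is at most 2^(4S+2) and n at most S, so X^(12n+40) is at most 2 to the product of the
  two linear factors; the final 2 covers equality and the extra 1 in \<open>bits\<close>.\<close>

definition bit_poly :: "nat poly" where "bit_poly = [:2, 4:] * [:40, 12:] + 2"

text \<open>A generous common bound for the iterations of all loops, which run over input entries,
  summands, label bits, axes, factors, shifts or telescoping steps.\<close>

definition loop_poly :: "nat poly" where "loop_poly = [:10, 4:]"

lemma poly_bit_poly: "poly bit_poly S = (4 * S + 2) * (12 * S + 40) + 2"
  by (simp add: bit_poly_def algebra_simps)

lemma poly_loop_poly: "poly loop_poly S = 4 * S + 10"
  by (simp add: loop_poly_def)

lemma ehrhart_polytope_computable:
  fixes N r n :: nat and \<gamma> :: "nat \<Rightarrow> int" and \<alpha> \<beta> :: "nat \<Rightarrow> nat \<Rightarrow> rat"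
  assumes r: "1 \<le> r" and n: "1 \<le> n"
  defines "xs \<equiv> encode_input N r n \<gamma> \<alpha> \<beta>"
  defines "bb \<equiv> poly bit_poly (bit_size xs)" and "yy \<equiv> poly loop_poly (bit_size xs)"
  shows "\<exists>d Q K M. rational_polytope d Q \<and>
    (\<forall>t<N. floor_quasi_poly r n \<gamma> \<alpha> \<beta> (int t) + int K = int (ehrhart Q (t + M))) \<and>
    real d \<le> 7 * (real n + of_int \<lceil>log 2 (real r)\<rceil>) \<and>
    card (vertices Q) \<le> r * 4 ^ (n + 1) \<and>
    (\<exists>ys T. computes polytope_program xs ys T \<and> encodes_output d (vertices Q) K M ys \<and>
      T \<le> time_bound bb yy polytope_program + (4 + 16 * yy ^ 5) * bb)"
proof -
  note props = encode_input_props[where N = N and r = r and n = n and \<gamma> = \<gamma> and \<alpha> = \<alpha> and \<beta> = \<beta>, folded xs_def]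
  define X where "X = size_bound xs"
  define S where "S = bit_size xs"
  \<comment> \<open>The exponent found by the doubling loop; being the least one it is at most
    \<lceil>log 2 r\<rceil>, as the dimension bound requires.\<close>
  define lg where "lg = (LEAST c. r \<le> 2 ^ c)"
  define g where "g i = \<gamma> (Suc i)" for i
  define a1 where "a1 i j = fst (quotient_of (\<alpha> (Suc i) (Suc j)))" for i j
  define a2 where "a2 i j = snd (quotient_of (\<alpha> (Suc i) (Suc j)))" for i j
  define b1 where "b1 i j = fst (quotient_of (\<beta> (Suc i) (Suc j)))" for i j
  define b2 where "b2 i j = snd (quotient_of (\<beta> (Suc i) (Suc j)))" for i j
  define a where "a i j = a1 i j * b2 i j" for i j
  define b where "b i j = b1 i j * a2 i j" for i j
  define D where "D i j = a2 i j * b2 i j" for i j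
  define dd where "dd = (1 + lg + 2 * n) + 2 * Suc n"
  define cap where "cap = r * (Suc n * (n * (Suc n * (8 * dd))))"
  have rr: "r \<le> 2 ^ r" using less_exp[of r] by simp
  have lg: "r \<le> 2 ^ lg" unfolding lg_def using rr by (rule LeastI)
  have lg_r: "lg \<le> r" unfolding lg_def using rr by (rule Least_le)
  have lg_min: "2 ^ c < r" if "c < lg" for c using not_less_Least[of c "\<lambda>c. r \<le> 2 ^ c"] that by (simp add: lg_def)
  have entries: "xs ! (3 + r + 4 * (i * n + j)) = a1 i j" "xs ! (3 + r + 4 * (i * n + j) + 1) = a2 i j"
    "xs ! (3 + r + 4 * (i * n + j) + 2) = b1 i j" "xs ! (3 + r + 4 * (i * n + j) + 3) = b2 i j"
    if "i < r" "j < n" for i j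
    using props(6)[OF that, of 0] props(6)[OF that, of 1] props(6)[OF that, of 2] props(6)[OF that, of 3]
    by (simp_all add: rat_entries_def encode_rat_def a1_def a2_def b1_def b2_def numeral_eq_Suc)
  have entry_le: "\<bar>xs ! c\<bar> + 1 \<le> X" if "c < length xs" for c
    unfolding X_def using that by (intro size_bound_ge) simp
  have X_len: "int (length xs) + 1 \<le> X" using size_bound_ge[of "int (length xs)" xs] by (simp add: X_def)
  have rn: "n \<le> r * n" "r \<le> r * n" using r n by simp_all
  have len: "r + n + 2 \<le> length xs" "2 * n + 3 \<le> length xs" unfolding props(1) using rn by linarith+
  have X_n: "int n + 2 \<le> X" "int r \<le> X" using X_len len(1) by linarith+
  have X2: "2 \<le> X" using X_n by linarith
  have X_lg: "int lg \<le> X" using lg_r X_n by linarith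
  have "(2::int) ^ (n + 1) \<le> 2 ^ Suc (length xs)" using len by (intro power_increasing) auto
  then have X_pow: "2 ^ (n + 1) \<le> X" using size_bound_pow[of xs] by (simp only: X_def)
  \<comment> \<open>N is itself an input entry, so every t < N lies in the range [0, X] covered by
    the bundle.\<close>
  have X_N: "int N \<le> X" using entry_le[of 0] props(1,2) by simp
  have idx: "3 + r + 4 * (i * n + j) + 3 < length xs" if "i < r" "j < n" for i j
  proof -
    have "i * n + j < Suc i * n" using that by simp
    also have "\<dots> \<le> r * n" using that by (intro mult_le_mono1) simp
    finally show ?thesis unfolding props(1) by simp
  qed
  have ab_le: "\<bar>a1 i j\<bar> \<le> X" "\<bar>a2 i j\<bar> \<le> X" "\<bar>b1 i j\<bar> \<le> X" "\<bar>b2 i j\<bar> \<le> X" if "i < r" "j < n" for i j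
  proof -
    let ?c = "3 + r + 4 * (i * n + j)"
    have "?c < length xs" "?c + 1 < length xs" "?c + 2 < length xs" "?c + 3 < length xs"
      using idx[OF that] by simp_all
    from this[THEN entry_le] show "\<bar>a1 i j\<bar> \<le> X" "\<bar>a2 i j\<bar> \<le> X" "\<bar>b1 i j\<bar> \<le> X" "\<bar>b2 i j\<bar> \<le> X"
      unfolding entries[OF that] by linarith+
  qed
  have pos: "0 < a2 i j" "0 < b2 i j" for i j
    by (simp_all add: a2_def b2_def quotient_of_denom_pos')
  have mult_le: "\<bar>u * v\<bar> \<le> X ^ 2" if "\<bar>u\<bar> \<le> X" "\<bar>v\<bar> \<le> X" for u v
    unfolding abs_mult power2_eq_square using that X2 by (intro mult_mono) auto
  have lens: "length xs \<le> S" unfolding S_def by (rule length_le_bit_size)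
  have dd_X: "int dd \<le> X ^ 4"
  proof -
    have "int dd \<le> 5 * X" using X_n X_lg by (simp add: dd_def)
    also have "\<dots> \<le> X ^ 3 * X"
      using X2 power_mono[of 2 X 3] by (intro mult_right_mono) auto
    finally show ?thesis by (simp add: power_numeral_reduce)
  qed
  have cap_X: "int cap + 5 \<le> X ^ (12 * n + 40)"
  proof -
    have 8: "8 \<le> X ^ 3" using power_mono[of 2 X 3] X2 by simp
    have "int cap = int r * (int (Suc n) * (int n * (int (Suc n) * (8 * int dd))))"
      by (simp only: cap_def of_nat_mult of_nat_numeral)
    also have "\<dots> \<le> X * (X * (X * (X * (X ^ 3 * X ^ 4))))"
      using X_n X2 8 dd_X by (intro mult_mono) auto
    also have "\<dots> = X ^ 11" by (simp add: power_numeral_reduce)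
    finally have "int cap \<le> X ^ 11" .
    moreover have "5 \<le> X ^ 11" using power_mono[of 2 X 11] X2 by simp
    moreover have "2 * X ^ 11 \<le> X ^ 12" using X2 mult_right_mono[of 2 X "X ^ 11"] by (simp add: power_numeral_reduce)
    moreover have "X ^ 12 \<le> X ^ (12 * n + 40)" using X2 by (intro power_increasing) auto
    ultimately show ?thesis by linarith
  qed
  have bits_le: "bits v \<le> bb" if "\<bar>v\<bar> \<le> X ^ (12 * n + 40)" for v
  proof -
    let ?e = "(4 * S + 2) * (12 * S + 40)"
    have "X ^ (12 * n + 40) \<le> (2 ^ (4 * S + 2)) ^ (12 * n + 40)"
      using size_bound_le[of xs] X2 by (intro power_mono) (simp_all add: X_def S_def)
    also have "\<dots> \<le> (2 :: int) ^ ?e"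
      unfolding power_mult[symmetric] using len lens by (intro power_increasing mult_le_mono2) auto
    finally have "\<bar>v\<bar> \<le> 2 ^ ?e" using that by linarith
    then have "\<bar>v\<bar> < 2 ^ Suc ?e" using zero_less_power[of "2 :: int" ?e] unfolding power_Suc by linarith
    then have "bits v \<le> Suc (Suc ?e)" unfolding bits_le_iff .
    then show ?thesis by (simp add: bb_def poly_bit_poly S_def)
  qed
  have yy: "yy = 4 * S + 10" by (simp add: yy_def poly_loop_poly S_def)
  interpret F: floor_instance r n lg X g a b D
  proof
    show "\<bar>g i\<bar> \<le> X" if "i < r" for i
      using entry_le[of "3 + i"] props(5)[OF that] that unfolding g_def props(1) by simp
    show "\<bar>a i j\<bar> \<le> X ^ 2" "\<bar>b i j\<bar> \<le> X ^ 2" "0 < D i j" "D i j \<le> X ^ 2" if "i < r" "j < n" for i j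
      using ab_le[OF that] pos[of i j] mult_le[of "a1 i j" "b2 i j"] mult_le[of "b1 i j" "a2 i j"] mult_le[of "a2 i j" "b2 i j"]
      by (simp_all add: a_def b_def D_def)
  qed (use n X_n X_pow lg in auto)
  have dd: "F.hh + F.vv = dd" by (simp add: F.hh_def F.vv_def dd_def)
  interpret P: floor_program r n lg X g a b D bb yy a1 a2 b1 b2 cap
  proof
    show "0 < bb" by (simp add: bb_def poly_bit_poly)
    show "r \<le> yy" "F.hh \<le> yy" "F.vv \<le> yy"
      using len lens lg_r by (simp_all add: yy F.hh_def F.vv_def)
  qed (use bits_le cap_X X_n X_lg in \<open>simp_all add: a_def b_def D_def\<close>)
  have cap_eq: "r * (Suc n * (n * (Suc n * (8 * (F.hh + F.vv))))) = cap" by (simp add: cap_def dd)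
  have "\<exists>s m. exec polytope_program (initial_memory xs) s m \<and> s \<le> time_bound bb yy polytope_program \<and>
    P.small m \<and> holds_list m F.result"
  proof (rule P.polytope_program_correct[OF X_def])
    show "Suc (length xs) \<le> yy" "lg \<le> yy" using len lens lg_r by (simp_all add: yy)
    show "r * (Suc n * (n * (Suc n * (8 * (F.hh + F.vv))))) \<le> cap" by (simp only: cap_eq)
    show "xs ! (3 + i) = g i" if "i < r" for i using props(5)[OF that] by (simp add: g_def)
    show "let c = 3 + r + 4 * (i * n + j) in xs ! c = a1 i j \<and> xs ! (c + 1) = a2 i j \<and> xs ! (c + 2) = b1 i j \<and> xs ! (c + 3) = b2 i j"
      if "i < r" "j < n" for i j unfolding Let_def using entries[OF that] by blast
  qed (use lg_min props in auto)
  then obtain s m where run: "exec polytope_program (initial_memory xs) s m"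
    "s \<le> time_bound bb yy polytope_program" "P.small m" "holds_list m F.result" by blast
  \<comment> \<open>The output entries are cells of the final memory and therefore small, so their
    number times the bit bound limits the charge for the output.\<close>
  have size: "bit_size F.result \<le> (4 + 16 * yy ^ 5) * bb"
  proof -
    have "bits x \<le> bb" if "x \<in> set F.result" for x
      using that run(3,4) unfolding in_set_conv_nth holds_list_def P.small_def by metis
    then have "bit_size F.result \<le> length F.result * bb"
      unfolding bit_size_def using sum_list_mono[of F.result bits "\<lambda>_. bb"] by (simp add: sum_list_triv)
    also have "length F.result \<le> 4 + cap"
      using P.length_all_le unfolding cap_eq F.result_def by simp
    also have "cap \<le> yy * (yy * (yy * (yy * (16 * yy))))"
      unfolding cap_def using len lens lg_r by (intro mult_le_mono) (simp_all add: yy dd_def)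
    also have "\<dots> = 16 * yy ^ 5" by (simp add: power_numeral_reduce)
    finally show ?thesis by simp
  qed
  have quasi: "floor_quasi_poly r n \<gamma> \<alpha> \<beta> t = F.total t" for t
  proof -
    have "\<lfloor>\<alpha> (Suc i) (Suc j) * of_int t + \<beta> (Suc i) (Suc j)\<rfloor> = F.val_floor i j t" for i j
    proof -
      have "\<alpha> (Suc i) (Suc j) = of_int (a1 i j) / of_int (a2 i j)" "\<beta> (Suc i) (Suc j) = of_int (b1 i j) / of_int (b2 i j)"
        unfolding a1_def a2_def b1_def b2_def by (rule quotient_of_div, simp)+
      then show ?thesis unfolding F.val_floor_def a_def b_def D_def using floor_fractions[OF pos] by simp
    qed
    then show ?thesis
      unfolding floor_quasi_poly_def F.total_def One_nat_def sum.atLeast1_atMost_eq[unfolded One_nat_def]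
        prod.atLeast1_atMost_eq[unfolded One_nat_def] g_def by simp
  qed
  have lg_log: "int lg \<le> \<lceil>log 2 (real r)\<rceil>"
  proof (cases lg)
    case 0
    have "0 \<le> log 2 (real r)" using r by simp
    then show ?thesis using 0 by simp
  next
    case (Suc l)
    then have "2 ^ l < r" using lg_min by simp
    then have "real (2 ^ l) < real r" by (simp only: of_nat_less_iff)
    then have "real l < log 2 (real r)" by (simp add: less_log_iff powr_realpow)
    then show ?thesis using Suc by linarith
  qed
  have ceil0: "0 \<le> \<lceil>log 2 (real r)\<rceil>" using lg_log by linarith
  show ?thesis
  proof (intro exI conjI allI impI)
    show "rational_polytope (F.hh + F.vv) F.B.Q" by (rule F.rational_polytope_Q)
    show "floor_quasi_poly r n \<gamma> \<alpha> \<beta> (int t) + int (nat F.KK) = int (ehrhart F.B.Q (t + nat (X ^ 2)))" if "t < N" for t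
      using F.ehrhart_eq[of t] that X_N F.KK_nonneg by (simp add: quasi)
    \<comment> \<open>The dimension is 3 + \<open>lg\<close> + 4 n, and 3 \<le> 3 n; this is the
      origin of the constant 7.\<close>
    show "real (F.hh + F.vv) \<le> 7 * (real n + of_int \<lceil>log 2 (real r)\<rceil>)"
    proof -
      have "real lg \<le> of_int \<lceil>log 2 (real r)\<rceil>" using lg_log by linarith
      moreover have "(0::real) \<le> of_int \<lceil>log 2 (real r)\<rceil>" using ceil0 by simp
      moreover have "real (F.hh + F.vv) = 3 + real lg + 4 * real n" unfolding dd dd_def by simp
      moreover have "1 \<le> real n" using n by simp
      ultimately show ?thesis by argo
    qed
    show "card (vertices F.B.Q) \<le> r * 4 ^ (n + 1)" by (rule F.card_vertices_le)
    show "computes polytope_program xs F.result (s + bit_size F.result)"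
      unfolding computes_def using run by blast
    show "encodes_output (F.hh + F.vv) (vertices F.B.Q) (nat F.KK) (nat (X ^ 2)) F.result" by (rule F.encodes_output_Q)
    show "s + bit_size F.result \<le> time_bound bb yy polytope_program + (4 + 16 * yy ^ 5) * bb"
      using run(2) size by linarith
  qed
qed

theorem theorem1p5:
  shows "\<exists>(C :: real) (P :: program) (q :: nat poly).
    \<forall>(N :: nat) (r :: nat) (n :: nat) (\<gamma> :: nat \<Rightarrow> int)
      (\<alpha> :: nat \<Rightarrow> nat \<Rightarrow> rat) (\<beta> :: nat \<Rightarrow> nat \<Rightarrow> rat).
      1 \<le> r \<longrightarrow> 1 \<le> n \<longrightarrow>
      (\<exists>(d :: nat) (Q :: seqspace set) (K :: nat) (M :: nat).
         rational_polytope d Q \<and>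
         (\<forall>t<N. floor_quasi_poly r n \<gamma> \<alpha> \<beta> (int t) + int K = int (ehrhart Q (t + M))) \<and>
         real d \<le> C * (real n + of_int \<lceil>log 2 (real r)\<rceil>) \<and>
         card (vertices Q) \<le> r * 4 ^ (n + 1) \<and>
         (\<exists>ys T. computes P (encode_input N r n \<gamma> \<alpha> \<beta>) ys T \<and>
                 encodes_output d (vertices Q) K M ys \<and>
                 T \<le> poly q (bit_size (encode_input N r n \<gamma> \<alpha> \<beta>))))"
proof -
  obtain q where q: "\<And>S. time_bound (poly bit_poly S) (poly loop_poly S) polytope_program = poly q S"
    using time_bound_poly by metis
  have eq: "time_bound (poly bit_poly S) (poly loop_poly S) polytope_program + (4 + 16 * poly loop_poly S ^ 5) * poly bit_poly S =
    poly (q + (4 + 16 * loop_poly ^ 5) * bit_poly) S" for S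
    unfolding q by simp
  show ?thesis
    apply (rule exI[of _ 7], rule exI[of _ polytope_program], rule exI[of _ "q + (4 + 16 * loop_poly ^ 5) * bit_poly"])
    apply (intro allI impI)
    apply (rule ehrhart_polytope_computable[unfolded eq])
    apply assumption+
    done
qed

end
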